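(* Let $\mathcal K$ be a long virtual knot and $A$ an abelian group. (1) Let $\delta$ be an invariant 1-cycle on the diagrams of $\mathcal K$ with coefficients in $A$. Then the formula $\pi_D(v)=\delta_{NE}-\delta_{SW}=\delta_{SE}-\delta_{NW}$ (values of $\delta_D$ on the arcs at $v$, in the notation of the context) defines a quasi-index $\pi$ on the diagrams of $\mathcal K$ with coefficients in $A$ such that, for some $\rho\in A$ and any diagram $D$ of $\mathcal K$, $$\delta_D=\sum_{v\in\mathcal V(D)}o(v)\,\pi_D(v)\cdot D^c_v+\rho D.\qquad( * )$$ (2) Let $\pi$ be a quasi-index on the diagrams of $\mathcal K$ with coefficients in $A$ and let $\rho\in A$ be an arbitrary element. Then formula $( * )$ defines an invariant 1-cycle on the diagrams of $\mathcal K$ with coefficients in $A$, and the formula $$p^\pi_D(v)=-o(v)\sum_{v'\in\mathcal V(D)}o(v')\,\pi_D(v')\cdot(D^c_v\cdot D^c_{v'})-ip_D(v)\cdot\rho$$ defines an oriented parity $p^\pi$ on the diagrams of $\mathcal K$ with coefficients in $A$.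
   Context: Long knots. A long virtual knot diagram $D$ is a generic immersion of the oriented line $\mathbb R$ into $\mathbb R^2$ coinciding with the axis $Ox$ outside a large disc, each double point being marked classical (with over/under information) or virtual. A long virtual knot is a class of such diagrams modulo isotopy, classical Reidemeister moves R1, R2, R3 and detour moves (replacing a path containing only virtual crossings by another path with the same ends containing only virtual crossings). $\mathcal V(D)$ is the set of classical crossings; $\mathcal A(D)$ is the set of arcs, i.e. pieces of $D$ between consecutive classical crossings, including the two unbounded end pieces. A move $f\colon D\to D'$ induces a partial bijection $f_*\colon\mathcal V(D)\to\mathcal V(D')$ between surviving crossings. Arcs $a\in\mathcal A(D)$, $a'\in\mathcal A(D')$ are correspondent under a Reidemeister move if they share a point outside the region of the move; isotopies and detour moves induce a bijection of arcs. Local picture. Draw a classical crossing $v$ with both strands directed upward: the incoming arcs are SW, SE, the outgoing ones NW, NE, and the strands run SW$\to$NE and SE$\to$NW. The oriented smoothing at $v$ splits $D$ into the left half $D^l_v$ (containing the NW and SW ends at $v$) and the right half $D^r_v$ (containing the NE and SE ends). One half is a closed path, the closed half $D^c_v$; the other is the open half. The order is $o(v)=1$ if $D^c_v=D^r_v$ and $o(v)=-1$ if $D^c_v=D^l_v$. If a triangle $\Delta$ has a corner at $v$, then $\epsilon_\Delta(v)=+1$ if $\Delta$ lies to the left or right of $v$ (between SW and NW, or between SE and NE) and $-1$ if it lies above or below $v$. Chains. $C_1(D,A)$ is the group of $A$-linear combinations of arcs; $H_1(D,A)$ is the subgroup of 1-cycles: at each classical crossing the sum of the values on the incoming arcs equals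 the sum on the outgoing arcs. $D$ denotes the cycle equal to $1$ on every arc. For a closed path $C$ in $D$ and a 1-cycle $\delta$, $C\cdot\delta$ is the intersection number on the oriented ribbon surface of $D$ (virtual crossings ignored): push $C$ off $D$ and sum the values of $\delta$ at the transverse intersections with sign $+1$ when (tangent of $C$, tangent of arc) is positively oriented and $-1$ otherwise. The index parity is $ip_D(v)=o(v)\,(D^c_v\cdot D)\in\mathbb Z$, which agrees with the usual formula $ip_D(v)=-(D^l_v\cdot D)$. A family $\gamma_D\in C_1(D,A)$ is invariant if $\gamma_D(a)=\gamma_{D'}(a')$ for every move $D\to D'$ and all correspondent arcs $a,a'$. Quasi-index. A family of maps $\pi_D\colon\mathcal V(D)\to A$ for all diagrams $D$ of $\mathcal K$ such that: (Q0) for any Reidemeister move $f\colon D\to D'$ and any crossing $v\in\mathcal V(D)$ which does not take part in the move, $\pi_D(v)=\pi_{D'}(f_*(v))$; (Q2) $\pi_D(v_1)=\pi_D(v_2)$ for any $v_1,v_2$ to which a decreasing R2 can be applied; (Q3) if $v_1,v_2,v_3$ take part in an R3 move $f\colon D\to D'$ with disappearing triangle $\Delta$, then there is $\lambda(f)\in A$ with $\pi_{D'}(f_*(v_i))=\pi_D(v_i)+\epsilon_\Delta(v_i)\lambda(f)$, $i=1,2,3$. Oriented parity. A family of maps $p_D\colon\mathcal V(D)\to A$ for all diagrams $D$ of $\mathcal K$ such that: (P0) $p_D(v)=p_{D'}(f_*(v))$ for every move $f\colon D\to D'$ and every $v$ for which $f_*(v)$ exists; (P1) $p_D(v)=0$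 if $v$ disappears in a decreasing R1; (P2) $p_D(v_1)+p_D(v_2)=0$ if $v_1,v_2$ disappear in a decreasing R2; (P3+) $\sum_{i=1}^3\epsilon_\Delta(v_i)p_D(v_i)=0$ if $v_1,v_2,v_3$ are the vertices of the disappearing triangle $\Delta$ of an R3.
   Formalization: In (Q0) a quasi-index is required to be preserved also by isotopies and detour moves, not only by Reidemeister moves; otherwise (2) fails, e.g. for π_D(v) = the number of virtual crossings of D. *)

theory Defs
  imports "HOL-Analysis.Analysis"
begin

section \<open>Long virtual knot diagrams\<close>

text \<open>
  The plane is the complex plane. A diagram is a parametrised curve together with the set of
  parameters at which the curve runs over at a classical crossing. A double point is
  classical if one of its two parameters lies in this set, and virtual otherwise.
\<close>

record diagram =
  curve :: "real \<Rightarrow> complex"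
  overpasses :: "real set"

definition orient :: "complex \<Rightarrow> complex \<Rightarrow> real" where
  \<comment> \<open>the determinant of the pair; positive iff the pair is positively oriented\<close>
  "orient u w = Im (cnj u * w)"

definition velocity :: "diagram \<Rightarrow> real \<Rightarrow> complex" where
  "velocity D t = vector_derivative (curve D) (at t)"

definition long_diagram :: "diagram \<Rightarrow> bool" where
  "long_diagram D \<longleftrightarrow>
     curve D C1_differentiable_on UNIV \<and>
     (\<forall>t. velocity D t \<noteq> 0) \<and>
     (\<exists>R>0. (\<forall>t. \<bar>t\<bar> \<ge> R \<longrightarrow> curve D t = of_real t) \<and> (\<forall>t. \<bar>t\<bar> < R \<longrightarrow> cmod (curve D t) < R)) \<and>
     (\<forall>s t u. curve D s = curve D t \<and> curve D t = curve D u \<longrightarrow> s = t \<or> t = u \<or> s = u) \<and>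
     (\<forall>s t. s \<noteq> t \<and> curve D s = curve D t \<longrightarrow> orient (velocity D s) (velocity D t) \<noteq> 0) \<and>
     finite (overpasses D) \<and>
     (\<forall>t\<in>overpasses D. \<exists>s. s \<noteq> t \<and> s \<notin> overpasses D \<and> curve D s = curve D t)"

definition crossings :: "diagram \<Rightarrow> complex set" where
  "crossings D = curve D ` overpasses D"

definition crossing_params :: "diagram \<Rightarrow> real set" where
  "crossing_params D = {t. curve D t \<in> crossings D}"

text \<open>
  Arcs, and more generally pieces of the diagram, are represented by sets of parameters.
\<close>

definition arcs :: "diagram \<Rightarrow> real set set" where
  "arcs D = components (- crossing_params D)"

definition arc_before :: "diagram \<Rightarrow> real \<Rightarrow> real set" where
  "arc_before D t = {x. x < t \<and> {x..<t} \<inter> crossing_params D = {}}"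

definition arc_after :: "diagram \<Rightarrow> real \<Rightarrow> real set" where
  "arc_after D t = {x. t < x \<and> {t<..x} \<inter> crossing_params D = {}}"


section \<open>Moves\<close>

subsection \<open>Isotopies and detour moves\<close>

definition ambient_isotopy :: "(real \<Rightarrow> complex \<Rightarrow> complex) \<Rightarrow> bool" where
  "ambient_isotopy H \<longleftrightarrow> (\<exists>H'.
     H 0 = id \<and>
     (\<exists>R. \<forall>s\<in>{0..1}. \<forall>z. cmod z \<ge> R \<longrightarrow> H s z = z) \<and>
     continuous_on ({0..1} \<times> UNIV) (\<lambda>(s, z). H s z) \<and>
     (\<forall>s\<in>{0..1}. bij (H s) \<and>
        (\<forall>z. (H s has_derivative H' s z) (at z) \<and> orient (H' s z 1) (H' s z \<i>) \<noteq> 0)) \<and>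
     (\<forall>w. continuous_on ({0..1} \<times> UNIV) (\<lambda>(s, z). H' s z w)))"

definition isotopy_move ::
    "(real \<Rightarrow> complex \<Rightarrow> complex) \<Rightarrow> (real \<Rightarrow> real) \<Rightarrow> diagram \<Rightarrow> diagram \<Rightarrow> bool" where
  \<comment> \<open>\<open>r\<close> is an orientation-preserving change of parameter\<close>
  "isotopy_move H r D D' \<longleftrightarrow>
     long_diagram D \<and> long_diagram D' \<and> ambient_isotopy H \<and>
     bij r \<and> (\<forall>t. \<exists>d>0. (r has_real_derivative d) (at t)) \<and>
     (\<forall>t. curve D' (r t) = H 1 (curve D t)) \<and>
     overpasses D' = r ` overpasses D"

definition detour_move :: "diagram \<Rightarrow> diagram \<Rightarrow> bool" where
  "detour_move D D' \<longleftrightarrow>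
     long_diagram D \<and> long_diagram D' \<and>
     overpasses D' = overpasses D \<and>
     (\<exists>a b. a < b \<and> (\<forall>t. t \<notin> {a<..<b} \<longrightarrow> curve D' t = curve D t) \<and>
        {a..b} \<inter> crossing_params D = {} \<and> {a..b} \<inter> crossing_params D' = {})"

subsection \<open>Reidemeister moves\<close>

definition plane_chart :: "(complex \<Rightarrow> complex) \<Rightarrow> bool" where
  \<comment> \<open>orientation-preserving diffeomorphisms of the plane\<close>
  "plane_chart \<phi> \<longleftrightarrow> (\<exists>\<phi>'. bij \<phi> \<and>
     (\<forall>z. (\<phi> has_derivative \<phi>' z) (at z) \<and> orient (\<phi>' z 1) (\<phi>' z \<i>) > 0) \<and>
     (\<forall>w. continuous_on UNIV (\<lambda>z. \<phi>' z w)))"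

definition region :: "(complex \<Rightarrow> complex) \<Rightarrow> complex set" where
  "region \<phi> = {z. cmod (\<phi> z) < 1}"

text \<open>
  A Reidemeister move replaces the part of the diagram inside a disc, which a chart \<open>\<phi>\<close> takes to
  the unit disc. The diagram meets the disc in \<open>n\<close> strands, which are the restrictions of the
  curve to \<open>[a k, b k]\<close>, where \<open>k = 1, \<dots>, n\<close>. Outside the disc nothing changes, not even the
  parametrisation.
\<close>

definition local_change ::
    "(complex \<Rightarrow> complex) \<Rightarrow> nat \<Rightarrow> (nat \<Rightarrow> real) \<Rightarrow> (nat \<Rightarrow> real) \<Rightarrow> diagram \<Rightarrow> diagram \<Rightarrow> bool" where
  "local_change \<phi> n a b D D' \<longleftrightarrow>
     long_diagram D \<and> long_diagram D' \<and> plane_chart \<phi> \<and>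
     (\<forall>k\<in>{1..n}. a k < b k) \<and> disjoint_family_on (\<lambda>k. {a k..b k}) {1..n} \<and>
     (\<forall>E\<in>{D, D'}.
        {t. cmod (\<phi> (curve E t)) \<le> 1} = (\<Union>k\<in>{1..n}. {a k..b k}) \<and>
        {t. curve E t \<in> region \<phi>} = (\<Union>k\<in>{1..n}. {a k<..<b k})) \<and>
     (\<forall>t. curve D t \<notin> region \<phi> \<longrightarrow>
        curve D' t = curve D t \<and> (t \<in> overpasses D' \<longleftrightarrow> t \<in> overpasses D))"

text \<open>
  Decreasing first move: a single strand whose only self-intersection is the classical
  crossing \<open>v\<close> is replaced by a strand without self-intersections.
\<close>

definition R1_decreasing ::
    "(complex \<Rightarrow> complex) \<Rightarrow> complex \<Rightarrow> diagram \<Rightarrow> diagram \<Rightarrow> bool" where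
  "R1_decreasing \<phi> v D D' \<longleftrightarrow> (\<exists>a b s t.
     local_change \<phi> 1 a b D D' \<and>
     a 1 < s \<and> s < t \<and> t < b 1 \<and> curve D s = v \<and> curve D t = v \<and> v \<in> crossings D \<and>
     (\<forall>x\<in>{a 1..b 1}. \<forall>y\<in>{a 1..b 1}. curve D x = curve D y \<longrightarrow> x = y \<or> {x, y} = {s, t}) \<and>
     inj_on (curve D') {a 1..b 1})"

text \<open>
  Decreasing second move: in the chart, the first strand is the segment of the real axis in the
  disc (in either direction). The second strand starts and ends in the upper half plane and
  crosses the real axis twice, and the move pushes it off into the upper half plane.
\<close>

definition R2_decreasing ::
    "(complex \<Rightarrow> complex) \<Rightarrow> complex \<Rightarrow> complex \<Rightarrow> diagram \<Rightarrow> diagram \<Rightarrow> bool" where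
  "R2_decreasing \<phi> v\<^sub>1 v\<^sub>2 D D' \<longleftrightarrow> (\<exists>a b s\<^sub>1 s\<^sub>2 t\<^sub>1 t\<^sub>2.
     local_change \<phi> 2 a b D D' \<and>
     (\<forall>k\<in>{1, 2}. inj_on (curve D) {a k..b k} \<and> inj_on (curve D') {a k..b k}) \<and>
     (\<forall>t\<in>{a 1..b 1}. Im (\<phi> (curve D t)) = 0 \<and> curve D' t = curve D t) \<and>
     a 2 < t\<^sub>1 \<and> t\<^sub>1 < t\<^sub>2 \<and> t\<^sub>2 < b 2 \<and>
     (\<forall>t\<in>{a 2..<t\<^sub>1} \<union> {t\<^sub>2<..b 2}. Im (\<phi> (curve D t)) > 0) \<and>
     (\<forall>t\<in>{t\<^sub>1<..<t\<^sub>2}. Im (\<phi> (curve D t)) < 0) \<and>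
     (\<forall>t\<in>{a 2..b 2}. Im (\<phi> (curve D' t)) > 0) \<and>
     s\<^sub>1 \<in> {a 1<..<b 1} \<and> s\<^sub>2 \<in> {a 1<..<b 1} \<and>
     curve D s\<^sub>1 = v\<^sub>1 \<and> curve D t\<^sub>1 = v\<^sub>1 \<and> curve D s\<^sub>2 = v\<^sub>2 \<and> curve D t\<^sub>2 = v\<^sub>2 \<and>
     ({s\<^sub>1, s\<^sub>2} \<subseteq> overpasses D \<or> {t\<^sub>1, t\<^sub>2} \<subseteq> overpasses D))"

text \<open>
  Third move: in the chart, the first and second strands are the segments of the real and of the
  imaginary axis in the disc (each in either direction). The third strand runs from the fourth
  quadrant to the second one, in \<open>D\<close> through the first quadrant and in \<open>D'\<close> through the third
  one. By rotating the chart and renaming the strands, every third move or its inverse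
  takes this form. The number \<open>p i j\<close> (or \<open>q i j\<close>) is the parameter on strand \<open>i\<close> of the
  crossing with strand \<open>j\<close> in \<open>D\<close> (or \<open>D'\<close>). The last two conditions say that the strands can be
  put at three different heights.
\<close>

definition R3_standard ::
    "(complex \<Rightarrow> complex) \<Rightarrow> (nat \<Rightarrow> nat \<Rightarrow> real) \<Rightarrow> (nat \<Rightarrow> nat \<Rightarrow> real) \<Rightarrow>
     diagram \<Rightarrow> diagram \<Rightarrow> bool" where
  "R3_standard \<phi> p q D D' \<longleftrightarrow> (\<exists>a b.
     local_change \<phi> 3 a b D D' \<and>
     (\<forall>k\<in>{1, 2, 3}. inj_on (curve D) {a k..b k} \<and> inj_on (curve D') {a k..b k}) \<and>
     (\<forall>t\<in>{a 1..b 1}. Im (\<phi> (curve D t)) = 0 \<and> curve D' t = curve D t) \<and>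
     (\<forall>t\<in>{a 2..b 2}. Re (\<phi> (curve D t)) = 0 \<and> curve D' t = curve D t) \<and>
     p 3 1 < p 3 2 \<and>
     (\<forall>t\<in>{a 3..<p 3 1}. Re (\<phi> (curve D t)) > 0 \<and> Im (\<phi> (curve D t)) < 0) \<and>
     (\<forall>t\<in>{p 3 1<..<p 3 2}. Re (\<phi> (curve D t)) > 0 \<and> Im (\<phi> (curve D t)) > 0) \<and>
     (\<forall>t\<in>{p 3 2<..b 3}. Re (\<phi> (curve D t)) < 0 \<and> Im (\<phi> (curve D t)) > 0) \<and>
     q 3 2 < q 3 1 \<and>
     (\<forall>t\<in>{a 3..<q 3 2}. Re (\<phi> (curve D' t)) > 0 \<and> Im (\<phi> (curve D' t)) < 0) \<and>
     (\<forall>t\<in>{q 3 2<..<q 3 1}. Re (\<phi> (curve D' t)) < 0 \<and> Im (\<phi> (curve D' t)) < 0) \<and>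
     (\<forall>t\<in>{q 3 1<..b 3}. Re (\<phi> (curve D' t)) < 0 \<and> Im (\<phi> (curve D' t)) > 0) \<and>
     (\<forall>i\<in>{1, 2, 3}. \<forall>j\<in>{1, 2, 3} - {i}.
        p i j \<in> {a i<..<b i} \<and> q i j \<in> {a i<..<b i} \<and>
        curve D (p i j) = curve D (p j i) \<and> curve D' (q i j) = curve D' (q j i) \<and>
        (p i j \<in> overpasses D \<or> p j i \<in> overpasses D) \<and>
        (q i j \<in> overpasses D' \<longleftrightarrow> p i j \<in> overpasses D)) \<and>
     \<not> {p 1 2, p 2 3, p 3 1} \<subseteq> overpasses D \<and>
     \<not> {p 2 1, p 3 2, p 1 3} \<subseteq> overpasses D)"

definition R3_move ::
    "(complex \<Rightarrow> complex) \<Rightarrow> (nat \<Rightarrow> nat \<Rightarrow> real) \<Rightarrow> (nat \<Rightarrow> nat \<Rightarrow> real) \<Rightarrow>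
     diagram \<Rightarrow> diagram \<Rightarrow> bool" where
  "R3_move \<phi> p q D D' \<longleftrightarrow> R3_standard \<phi> p q D D' \<or> R3_standard \<phi> q p D' D"

definition triangle_corners :: "(nat \<times> nat) set" where
  "triangle_corners = {(1, 2), (1, 3), (2, 3)}"

text \<open>
  The sign of the triangle at the crossing of strands \<open>i\<close> and \<open>j\<close>; the remaining strand is
  \<open>6 - i - j\<close>. The two sides of the triangle at the crossing lie on strands \<open>i\<close> and \<open>j\<close>. The
  triangle lies above (or below) the crossing if both sides leave it (or enter it), and to the
  left or right if one enters and the other leaves.
\<close>

definition corner_sign :: "(nat \<Rightarrow> nat \<Rightarrow> real) \<Rightarrow> nat \<Rightarrow> nat \<Rightarrow> int" where
  "corner_sign p i j =
     (if p i j < p i (6 - i - j) \<longleftrightarrow> p j i < p j (6 - i - j) then -1 else 1)"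

definition reidemeister_move :: "(complex \<Rightarrow> complex) \<Rightarrow> diagram \<Rightarrow> diagram \<Rightarrow> bool" where
  "reidemeister_move \<phi> D D' \<longleftrightarrow>
     (\<exists>v. R1_decreasing \<phi> v D D' \<or> R1_decreasing \<phi> v D' D) \<or>
     (\<exists>v\<^sub>1 v\<^sub>2. R2_decreasing \<phi> v\<^sub>1 v\<^sub>2 D D' \<or> R2_decreasing \<phi> v\<^sub>1 v\<^sub>2 D' D) \<or>
     (\<exists>p q. R3_move \<phi> p q D D')"

definition diagram_move :: "diagram \<Rightarrow> diagram \<Rightarrow> bool" where
  "diagram_move D D' \<longleftrightarrow>
     (\<exists>H r. isotopy_move H r D D') \<or> detour_move D D' \<or> (\<exists>\<phi>. reidemeister_move \<phi> D D')"

definition long_virtual_knot :: "diagram set \<Rightarrow> bool" where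
  "long_virtual_knot K \<longleftrightarrow> (\<exists>D. long_diagram D \<and> K = {D'. equivclp diagram_move D D'})"

subsection \<open>Surviving crossings and correspondent arcs\<close>

definition passive_pair :: "diagram \<Rightarrow> diagram \<Rightarrow> complex \<Rightarrow> complex \<Rightarrow> bool" where
  \<comment> \<open>\<open>v'\<close> is the image under a move of the crossing \<open>v\<close>, which does not take part in the move\<close>
  "passive_pair D D' v v' \<longleftrightarrow> v \<in> crossings D \<and>
     ((\<exists>H r. isotopy_move H r D D' \<and> v' = H 1 v) \<or>
      (detour_move D D' \<and> v' = v) \<or>
      (\<exists>\<phi>. reidemeister_move \<phi> D D' \<and> v \<notin> region \<phi> \<and> v' = v))"

definition active_pair :: "diagram \<Rightarrow> diagram \<Rightarrow> complex \<Rightarrow> complex \<Rightarrow> bool" where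
  \<comment> \<open>only a third move has crossings that take part in it and survive\<close>
  "active_pair D D' v v' \<longleftrightarrow>
     (\<exists>\<phi> p q. R3_move \<phi> p q D D' \<and>
        (\<exists>(i, j)\<in>triangle_corners. v = curve D (p i j) \<and> v' = curve D' (q i j)))"

text \<open>
  A common point of two arcs means a common point of the parametrised curves. A mere common
  point of the plane could be a virtual crossing.
\<close>

definition arc_pair :: "diagram \<Rightarrow> diagram \<Rightarrow> real set \<Rightarrow> real set \<Rightarrow> bool" where
  "arc_pair D D' a a' \<longleftrightarrow> a \<in> arcs D \<and> a' \<in> arcs D' \<and>
     ((\<exists>H r. isotopy_move H r D D' \<and> a' = r ` a) \<or>
      (detour_move D D' \<and> a' = a) \<or>
      (\<exists>\<phi>. reidemeister_move \<phi> D D' \<and> (\<exists>t\<in>a \<inter> a'. curve D t \<notin> region \<phi>)))"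


section \<open>Crossings, halves and chains\<close>

text \<open>
  The parameters of the strand from SW to NE and of the strand from SE to NW at a crossing. The
  pair (direction of the first strand, direction of the second strand) is positively oriented.
\<close>

definition SW_NE :: "diagram \<Rightarrow> complex \<Rightarrow> real" where
  "SW_NE D v = (THE s. curve D s = v \<and> (\<exists>t. curve D t = v \<and> orient (velocity D s) (velocity D t) > 0))"

definition SE_NW :: "diagram \<Rightarrow> complex \<Rightarrow> real" where
  "SE_NW D v = (THE t. curve D t = v \<and> (\<exists>s. curve D s = v \<and> orient (velocity D s) (velocity D t) > 0))"

definition arc_SW :: "diagram \<Rightarrow> complex \<Rightarrow> real set" where
  "arc_SW D v = arc_before D (SW_NE D v)"

definition arc_NE :: "diagram \<Rightarrow> complex \<Rightarrow> real set" where
  "arc_NE D v = arc_after D (SW_NE D v)"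

definition arc_SE :: "diagram \<Rightarrow> complex \<Rightarrow> real set" where
  "arc_SE D v = arc_before D (SE_NW D v)"

definition arc_NW :: "diagram \<Rightarrow> complex \<Rightarrow> real set" where
  "arc_NW D v = arc_after D (SE_NW D v)"

text \<open>
  The left half arrives at the crossing along SW and continues along NW; the right half arrives
  along SE and continues along NE.
\<close>

definition left_half :: "diagram \<Rightarrow> complex \<Rightarrow> real set" where
  "left_half D v =
     (if SE_NW D v < SW_NE D v then {SE_NW D v..SW_NE D v} else {..SW_NE D v} \<union> {SE_NW D v..})"

definition right_half :: "diagram \<Rightarrow> complex \<Rightarrow> real set" where
  "right_half D v =
     (if SW_NE D v < SE_NW D v then {SW_NE D v..SE_NW D v} else {..SE_NW D v} \<union> {SW_NE D v..})"

definition closed_half :: "diagram \<Rightarrow> complex \<Rightarrow> real set" where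
  "closed_half D v = (if bounded (left_half D v) then left_half D v else right_half D v)"

definition order_sign :: "diagram \<Rightarrow> complex \<Rightarrow> int" where
  "order_sign D v = (if closed_half D v = right_half D v then 1 else -1)"

text \<open>
  A chain is a function on arcs, considered on the arcs of the diagram only.
\<close>

definition piece_chain :: "real set \<Rightarrow> real set \<Rightarrow> int" where
  "piece_chain X a = (if a \<subseteq> X then 1 else 0)"

definition whole_chain :: "real set \<Rightarrow> int" where
  "whole_chain a = 1"

definition is_cycle :: "diagram \<Rightarrow> (real set \<Rightarrow> 'a::ab_group_add) \<Rightarrow> bool" where
  "is_cycle D \<delta> \<longleftrightarrow> (\<forall>v\<in>crossings D.
     \<delta> (arc_SW D v) + \<delta> (arc_SE D v) = \<delta> (arc_NW D v) + \<delta> (arc_NE D v))"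

definition int_scale :: "int \<Rightarrow> 'a::ab_group_add \<Rightarrow> 'a" where
  "int_scale k x = (if 0 \<le> k then (\<Sum>i<nat k. x) else - (\<Sum>i<nat (- k). x))"

text \<open>
  The intersection number of the closed half at \<open>v\<close> with a cycle, computed by pushing the closed
  half off \<open>D\<close> to its left. Let the closed half run straight through a crossing with parameter
  \<open>u\<close>, and let \<open>w\<close> be the other parameter of that crossing. If the other strand goes from right to
  left, then the pushed path meets the arc after \<open>w\<close>, with sign \<open>+1\<close>; otherwise it meets the arc
  before \<open>w\<close>, with sign \<open>-1\<close>. At the corner \<open>v\<close> the pushed path meets nothing if the closed half
  is the left one. If it is the right one, it meets SW with sign \<open>-1\<close> and NW with sign \<open>+1\<close>.
\<close>

definition other_param :: "diagram \<Rightarrow> real \<Rightarrow> real" where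
  "other_param D u = (THE w. w \<noteq> u \<and> curve D w = curve D u)"

definition half_intersection ::
    "diagram \<Rightarrow> complex \<Rightarrow> (real set \<Rightarrow> 'a::ab_group_add) \<Rightarrow> 'a" where
  "half_intersection D v \<delta> =
     (\<Sum>u\<in>crossing_params D \<inter> interior (closed_half D v).
        let w = other_param D u in
        if orient (velocity D u) (velocity D w) > 0
        then \<delta> (arc_after D w) else - \<delta> (arc_before D w)) +
     (if closed_half D v = right_half D v then \<delta> (arc_NW D v) - \<delta> (arc_SW D v) else 0)"

definition index_parity :: "diagram \<Rightarrow> complex \<Rightarrow> int" where
  "index_parity D v = order_sign D v * half_intersection D v whole_chain"


section \<open>Invariant cycles, quasi-indices and oriented parities\<close>

definition invariant_cycle ::
    "diagram set \<Rightarrow> (diagram \<Rightarrow> real set \<Rightarrow> 'a::ab_group_add) \<Rightarrow> bool" where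
  "invariant_cycle K \<delta> \<longleftrightarrow>
     (\<forall>D\<in>K. is_cycle D (\<delta> D)) \<and>
     (\<forall>D\<in>K. \<forall>D'\<in>K. \<forall>a a'. arc_pair D D' a a' \<longrightarrow> \<delta> D a = \<delta> D' a')"

definition quasi_index ::
    "diagram set \<Rightarrow> (diagram \<Rightarrow> complex \<Rightarrow> 'a::ab_group_add) \<Rightarrow> bool" where
  "quasi_index K \<pi> \<longleftrightarrow>
     (\<forall>D\<in>K. \<forall>D'\<in>K. \<forall>v v'. passive_pair D D' v v' \<longrightarrow> \<pi> D v = \<pi> D' v') \<and>
     (\<forall>D\<in>K. \<forall>D'\<in>K. \<forall>\<phi> v\<^sub>1 v\<^sub>2. R2_decreasing \<phi> v\<^sub>1 v\<^sub>2 D D' \<longrightarrow> \<pi> D v\<^sub>1 = \<pi> D v\<^sub>2) \<and>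
     (\<forall>D\<in>K. \<forall>D'\<in>K. \<forall>\<phi> p q. R3_move \<phi> p q D D' \<longrightarrow>
        (\<exists>l. \<forall>(i, j)\<in>triangle_corners.
           \<pi> D' (curve D' (q i j)) = \<pi> D (curve D (p i j)) + int_scale (corner_sign p i j) l))"

definition oriented_parity ::
    "diagram set \<Rightarrow> (diagram \<Rightarrow> complex \<Rightarrow> 'a::ab_group_add) \<Rightarrow> bool" where
  "oriented_parity K P \<longleftrightarrow>
     (\<forall>D\<in>K. \<forall>D'\<in>K. \<forall>v v'. passive_pair D D' v v' \<or> active_pair D D' v v' \<longrightarrow> P D v = P D' v') \<and>
     (\<forall>D\<in>K. \<forall>D'\<in>K. \<forall>\<phi> v. R1_decreasing \<phi> v D D' \<longrightarrow> P D v = 0) \<and>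
     (\<forall>D\<in>K. \<forall>D'\<in>K. \<forall>\<phi> v\<^sub>1 v\<^sub>2. R2_decreasing \<phi> v\<^sub>1 v\<^sub>2 D D' \<longrightarrow> P D v\<^sub>1 + P D v\<^sub>2 = 0) \<and>
     (\<forall>D\<in>K. \<forall>D'\<in>K. \<forall>\<phi> p q. R3_move \<phi> p q D D' \<longrightarrow>
        (\<Sum>(i, j)\<in>triangle_corners. int_scale (corner_sign p i j) (P D (curve D (p i j)))) = 0)"

definition cycle_of_index ::
    "(diagram \<Rightarrow> complex \<Rightarrow> 'a::ab_group_add) \<Rightarrow> 'a \<Rightarrow> diagram \<Rightarrow> real set \<Rightarrow> 'a" where
  "cycle_of_index \<pi> \<rho> D a =
     (\<Sum>v\<in>crossings D. int_scale (order_sign D v * piece_chain (closed_half D v) a) (\<pi> D v)) +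
     int_scale (whole_chain a) \<rho>"

definition parity_of_index ::
    "(diagram \<Rightarrow> complex \<Rightarrow> 'a::ab_group_add) \<Rightarrow> 'a \<Rightarrow> diagram \<Rightarrow> complex \<Rightarrow> 'a" where
  "parity_of_index \<pi> \<rho> D v =
     - int_scale (order_sign D v)
         (\<Sum>v'\<in>crossings D.
            int_scale (order_sign D v' * half_intersection D v (piece_chain (closed_half D v')))
              (\<pi> D v')) -
     int_scale (index_parity D v) \<rho>"

end

theory Submission
  imports Defs
begin

text \<open>
  The curve runs through the diagram once, from left to right. Hence a chain is determined by its
  value on the first arc and by its jumps at the parameters of the crossings. For a 1-cycle the two
  jumps at a crossing \<open>v\<close> are opposite: \<open>\<pi> v\<close> at the parameter of the strand SW-NE and \<open>- \<pi> v\<close> at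
  that of the strand SE-NW. The chain \<open>o(v) D\<^sup>c\<^sub>v\<close> has jumps \<open>1\<close> and \<open>- 1\<close> at these two
  parameters, has no other jumps, and vanishes on the first arc. So \<open>\<Sum> o(v) \<pi>(v) D\<^sup>c\<^sub>v + \<rho> D\<close> is the cycle
  with jumps \<open>\<plusminus> \<pi>\<close> and first value \<open>\<rho>\<close>; every cycle has this form
  (\<open>cycle_of_index_arc_at\<close>, \<open>cycle_eq_cycle_of_index\<close>). The first value of an
  invariant cycle is preserved by all moves, since the first arcs always correspond.

  A Reidemeister move changes the diagram only inside a disc, which it meets in one, two or three
  strands. If the first value and the jumps at the crossings outside the disc stay the same, then the
  cycle keeps its values outside the disc if and only if the sum of its jumps along each strand is
  the same before and after the move. For the first move these sums vanish. For the
  second one they vanish if and only if \<open>\<pi>\<close> takes the same value at both crossings, because a strand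
  passes them in opposite roles. For the third one they give three linear equations, whose
  solutions are the changes of \<open>\<pi>\<close> of the form \<open>\<epsilon>(v) \<lambda>\<close>. These are the axioms of a quasi-index.

  The parity is linear in the cycle, so that it equals \<open>- o(v) (D\<^sup>c\<^sub>v \<cdot> \<delta>)\<close>, where \<open>\<delta>\<close> is the cycle
  of \<open>\<pi>\<close> and \<open>\<rho>\<close>. Let \<open>swept x\<close> be the intersection number with \<open>\<delta>\<close> of the part of the diagram before
  the parameter \<open>x\<close>, pushed off to the left. Whichever half is closed,
  \<open>- o(v) (D\<^sup>c\<^sub>v \<cdot> \<delta>) = swept s - swept t + \<delta>\<^bsub>SW\<^esub>\<close>, where \<open>s\<close> and \<open>t\<close> are the parameters of SW-NE
  and SE-NW (\<open>half_intersection_cycle_parity\<close>). Its invariance at the crossings outside the disc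
  holds because the intersections along each strand of the disc have the same sum before and after
  the move. This, the invariance at the crossings of a third move and the axioms on
  disappearing crossings are identities between the values of \<open>\<delta>\<close> on the arcs of the
  three local pictures (\<open>kink_meets\<close>, \<open>bigon_meets\<close>, \<open>triangle_parity_sum\<close>,
  \<open>triangle_pair_meets\<close>, \<open>triangle_pair_parity\<close>).
\<close>

section \<open>Integer multiples\<close>

lemma int_scale_0 [simp]: "int_scale 0 x = 0"
  by (simp add: int_scale_def)

lemma int_scale_1 [simp]: "int_scale 1 x = x"
  by (simp add: int_scale_def)

lemma int_scale_add_one: "int_scale (k + 1) x = int_scale k x + x"
proof -
  consider "k \<ge> 0" | "k = -1" | "k < -1" by linarith
  then show ?thesis
  proof cases
    case 1
    then show ?thesis by (simp add: int_scale_def nat_add_distrib)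
  next
    case 2
    then show ?thesis by (simp add: int_scale_def)
  next
    case 3
    then have "nat (- k) = Suc (nat (- (k + 1)))" by simp
    with 3 show ?thesis by (simp add: int_scale_def)
  qed
qed

lemma int_scale_add: "int_scale (j + k) x = int_scale j x + int_scale k x"
proof (induction k rule: int_induct[where k = 0])
  case base
  then show ?case by simp
next
  case (step1 i)
  then show ?case
    using int_scale_add_one[of "j + i" x] int_scale_add_one[of i x] by (simp add: add.assoc)
next
  case (step2 i)
  then show ?case
    using int_scale_add_one[of "j + (i - 1)" x] int_scale_add_one[of "i - 1" x]
    by (simp add: algebra_simps)
qed

lemma int_scale_minus: "int_scale (- k) x = - int_scale k x"
  using int_scale_add[of k "- k" x] by (simp add: eq_neg_iff_add_eq_0 add.commute)

lemma int_scale_diff: "int_scale (j - k) x = int_scale j x - int_scale k x"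
  using int_scale_add[of j "- k" x] by (simp add: int_scale_minus)

lemma int_scale_minus_one [simp]: "int_scale (- 1) x = - x"
  by (simp add: int_scale_minus)

lemma int_scale_sum: "int_scale (sum f S) x = (\<Sum>i\<in>S. int_scale (f i) x)"
  by (induction S rule: infinite_finite_induct) (simp_all add: int_scale_add)

section \<open>Crossings of a diagram\<close>

lemma orient_swap: "orient u w = - orient w u"
  by (simp add: orient_def)

definition ascends_right :: "diagram \<Rightarrow> real \<Rightarrow> bool" where
  "ascends_right D u \<longleftrightarrow> orient (velocity D u) (velocity D (other_param D u)) > 0"

lemma overpasses_subset: "overpasses D \<subseteq> crossing_params D"
  by (auto simp: crossing_params_def crossings_def)

lemma long_diagram_no_triple:
  assumes "long_diagram D" "curve D s = curve D t" "curve D t = curve D u"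
  shows "s = t \<or> t = u \<or> s = u"
proof -
  have "\<forall>s t u. curve D s = curve D t \<and> curve D t = curve D u \<longrightarrow> s = t \<or> t = u \<or> s = u"
    using assms(1) unfolding long_diagram_def by (elim conjE) assumption
  then show ?thesis using assms(2,3) by blast
qed

lemma long_diagram_transverse:
  assumes "long_diagram D" "s \<noteq> t" "curve D s = curve D t"
  shows "orient (velocity D s) (velocity D t) \<noteq> 0"
proof -
  have "\<forall>s t. s \<noteq> t \<and> curve D s = curve D t \<longrightarrow> orient (velocity D s) (velocity D t) \<noteq> 0"
    using assms(1) unfolding long_diagram_def by (elim conjE) assumption
  then show ?thesis using assms(2,3) by blast
qed

lemma long_diagram_over:
  assumes "long_diagram D" "t \<in> overpasses D"
  obtains s where "s \<noteq> t" "s \<notin> overpasses D" "curve D s = curve D t"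
  using assms unfolding long_diagram_def by blast

lemma finite_overpasses: "long_diagram D \<Longrightarrow> finite (overpasses D)"
  unfolding long_diagram_def by (elim conjE) assumption

lemma finite_crossings: "long_diagram D \<Longrightarrow> finite (crossings D)"
  by (simp add: crossings_def finite_overpasses)

lemma other_param_unique:
  assumes "long_diagram D" "w \<noteq> u" "curve D w = curve D u"
  shows "other_param D u = w"
  unfolding other_param_def
proof (rule the_equality)
  show "w \<noteq> u \<and> curve D w = curve D u" using assms by simp
  fix x assume "x \<noteq> u \<and> curve D x = curve D u"
  then show "x = w" using long_diagram_no_triple[OF assms(1), of x u w] assms(2,3) by metis
qed

lemma
  assumes D: "long_diagram D" and u: "u \<in> crossing_params D"
  shows other_param_neq: "other_param D u \<noteq> u"
    and curve_other_param: "curve D (other_param D u) = curve D u"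
    and other_param_in: "other_param D u \<in> crossing_params D"
    and other_param_involutive: "other_param D (other_param D u) = u"
proof -
  from u obtain t where t: "t \<in> overpasses D" "curve D u = curve D t"
    by (auto simp: crossing_params_def crossings_def)
  from long_diagram_over[OF D t(1)] obtain s where s: "s \<noteq> t" "curve D s = curve D t" by metis
  then obtain w where w: "w \<noteq> u" "curve D w = curve D u" using t by metis
  then have m: "other_param D u = w" by (rule other_param_unique[OF D])
  from w m show "other_param D u \<noteq> u" "curve D (other_param D u) = curve D u" by auto
  then show "other_param D u \<in> crossing_params D" "other_param D (other_param D u) = u"
    using u w other_param_unique[OF D, of u w] by (auto simp: crossing_params_def m)
qed

lemma curve_eq_cases:
  assumes "long_diagram D" "u \<in> crossing_params D" "curve D w = curve D u"
  shows "w = u \<or> w = other_param D u"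
  using other_param_unique[OF assms(1) _ assms(3)] by auto

lemma finite_crossing_params:
  assumes D: "long_diagram D"
  shows "finite (crossing_params D)"
proof -
  have "crossing_params D \<subseteq> overpasses D \<union> other_param D ` overpasses D"
  proof
    fix u assume u: "u \<in> crossing_params D"
    then obtain t where t: "t \<in> overpasses D" "curve D u = curve D t"
      by (auto simp: crossing_params_def crossings_def)
    then show "u \<in> overpasses D \<union> other_param D ` overpasses D"
      using curve_eq_cases[OF D, of t u] overpasses_subset by auto
  qed
  then show ?thesis by (rule finite_subset) (simp add: finite_overpasses[OF D])
qed

text \<open>
  Exchanging the two strands changes the sign of the orientation, and transversality excludes the
  value zero. So exactly one of the two parameters of a crossing belongs to the strand SW-NE.
\<close>

lemma ascends_right_other:
  assumes D: "long_diagram D" and u: "u \<in> crossing_params D"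
  shows "ascends_right D (other_param D u) \<longleftrightarrow> \<not> ascends_right D u"
  using long_diagram_transverse[OF D other_param_neq[OF D u] curve_other_param[OF D u]]
    orient_swap[of "velocity D u" "velocity D (other_param D u)"]
  by (auto simp: ascends_right_def other_param_involutive[OF D u])

lemma
  assumes D: "long_diagram D" and u: "u \<in> crossing_params D"
  shows SW_NE_eq: "SW_NE D (curve D u) = (if ascends_right D u then u else other_param D u)"
    and SE_NW_eq: "SE_NW D (curve D u) = (if ascends_right D u then other_param D u else u)"
proof -
  let ?w = "other_param D u" and ?v = "curve D u"
  let ?s = "if ascends_right D u then u else ?w" and ?t = "if ascends_right D u then ?w else u"
  have irrefl: "\<not> orient (velocity D t) (velocity D t) > 0" for t by (simp add: orient_def)
  have pos: "ascends_right D u \<longleftrightarrow> orient (velocity D u) (velocity D ?w) > 0"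
    by (simp add: ascends_right_def)
  have neg: "\<not> ascends_right D u \<longleftrightarrow> orient (velocity D ?w) (velocity D u) > 0"
    using ascends_right_other[OF D u] by (simp add: ascends_right_def other_param_involutive[OF D u])
  have key: "curve D s = ?v \<and> curve D t = ?v \<and> orient (velocity D s) (velocity D t) > 0 \<longleftrightarrow>
      s = ?s \<and> t = ?t" for s t
  proof
    assume st: "curve D s = ?v \<and> curve D t = ?v \<and> orient (velocity D s) (velocity D t) > 0"
    then have "s = u \<or> s = ?w" "t = u \<or> t = ?w" using curve_eq_cases[OF D u] by auto
    then show "s = ?s \<and> t = ?t" using st pos neg irrefl by auto
  next
    assume "s = ?s \<and> t = ?t"
    then show "curve D s = ?v \<and> curve D t = ?v \<and> orient (velocity D s) (velocity D t) > 0"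
      using pos neg curve_other_param[OF D u] by (cases "ascends_right D u") simp_all
  qed
  show "SW_NE D ?v = ?s" unfolding SW_NE_def by (rule the_equality) (use key in blast)+
  show "SE_NW D ?v = ?t" unfolding SE_NW_def by (rule the_equality) (use key in blast)+
qed

lemma crossing_at_SW_NE:
  assumes D: "long_diagram D" and v: "v \<in> crossings D"
  defines "s \<equiv> SW_NE D v"
  shows "s \<in> crossing_params D" "ascends_right D s" "curve D s = v" "SE_NW D v = other_param D s"
proof -
  from v obtain u where u: "u \<in> crossing_params D" "v = curve D u"
    by (auto simp: crossings_def crossing_params_def)
  let ?w = "other_param D u"
  have "s = (if ascends_right D u then u else ?w)"
    unfolding s_def u(2) by (rule SW_NE_eq[OF D u(1)])
  moreover have "SE_NW D v = (if ascends_right D u then ?w else u)"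
    unfolding u(2) by (rule SE_NW_eq[OF D u(1)])
  ultimately show "s \<in> crossing_params D" "ascends_right D s" "curve D s = v" "SE_NW D v = other_param D s"
    using u ascends_right_other[OF D u(1)] other_param_in[OF D u(1)]
      curve_other_param[OF D u(1)] other_param_involutive[OF D u(1)] by auto
qed

section \<open>Arcs\<close>

definition arc_at :: "diagram \<Rightarrow> real \<Rightarrow> real set" where
  "arc_at D t = connected_component_set (- crossing_params D) t"

lemma arcs_eq: "arcs D = arc_at D ` (- crossing_params D)"
  by (auto simp: arcs_def arc_at_def components_iff)

lemma arc_at_self: "t \<notin> crossing_params D \<Longrightarrow> t \<in> arc_at D t"
  by (simp add: arc_at_def)

lemma mem_arc_at:
  assumes "t \<notin> crossing_params D"
  shows "x \<in> arc_at D t \<longleftrightarrow> {min x t..max x t} \<inter> crossing_params D = {}"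
proof
  assume "x \<in> arc_at D t"
  then obtain C where C: "connected C" "C \<subseteq> - crossing_params D" "t \<in> C" "x \<in> C"
    by (auto simp: arc_at_def connected_component_def)
  then have "{min x t..max x t} \<subseteq> C"
    using connected_contains_Icc[OF C(1)] by (simp add: min_def max_def)
  with C show "{min x t..max x t} \<inter> crossing_params D = {}" by blast
next
  assume *: "{min x t..max x t} \<inter> crossing_params D = {}"
  show "x \<in> arc_at D t"
    unfolding arc_at_def mem_Collect_eq connected_component_def
    by (rule exI[of _ "{min x t..max x t}"]) (use * in \<open>auto\<close>)
qed

lemma arc_eq_arc_at:
  assumes "a \<in> arcs D" "t \<in> a"
  shows "a = arc_at D t" "t \<notin> crossing_params D"
proof -
  from assms obtain s where s: "s \<notin> crossing_params D" "a = arc_at D s" by (auto simp: arcs_eq)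
  then show "a = arc_at D t" using assms
    by (metis arc_at_def connected_component_eq)
  have "t \<in> {min t s..max t s}" by simp
  then show "t \<notin> crossing_params D" using s assms(2) mem_arc_at[OF s(1), of t] by blast
qed

lemma arc_at_cong:
  assumes "x \<le> y" "{x..y} \<inter> crossing_params D = {}"
  shows "arc_at D x = arc_at D y"
proof -
  have y: "y \<notin> crossing_params D" using assms by auto
  have "{min x y..max x y} = {x..y}" using assms(1) by auto
  then have "x \<in> arc_at D y" using assms(2) mem_arc_at[OF y, of x] by metis
  moreover have "arc_at D y \<in> arcs D" using y unfolding arcs_eq by blast
  ultimately show ?thesis using arc_eq_arc_at(1)[of "arc_at D y" D x] by simp
qed

lemma arc_before_eq:
  assumes "x < u" "{x..<u} \<inter> crossing_params D = {}" "u \<in> crossing_params D"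
  shows "arc_before D u = arc_at D x"
proof -
  have x: "x \<notin> crossing_params D" using assms by auto
  have "y < u \<and> {y..<u} \<inter> crossing_params D = {} \<longleftrightarrow> {min y x..max y x} \<inter> crossing_params D = {}" for y
  proof
    assume *: "y < u \<and> {y..<u} \<inter> crossing_params D = {}"
    then have "{min y x..max y x} \<subseteq> {y..<u} \<union> {x..<u}" using assms(1) by auto
    with * assms(2) show "{min y x..max y x} \<inter> crossing_params D = {}" by blast
  next
    assume *: "{min y x..max y x} \<inter> crossing_params D = {}"
    have yu: "y < u"
    proof (rule ccontr)
      assume "\<not> y < u"
      then have "u \<in> {min y x..max y x}" using assms(1) by auto
      with * assms(3) show False by blast
    qed
    have "{y..<u} \<subseteq> {min y x..max y x} \<union> {x..<u}" using yu by auto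
    with yu * assms(2) show "y < u \<and> {y..<u} \<inter> crossing_params D = {}" by blast
  qed
  then show ?thesis using mem_arc_at[OF x] unfolding arc_before_def by blast
qed

lemma arc_after_eq:
  assumes "u < x" "{u<..x} \<inter> crossing_params D = {}" "u \<in> crossing_params D"
  shows "arc_after D u = arc_at D x"
proof -
  have x: "x \<notin> crossing_params D" using assms by auto
  have "u < y \<and> {u<..y} \<inter> crossing_params D = {} \<longleftrightarrow> {min y x..max y x} \<inter> crossing_params D = {}" for y
  proof
    assume *: "u < y \<and> {u<..y} \<inter> crossing_params D = {}"
    then have "{min y x..max y x} \<subseteq> {u<..y} \<union> {u<..x}" using assms(1) by auto
    with * assms(2) show "{min y x..max y x} \<inter> crossing_params D = {}" by blast
  next
    assume *: "{min y x..max y x} \<inter> crossing_params D = {}"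
    have yu: "u < y"
    proof (rule ccontr)
      assume "\<not> u < y"
      then have "u \<in> {min y x..max y x}" using assms(1) by auto
      with * assms(3) show False by blast
    qed
    have "{u<..y} \<subseteq> {min y x..max y x} \<union> {u<..x}" using yu by auto
    with yu * assms(2) show "u < y \<and> {u<..y} \<inter> crossing_params D = {}" by blast
  qed
  then show ?thesis using mem_arc_at[OF x] unfolding arc_after_def by blast
qed

lemma arc_after_eq_arc_before:
  assumes "p < q" "{p<..<q} \<inter> crossing_params D = {}" "p \<in> crossing_params D" "q \<in> crossing_params D"
  shows "arc_after D p = arc_before D q"
proof -
  obtain x where x: "p < x" "x < q" using assms(1) dense by blast
  then have "{p<..x} \<subseteq> {p<..<q}" "{x..<q} \<subseteq> {p<..<q}" by auto
  then have "{p<..x} \<inter> crossing_params D = {}" "{x..<q} \<inter> crossing_params D = {}"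
    using assms(2) by blast+
  then show ?thesis using arc_after_eq[OF x(1) _ assms(3)] arc_before_eq[OF x(2) _ assms(4)] by simp
qed

text \<open>
  Arcs next to a crossing are compared with their values at points close to it; the open set
  will be the complement of the strands in the disc of a move.
\<close>

lemma exists_just_before:
  fixes S :: "real set"
  assumes "finite T" "z < u" "open S" "u \<in> S"
  obtains x where "z < x" "x < u" "{x..<u} \<inter> T = {}" "{x..u} \<subseteq> S"
proof -
  from assms obtain e where e: "e > 0" "ball u e \<subseteq> S" by (meson open_contains_ball)
  define m where "m = Max (insert z (insert (u - e) (T \<inter> {..<u})))"
  have fin: "finite (insert z (insert (u - e) (T \<inter> {..<u})))" using assms by auto
  have m: "m < u" "z \<le> m" "u - e \<le> m" "\<And>t. t \<in> T \<Longrightarrow> t < u \<Longrightarrow> t \<le> m"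
    unfolding m_def using fin assms(2) e by (simp_all del: Max_insert add: Max_less_iff Max_ge)
  obtain x where x: "m < x" "x < u" using m(1) dense by blast
  have "{x..u} \<subseteq> ball u e" using x m e by (auto simp: dist_real_def)
  moreover have "{x..<u} \<inter> T = {}" using x m(4) by fastforce
  ultimately show ?thesis using that[of x] x m e by auto
qed

lemma exists_just_after:
  fixes S :: "real set"
  assumes "finite T" "u < z" "open S" "u \<in> S"
  obtains x where "u < x" "x < z" "{u<..x} \<inter> T = {}" "{u..x} \<subseteq> S"
proof -
  have "finite (uminus ` T)" "- z < - u" "open (uminus ` S)" "- u \<in> uminus ` S"
    using assms by (auto intro: open_negations)
  then obtain x where x: "- z < x" "x < - u" "{x..<-u} \<inter> uminus ` T = {}" "{x..-u} \<subseteq> uminus ` S"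
    by (rule exists_just_before)
  have "{u<..- x} \<inter> T = {}"
  proof -
    have "- t \<in> {x..<-u}" if "t \<in> {u<..- x}" for t using that by auto
    then show ?thesis using x(3) by blast
  qed
  moreover have "{u..- x} \<subseteq> S"
  proof
    fix t assume "t \<in> {u..- x}"
    then have "- t \<in> {x..-u}" by auto
    then have "- t \<in> uminus ` S" using x(4) by blast
    then show "t \<in> S" by auto
  qed
  ultimately show ?thesis using that[of "- x"] x by auto
qed

lemma arcs_at_crossing:
  assumes "long_diagram E" "u \<in> crossing_params E"
  shows "arc_before E u \<in> arcs E" "arc_after E u \<in> arcs E"
proof -
  note fin = finite_crossing_params[OF assms(1)]
  obtain x where x: "x < u" "{x..<u} \<inter> crossing_params E = {}"
    using exists_just_before[OF fin, of "u - 1" u UNIV] by auto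
  obtain y where y: "u < y" "{u<..y} \<inter> crossing_params E = {}"
    using exists_just_after[OF fin, of u "u + 1" UNIV] by auto
  have "x \<notin> crossing_params E" "y \<notin> crossing_params E" using x y by auto
  moreover note arc_before_eq[OF x assms(2)] arc_after_eq[OF y assms(2)]
  ultimately show "arc_before E u \<in> arcs E" "arc_after E u \<in> arcs E"
    by (auto simp: arcs_eq)
qed

section \<open>Jumps of a chain\<close>

abbreviation crossing_sum :: "diagram \<Rightarrow> (real \<Rightarrow> 'a::ab_group_add) \<Rightarrow> real set \<Rightarrow> 'a" where
  "crossing_sum D f X \<equiv> \<Sum>u\<in>crossing_params D \<inter> X. f u"

definition jump :: "diagram \<Rightarrow> (real set \<Rightarrow> 'a::ab_group_add) \<Rightarrow> real \<Rightarrow> 'a" where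
  "jump D c u = c (arc_after D u) - c (arc_before D u)"

text \<open>
  The jump that a cycle with index \<open>\<pi>\<close> has at a crossing parameter.
\<close>

definition weight :: "diagram \<Rightarrow> (complex \<Rightarrow> 'a::ab_group_add) \<Rightarrow> real \<Rightarrow> 'a" where
  "weight D \<pi> u = (if ascends_right D u then \<pi> (curve D u) else - \<pi> (curve D u))"

abbreviation jump_at_crossing :: "diagram \<Rightarrow> (real set \<Rightarrow> 'a::ab_group_add) \<Rightarrow> complex \<Rightarrow> 'a" where
  "jump_at_crossing D c v \<equiv> c (arc_NE D v) - c (arc_SW D v)"

lemma jump_at_crossing_eq: "jump_at_crossing D c v = jump D c (SW_NE D v)"
  by (simp add: jump_def arc_NE_def arc_SW_def)

lemma weight_other_param:
  assumes "long_diagram D" "u \<in> crossing_params D"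
  shows "weight D \<pi> (other_param D u) = - weight D \<pi> u"
  using assms by (simp add: weight_def ascends_right_other curve_other_param)

lemma is_cycle_iff_jump:
  assumes D: "long_diagram D"
  shows "is_cycle D c \<longleftrightarrow> (\<forall>u\<in>crossing_params D. jump D c (other_param D u) = - jump D c u)"
proof -
  have *: "c (arc_SW D v) + c (arc_SE D v) = c (arc_NW D v) + c (arc_NE D v) \<longleftrightarrow>
      jump D c (other_param D (SW_NE D v)) = - jump D c (SW_NE D v)" if "v \<in> crossings D" for v
  proof -
    have "jump D c (other_param D (SW_NE D v)) = c (arc_NW D v) - c (arc_SE D v)"
      using crossing_at_SW_NE(4)[OF D that] by (simp add: jump_def arc_NW_def arc_SE_def)
    moreover have "- jump D c (SW_NE D v) = c (arc_SW D v) - c (arc_NE D v)"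
      by (simp add: jump_def arc_SW_def arc_NE_def)
    ultimately show ?thesis by (simp add: diff_eq_eq add.commute) (auto simp: algebra_simps)
  qed
  show ?thesis
  proof
    assume cyc: "is_cycle D c"
    show "\<forall>u\<in>crossing_params D. jump D c (other_param D u) = - jump D c u"
    proof
      fix u assume u: "u \<in> crossing_params D"
      then have v: "curve D u \<in> crossings D" by (simp add: crossing_params_def)
      have j: "jump D c (other_param D (SW_NE D (curve D u))) = - jump D c (SW_NE D (curve D u))"
        using cyc v * by (simp add: is_cycle_def)
      show "jump D c (other_param D u) = - jump D c u"
      proof (cases "ascends_right D u")
        case True
        then show ?thesis using j SW_NE_eq[OF D u] by simp
      next
        case False
        then show ?thesis using j SW_NE_eq[OF D u] by (simp add: other_param_involutive[OF D u])
      qed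
    qed
  next
    assume "\<forall>u\<in>crossing_params D. jump D c (other_param D u) = - jump D c u"
    then show "is_cycle D c" unfolding is_cycle_def using * crossing_at_SW_NE(1)[OF D] by blast
  qed
qed

lemma cycle_jump_eq_weight:
  assumes D: "long_diagram D" and cyc: "is_cycle D c" and u: "u \<in> crossing_params D"
  shows "jump D c u = weight D (jump_at_crossing D c) u"
  using cyc u by (auto simp: is_cycle_iff_jump[OF D] weight_def jump_at_crossing_eq SW_NE_eq[OF D])

lemma chain_telescope:
  assumes D: "long_diagram D"
  shows "x < y \<Longrightarrow> x \<notin> crossing_params D \<Longrightarrow> y \<notin> crossing_params D \<Longrightarrow>
    c (arc_at D y) = c (arc_at D x) + crossing_sum D (jump D c) {x<..<y}"
proof (induction "card (crossing_params D \<inter> {x<..<y})" arbitrary: y rule: less_induct)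
  case less
  note fin = finite_crossing_params[OF D]
  let ?T = "crossing_params D"
  show ?case
  proof (cases "?T \<inter> {x<..<y} = {}")
    case True
    moreover have "{x..y} = insert x (insert y {x<..<y})" using less.prems by auto
    ultimately have "{x..y} \<inter> ?T = {}" using less.prems by auto
    then have "arc_at D x = arc_at D y" using less.prems by (intro arc_at_cong) auto
    with True show ?thesis by simp
  next
    case False
    define u where "u = Max (?T \<inter> {x<..<y})"
    have fin': "finite (?T \<inter> {x<..<y})" using fin by simp
    have u: "u \<in> ?T" "x < u" "u < y" unfolding u_def using Max_in[OF fin' False] by auto
    have umax: "t \<le> u" if "t \<in> ?T" "t < y" "x < t" for t
      unfolding u_def using that fin' by (intro Max_ge) auto
    obtain z where z: "x < z" "z < u" "{z..<u} \<inter> ?T = {}"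
      using exists_just_before[OF fin u(2), of UNIV] by auto
    have zT: "z \<notin> ?T" using z by auto
    have split: "?T \<inter> {x<..<y} = insert u (?T \<inter> {x<..<z})"
    proof (rule set_eqI)
      fix t show "t \<in> ?T \<inter> {x<..<y} \<longleftrightarrow> t \<in> insert u (?T \<inter> {x<..<z})"
        using umax[of t] z u by (cases "z \<le> t"; cases "t < u") auto
    qed
    have nu: "u \<notin> ?T \<inter> {x<..<z}" using z by auto
    have "card (?T \<inter> {x<..<z}) < card (?T \<inter> {x<..<y})"
      unfolding split using nu fin by simp
    then have "c (arc_at D z) = c (arc_at D x) + (\<Sum>u\<in>?T \<inter> {x<..<z}. jump D c u)"
      using less.hyps[of z] less.prems z zT by simp
    moreover have "arc_before D u = arc_at D z" using z u by (intro arc_before_eq)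
    moreover have "arc_after D u = arc_at D y"
    proof (rule arc_after_eq[OF u(3) _ u(1)])
      show "{u<..y} \<inter> ?T = {}" using umax u less.prems(3) by fastforce
    qed
    moreover have "(\<Sum>u\<in>?T \<inter> {x<..<y}. jump D c u) = jump D c u + (\<Sum>u\<in>?T \<inter> {x<..<z}. jump D c u)"
      unfolding split using nu fin by simp
    ultimately show ?thesis by (simp add: jump_def)
  qed
qed

section \<open>The cycle of a quasi-index\<close>

lemma closed_half_eq:
  assumes D: "long_diagram D" and v: "v \<in> crossings D"
  defines "s \<equiv> SW_NE D v" and "t \<equiv> SE_NW D v"
  shows "s < t \<Longrightarrow> closed_half D v = {s..t}" "s < t \<Longrightarrow> order_sign D v = 1"
    "s < t \<Longrightarrow> closed_half D v = right_half D v"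
    "t < s \<Longrightarrow> closed_half D v = {t..s}" "t < s \<Longrightarrow> order_sign D v = -1"
    "t < s \<Longrightarrow> closed_half D v \<noteq> right_half D v" "s \<noteq> t"
proof -
  have unb: "\<not> bounded ({..x} \<union> {y..})" for x y :: real
  proof
    assume "bounded ({..x} \<union> {y..})"
    then obtain M where "\<And>z. z \<in> {..x} \<union> {y..} \<Longrightarrow> \<bar>z\<bar> \<le> M" by (auto simp: bounded_iff)
    from this[of "max y (M + 1)"] show False by auto
  qed
  show st: "s \<noteq> t" unfolding s_def t_def
    using crossing_at_SW_NE[OF D v] other_param_neq[OF D] by metis
  { assume "s < t"
    then have r: "right_half D v = {s..t}" and l: "left_half D v = {..s} \<union> {t..}"
      by (auto simp: right_half_def left_half_def s_def t_def)
    show c: "closed_half D v = {s..t}" by (simp only: closed_half_def l r unb if_False)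
    show "closed_half D v = right_half D v" by (simp add: c r)
    then show "order_sign D v = 1" by (simp add: order_sign_def) }
  { assume "t < s"
    then have r: "left_half D v = {t..s}" and l: "right_half D v = {..t} \<union> {s..}"
      by (auto simp: right_half_def left_half_def s_def t_def)
    show c: "closed_half D v = {t..s}" by (simp add: closed_half_def r)
    have "bounded (closed_half D v)" by (simp add: c)
    then show "closed_half D v \<noteq> right_half D v" unfolding l using unb by metis
    then show "order_sign D v = -1" by (simp add: order_sign_def) }
qed

lemma arc_at_subset_interval:
  assumes "x \<notin> crossing_params D" "p \<in> crossing_params D" "q \<in> crossing_params D"
  shows "arc_at D x \<subseteq> {p..q} \<longleftrightarrow> p < x \<and> x < q"
proof
  assume "arc_at D x \<subseteq> {p..q}"
  then have "x \<in> {p..q}" using arc_at_self[OF assms(1)] by blast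
  then show "p < x \<and> x < q" using assms by (auto simp: less_le)
next
  assume *: "p < x \<and> x < q"
  show "arc_at D x \<subseteq> {p..q}"
  proof
    fix y assume "y \<in> arc_at D x"
    then have "p \<notin> {min y x..max y x}" "q \<notin> {min y x..max y x}"
      using mem_arc_at[OF assms(1)] assms by blast+
    then show "y \<in> {p..q}" using * by auto
  qed
qed

text \<open>
  Sums over the crossings become sums over the crossing parameters, two for each crossing.
\<close>

lemma crossing_params_fiber:
  assumes D: "long_diagram D" and v: "v \<in> crossings D"
  shows "{u \<in> crossing_params D. curve D u = v} = {SW_NE D v, SE_NW D v}"
proof -
  note s = crossing_at_SW_NE[OF D v]
  show ?thesis using s curve_eq_cases[OF D s(1)] curve_other_param[OF D s(1)] other_param_in[OF D s(1)]
    by auto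
qed

text \<open>
  The chain \<open>o(v) D\<^sup>c\<^sub>v\<close> jumps by \<open>1\<close> at the strand SW-NE and by \<open>- 1\<close> at the strand SE-NW, whichever comes
  first: if SE-NW comes first, then the sign of \<open>o(v)\<close> exchanges entering and leaving the half.
\<close>

lemma cycle_of_index_arc_at:
  assumes D: "long_diagram D" and x: "x \<notin> crossing_params D"
  shows "cycle_of_index \<pi> \<rho> D (arc_at D x) =
    \<rho> + crossing_sum D (weight D (\<pi> D)) {..<x}"
proof -
  let ?T = "crossing_params D"
  have *: "int_scale (order_sign D v * piece_chain (closed_half D v) (arc_at D x)) (\<pi> D v) =
      (\<Sum>u\<in>{u \<in> ?T \<inter> {..<x}. curve D u = v}. weight D (\<pi> D) u)" if v: "v \<in> crossings D" for v
  proof -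
    let ?s = "SW_NE D v" and ?t = "SE_NW D v"
    note s = crossing_at_SW_NE[OF D v]
    note ch = closed_half_eq[OF D v]
    have t: "?t \<in> ?T" using s other_param_in[OF D s(1)] by simp
    have ws: "weight D (\<pi> D) ?s = \<pi> D v" using s by (simp add: weight_def)
    have wt: "weight D (\<pi> D) ?t = - \<pi> D v" using ws s(4) weight_other_param[OF D s(1), of "\<pi> D"] by metis
    have "{u \<in> ?T \<inter> {..<x}. curve D u = v} = {u \<in> ?T. curve D u = v} \<inter> {..<x}" by auto
    also have "\<dots> = {?s, ?t} \<inter> {..<x}" by (simp only: crossing_params_fiber[OF D v])
    finally have fib: "{u \<in> ?T \<inter> {..<x}. curve D u = v} = {?s, ?t} \<inter> {..<x}" .
    have sum: "(\<Sum>u\<in>{?s, ?t} \<inter> {..<x}. weight D (\<pi> D) u) =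
      (if ?s < x then \<pi> D v else 0) - (if ?t < x then \<pi> D v else 0)"
      using ch(7) ws wt by (auto simp: Int_insert_left)
    have x': "x \<noteq> ?s" "x \<noteq> ?t" using x s t by auto
    show ?thesis
    proof (cases "?s < ?t")
      case True
      then have "piece_chain (closed_half D v) (arc_at D x) = (if ?s < x \<and> x < ?t then 1 else 0)"
        using ch(1) arc_at_subset_interval[OF x s(1) t] by (simp add: piece_chain_def)
      then show ?thesis unfolding fib sum using True ch(2) x' by auto
    next
      case False
      then have ts: "?t < ?s" using ch(7) by simp
      then have "piece_chain (closed_half D v) (arc_at D x) = (if ?t < x \<and> x < ?s then 1 else 0)"
        using ch(4) arc_at_subset_interval[OF x t s(1)] by (simp add: piece_chain_def)
      then show ?thesis unfolding fib sum using ts ch(5) x' by auto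
    qed
  qed
  have "(\<Sum>v\<in>crossings D. int_scale (order_sign D v * piece_chain (closed_half D v) (arc_at D x)) (\<pi> D v))
     = (\<Sum>v\<in>crossings D. \<Sum>u\<in>{u \<in> ?T \<inter> {..<x}. curve D u = v}. weight D (\<pi> D) u)"
    by (intro sum.cong refl *)
  also have "\<dots> = (\<Sum>u\<in>?T \<inter> {..<x}. weight D (\<pi> D) u)"
  proof (rule sum.group)
    show "finite (?T \<inter> {..<x})" "finite (crossings D)"
      using finite_crossing_params[OF D] finite_crossings[OF D] by auto
    show "curve D ` (?T \<inter> {..<x}) \<subseteq> crossings D" by (auto simp: crossing_params_def)
  qed
  finally show ?thesis by (simp add: cycle_of_index_def whole_chain_def add.commute)
qed

lemma jump_cycle_of_index:
  assumes D: "long_diagram D" and u: "u \<in> crossing_params D"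
  shows "jump D (cycle_of_index \<pi> \<rho> D) u = weight D (\<pi> D) u"
proof -
  let ?T = "crossing_params D"
  note fin = finite_crossing_params[OF D]
  obtain x where x: "x < u" "{x..<u} \<inter> ?T = {}"
    using exists_just_before[OF fin, of "u - 1" u UNIV] by auto
  obtain y where y: "u < y" "{u<..y} \<inter> ?T = {}"
    using exists_just_after[OF fin, of u "u + 1" UNIV] by auto
  have "x \<notin> ?T" "y \<notin> ?T" using x y by auto
  moreover have "?T \<inter> {..<y} = insert u (?T \<inter> {..<x})"
  proof (rule set_eqI)
    fix t
    have "t \<in> ?T \<Longrightarrow> x \<le> t \<Longrightarrow> t < u \<Longrightarrow> False" using x(2) by auto
    moreover have "t \<in> ?T \<Longrightarrow> u < t \<Longrightarrow> t < y \<Longrightarrow> False"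
      using y(2) by (meson disjoint_iff greaterThanAtMost_iff less_imp_le)
    ultimately show "t \<in> ?T \<inter> {..<y} \<longleftrightarrow> t \<in> insert u (?T \<inter> {..<x})"
      using x(1) y(1) u by (cases "x \<le> t"; cases t u rule: linorder_cases) auto
  qed
  moreover have "arc_after D u = arc_at D y" "arc_before D u = arc_at D x"
    using arc_after_eq[OF y u] arc_before_eq[OF x u] by auto
  ultimately show ?thesis using fin x by (simp add: jump_def cycle_of_index_arc_at[OF D])
qed

lemma is_cycle_cycle_of_index:
  assumes D: "long_diagram D"
  shows "is_cycle D (cycle_of_index \<pi> \<rho> D)"
  unfolding is_cycle_iff_jump[OF D]
  by (simp add: jump_cycle_of_index[OF D] other_param_in[OF D] weight_other_param[OF D])

lemma cycle_eq_cycle_of_index: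
  assumes D: "long_diagram D" and cyc: "is_cycle D (\<delta> D)"
    and x0: "\<And>u. u \<in> crossing_params D \<Longrightarrow> x0 < u" and a: "a \<in> arcs D"
  shows "\<delta> D a = cycle_of_index (\<lambda>D. jump_at_crossing D (\<delta> D)) (\<delta> D (arc_at D x0)) D a"
proof -
  let ?T = "crossing_params D"
  from a obtain x where x: "x \<notin> ?T" "a = arc_at D x" by (auto simp: arcs_eq)
  have "\<delta> D (arc_at D x) = \<delta> D (arc_at D x0) + (\<Sum>u\<in>?T \<inter> {..<x}. jump D (\<delta> D) u)"
  proof (cases "x0 < x")
    case True
    have "?T \<inter> {x0<..<x} = ?T \<inter> {..<x}" using x0 by auto
    then show ?thesis using chain_telescope[OF D True _ x(1), of "\<delta> D"] x0 by fastforce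
  next
    case False
    have "arc_at D x = arc_at D x0" by (rule arc_at_cong) (use False x0 in \<open>fastforce+\<close>)
    moreover have "?T \<inter> {..<x} = {}" using False x0 by fastforce
    ultimately show ?thesis by simp
  qed
  also have "(\<Sum>u\<in>?T \<inter> {..<x}. jump D (\<delta> D) u) =
      (\<Sum>u\<in>?T \<inter> {..<x}. weight D (jump_at_crossing D (\<delta> D)) u)"
    by (intro sum.cong) (auto simp: cycle_jump_eq_weight[OF D cyc])
  finally show ?thesis using x by (simp add: cycle_of_index_arc_at[OF D])
qed

section \<open>The intersection number with a closed half\<close>

text \<open>
  The contribution of the crossing parameter \<open>u\<close> to the intersection number of a path that runs
  along the diagram, pushed off to its left, with the chain \<open>c\<close>.
\<close>

definition meet :: "diagram \<Rightarrow> (real set \<Rightarrow> 'a::ab_group_add) \<Rightarrow> real \<Rightarrow> 'a" where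
  "meet D c u = (if ascends_right D u then c (arc_after D (other_param D u))
     else - c (arc_before D (other_param D u)))"

text \<open>
  The intersection number of the part of the diagram before \<open>x\<close>, pushed off to its left.
\<close>

definition swept :: "diagram \<Rightarrow> (real set \<Rightarrow> 'a::ab_group_add) \<Rightarrow> real \<Rightarrow> 'a" where
  "swept D c x = crossing_sum D (meet D c) {..<x}"

definition cycle_parity :: "diagram \<Rightarrow> (real set \<Rightarrow> 'a::ab_group_add) \<Rightarrow> complex \<Rightarrow> 'a" where
  "cycle_parity D c v = swept D c (SW_NE D v) - swept D c (SE_NW D v) + c (arc_SW D v)"

lemma half_intersection_meet:
  "half_intersection D v c = (\<Sum>u\<in>crossing_params D \<inter> interior (closed_half D v). meet D c u) +
     (if closed_half D v = right_half D v then c (arc_NW D v) - c (arc_SW D v) else 0)"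
  by (simp add: half_intersection_def meet_def ascends_right_def Let_def)

lemma swept_diff:
  assumes D: "long_diagram D" and "s < t" and s: "s \<in> crossing_params D"
  shows "swept D c t - swept D c s = meet D c s + crossing_sum D (meet D c) {s<..<t}"
proof -
  let ?T = "crossing_params D"
  have "?T \<inter> {..<t} = ?T \<inter> {..<s} \<union> insert s (?T \<inter> {s<..<t})" using assms(2,3) by auto
  moreover have "(\<Sum>u\<in>?T \<inter> {..<s} \<union> insert s (?T \<inter> {s<..<t}). meet D c u) =
     (\<Sum>u\<in>?T \<inter> {..<s}. meet D c u) + (\<Sum>u\<in>insert s (?T \<inter> {s<..<t}). meet D c u)"
    by (rule sum.union_disjoint) (auto simp: finite_crossing_params[OF D])
  ultimately show ?thesis by (simp add: swept_def finite_crossing_params[OF D])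
qed

text \<open>
  The difference of the values of \<open>swept\<close> at the ends of the closed half also contains the term of
  the parameter at which the half starts. If the closed half is the right one, this term is
  \<open>\<delta>\<^bsub>NW\<^esub>\<close>, a part of the corner term; if it is the left one, the term is \<open>- \<delta>\<^bsub>SW\<^esub>\<close>, and the corner
  term is zero. In both cases the same expression results.
\<close>

lemma half_intersection_cycle_parity:
  assumes D: "long_diagram D" and v: "v \<in> crossings D"
  shows "- int_scale (order_sign D v) (half_intersection D v c) = cycle_parity D c v"
proof -
  let ?s = "SW_NE D v" and ?t = "SE_NW D v"
  note s = crossing_at_SW_NE[OF D v]
  note ch = closed_half_eq[OF D v]
  have t: "?t \<in> crossing_params D" using s other_param_in[OF D s(1)] by simp
  have ot: "other_param D ?t = ?s" using s other_param_involutive[OF D s(1)] by simp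
  have asc: "\<not> ascends_right D ?t" using s ascends_right_other[OF D s(1)] by simp
  show ?thesis
  proof (cases "?s < ?t")
    case True
    have "meet D c ?s = c (arc_NW D v)" using s by (simp add: meet_def arc_NW_def)
    moreover have "interior (closed_half D v) = {?s<..<?t}" by (simp add: ch(1)[OF True])
    ultimately show ?thesis using ch(2,3)[OF True] swept_diff[OF D True s(1), of c]
      by (simp only: half_intersection_meet cycle_parity_def int_scale_1 simp_thms if_True)
         (simp add: algebra_simps)
  next
    case False
    then have ts: "?t < ?s" using ch(7) by simp
    have "meet D c ?t = - c (arc_SW D v)" using asc ot by (simp add: meet_def arc_SW_def)
    moreover have "interior (closed_half D v) = {?t<..<?s}" by (simp add: ch(4)[OF ts])
    ultimately show ?thesis using ch(5,6)[OF ts] swept_diff[OF D ts t, of c]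
      by (simp only: half_intersection_meet cycle_parity_def int_scale_minus_one simp_thms if_False)
         (simp add: algebra_simps)
  qed
qed

lemma half_intersection_add:
  "half_intersection D v (\<lambda>a. c a + c' a) = half_intersection D v c + half_intersection D v c'"
proof -
  have "meet D (\<lambda>a. c a + c' a) u = meet D c u + meet D c' u" for u
    by (simp add: meet_def)
  then show ?thesis by (simp add: half_intersection_meet sum.distrib)
qed

lemma half_intersection_int_scale:
  "half_intersection D v (\<lambda>a. int_scale (k a) x) = int_scale (half_intersection D v k) x"
proof -
  have "meet D (\<lambda>a. int_scale (k a) x) u = int_scale (meet D k u) x" for u
    by (simp add: meet_def int_scale_minus)
  then show ?thesis by (simp add: half_intersection_meet int_scale_sum int_scale_add int_scale_diff)
qed

lemma half_intersection_zero: "half_intersection D v (\<lambda>a. 0 :: 'a::ab_group_add) = 0"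
proof -
  have "meet D (\<lambda>a. 0 :: 'a) u = 0" for u by (simp add: meet_def)
  then show ?thesis by (simp add: half_intersection_meet)
qed

lemma half_intersection_sum:
  "half_intersection D v (\<lambda>a. \<Sum>i\<in>I. c i a) = (\<Sum>i\<in>I. half_intersection D v (c i))"
  by (induction I rule: infinite_finite_induct) (simp_all add: half_intersection_zero half_intersection_add)

lemma half_intersection_scaled:
  assumes "e = 1 \<or> e = (-1::int)"
  shows "half_intersection D v (\<lambda>a. e * k a) = e * half_intersection D v (k :: real set \<Rightarrow> int)"
proof -
  have "meet D (\<lambda>a. e * k a) u = e * meet D k u" for u
    by (simp add: meet_def)
  then show ?thesis by (simp add: half_intersection_meet sum_distrib_left algebra_simps)
qed

lemma order_sign_cases: "order_sign D v = 1 \<or> order_sign D v = -1"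
  by (simp add: order_sign_def)

text \<open>
  The intersection number is linear in the chain, so the double sum collapses.
\<close>

lemma parity_of_index_eq_cycle_parity:
  assumes D: "long_diagram D" and v: "v \<in> crossings D"
  shows "parity_of_index \<pi> \<rho> D v = cycle_parity D (cycle_of_index \<pi> \<rho> D) v"
proof -
  have "half_intersection D v (cycle_of_index \<pi> \<rho> D) =
    (\<Sum>v'\<in>crossings D. int_scale (order_sign D v' * half_intersection D v (piece_chain (closed_half D v'))) (\<pi> D v'))
     + int_scale (half_intersection D v whole_chain) \<rho>"
    unfolding cycle_of_index_def half_intersection_add half_intersection_sum half_intersection_int_scale
    by (simp add: half_intersection_scaled[OF order_sign_cases])
  then show ?thesis unfolding half_intersection_cycle_parity[OF D v, symmetric] parity_of_index_def
    using order_sign_cases[of D v] by (auto simp: index_parity_def int_scale_minus)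
qed

section \<open>Isotopies and detour moves\<close>

text \<open>
  After the change of parameter \<open>r\<close> the two diagrams have the same signed Gauss code. Isotopies and
  detour moves are of this kind, and chains, indices and parities depend on the code only.
\<close>

definition same_code :: "(real \<Rightarrow> real) \<Rightarrow> diagram \<Rightarrow> diagram \<Rightarrow> bool" where
  "same_code r D D' \<longleftrightarrow> long_diagram D \<and> long_diagram D' \<and> strict_mono r \<and> surj r \<and>
     crossing_params D' = r ` crossing_params D \<and>
     (\<forall>u\<in>crossing_params D. other_param D' (r u) = r (other_param D u) \<and>
        (ascends_right D' (r u) \<longleftrightarrow> ascends_right D u))"

lemma strict_mono_surj_image_interval:
  fixes r :: "real \<Rightarrow> real"
  assumes "strict_mono r" "surj r"
  shows "r ` {x..<y} = {r x..<r y}" "r ` {x<..y} = {r x<..r y}" "r ` {..<y} = {..<r y}"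
    "r ` {x..y} = {r x..r y}"
proof -
  have inj: "inj r" using assms(1) by (rule strict_mono_imp_inj_on)
  have *: "r ` A = B" if "\<And>z. z \<in> A \<longleftrightarrow> r z \<in> B" for A B
  proof (rule set_eqI)
    fix w obtain z where "w = r z" using assms(2) by blast
    then show "w \<in> r ` A \<longleftrightarrow> w \<in> B" using that inj by (simp add: inj_image_mem_iff)
  qed
  show "r ` {x..<y} = {r x..<r y}" "r ` {x<..y} = {r x<..r y}" "r ` {..<y} = {..<r y}"
      "r ` {x..y} = {r x..r y}"
    by (rule *; simp add: strict_mono_less[OF assms(1)] strict_mono_less_eq[OF assms(1)])+
qed

lemma strict_mono_surj_image_Collect:
  fixes r :: "real \<Rightarrow> real"
  assumes "strict_mono r" "surj r" "\<And>z. P' (r z) \<longleftrightarrow> P z"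
  shows "{w. P' w} = r ` {z. P z}"
proof (rule set_eqI)
  fix w obtain z where "w = r z" using assms(2) by blast
  then show "w \<in> {w. P' w} \<longleftrightarrow> w \<in> r ` {z. P z}"
    using assms(3) strict_mono_imp_inj_on[OF assms(1), of UNIV] by (simp add: inj_image_mem_iff)
qed

context
  fixes r D D'
  assumes code: "same_code r D D'"
begin

lemma code_basic:
  shows "long_diagram D" "long_diagram D'" "strict_mono r" "surj r" "inj r"
    "crossing_params D' = r ` crossing_params D"
  using code strict_mono_imp_inj_on[of r UNIV] by (auto simp: same_code_def)

lemma code_arc_before: "arc_before D' (r u) = r ` arc_before D u"
proof -
  have *: "{r x..<r u} \<inter> crossing_params D' = {} \<longleftrightarrow> {x..<u} \<inter> crossing_params D = {}" for x
    unfolding code_basic(6) strict_mono_surj_image_interval(1)[OF code_basic(3,4), symmetric]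
    using image_Int[OF code_basic(5), of "{x..<u}" "crossing_params D"] by auto
  show ?thesis unfolding arc_before_def
    by (rule strict_mono_surj_image_Collect[OF code_basic(3,4)]) (simp add: * strict_mono_less[OF code_basic(3)])
qed

lemma code_arc_after: "arc_after D' (r u) = r ` arc_after D u"
proof -
  have *: "{r u<..r x} \<inter> crossing_params D' = {} \<longleftrightarrow> {u<..x} \<inter> crossing_params D = {}" for x
    unfolding code_basic(6) strict_mono_surj_image_interval(2)[OF code_basic(3,4), symmetric]
    using image_Int[OF code_basic(5), of "{u<..x}" "crossing_params D"] by auto
  show ?thesis unfolding arc_after_def
    by (rule strict_mono_surj_image_Collect[OF code_basic(3,4)]) (simp add: * strict_mono_less[OF code_basic(3)])
qed

lemma code_arc_at:
  assumes x: "x \<notin> crossing_params D"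
  shows "r x \<notin> crossing_params D'" "arc_at D' (r x) = r ` arc_at D x"
proof -
  show x': "r x \<notin> crossing_params D'" using x code_basic(5,6) by (auto simp: inj_image_mem_iff)
  have mm: "min (r y) (r x) = r (min y x)" "max (r y) (r x) = r (max y x)" for y
    using strict_mono_less_eq[OF code_basic(3)] by (auto simp: min_def max_def)
  have "r y \<in> arc_at D' (r x) \<longleftrightarrow> y \<in> arc_at D x" for y
    unfolding mem_arc_at[OF x] mem_arc_at[OF x'] mm code_basic(6)
      strict_mono_surj_image_interval(4)[OF code_basic(3,4), symmetric]
    using image_Int[OF code_basic(5), of "{min y x..max y x}" "crossing_params D"] by auto
  then show "arc_at D' (r x) = r ` arc_at D x"
    using strict_mono_surj_image_Collect[OF code_basic(3,4), of "\<lambda>w. w \<in> arc_at D' (r x)" "\<lambda>z. z \<in> arc_at D x"]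
    by simp
qed

lemma code_SW_NE:
  assumes v: "v \<in> crossings D"
  shows "SW_NE D' (curve D' (r (SW_NE D v))) = r (SW_NE D v)"
    and "SE_NW D' (curve D' (r (SW_NE D v))) = r (SE_NW D v)"
proof -
  note s = crossing_at_SW_NE[OF code_basic(1) v]
  have "r (SW_NE D v) \<in> crossing_params D'" using s(1) code_basic(6) by auto
  then show "SW_NE D' (curve D' (r (SW_NE D v))) = r (SW_NE D v)"
    "SE_NW D' (curve D' (r (SW_NE D v))) = r (SE_NW D v)"
    using code s by (auto simp: SW_NE_eq[OF code_basic(2)] SE_NW_eq[OF code_basic(2)] same_code_def)
qed

lemma code_sum:
  assumes "\<And>u. u \<in> crossing_params D \<Longrightarrow> f' (r u) = f u"
  shows "crossing_sum D' f' {..<r x} = crossing_sum D f {..<x}"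
proof -
  have "crossing_params D' \<inter> {..<r x} = r ` (crossing_params D \<inter> {..<x})"
    unfolding code_basic(6) strict_mono_surj_image_interval(3)[OF code_basic(3,4), symmetric]
      image_Int[OF code_basic(5)] ..
  then show ?thesis using assms code_basic(5) by (simp add: sum.reindex inj_on_def)
qed

lemma code_cycle_of_index:
  assumes "\<And>u. u \<in> crossing_params D \<Longrightarrow> \<pi> D' (curve D' (r u)) = \<pi> D (curve D u)"
    and a: "a \<in> arcs D"
  shows "cycle_of_index \<pi> \<rho> D' (r ` a) = cycle_of_index \<pi> \<rho> D a"
proof -
  from a obtain x where x: "x \<notin> crossing_params D" "a = arc_at D x" by (auto simp: arcs_eq)
  have "weight D' (\<pi> D') (r u) = weight D (\<pi> D) u" if "u \<in> crossing_params D" for u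
    using assms(1)[OF that] code that by (simp add: weight_def same_code_def)
  then show ?thesis unfolding x(2) code_arc_at(2)[OF x(1), symmetric]
      cycle_of_index_arc_at[OF code_basic(1) x(1)]
      cycle_of_index_arc_at[OF code_basic(2) code_arc_at(1)[OF x(1)]]
    by (simp add: code_sum)
qed

lemma code_jump_and_parity:
  assumes c: "\<And>a. a \<in> arcs D \<Longrightarrow> c a = c' (r ` a)" and v: "v \<in> crossings D"
  defines "v' \<equiv> curve D' (r (SW_NE D v))"
  shows "jump_at_crossing D' c' v' = jump_at_crossing D c v"
    and "cycle_parity D' c' v' = cycle_parity D c v"
proof -
  note s = crossing_at_SW_NE[OF code_basic(1) v]
  have b: "c' (arc_before D' (r u)) = c (arc_before D u)" if "u \<in> crossing_params D" for u
    unfolding code_arc_before using c[OF arcs_at_crossing(1)[OF code_basic(1) that]] by simp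
  have f: "c' (arc_after D' (r u)) = c (arc_after D u)" if "u \<in> crossing_params D" for u
    unfolding code_arc_after using c[OF arcs_at_crossing(2)[OF code_basic(1) that]] by simp
  show "jump_at_crossing D' c' v' = jump_at_crossing D c v"
    using b[OF s(1)] f[OF s(1)] by (simp add: arc_SW_def arc_NE_def v'_def code_SW_NE[OF v])
  have "meet D' c' (r u) = meet D c u" if "u \<in> crossing_params D" for u
    using code that b f other_param_in[OF code_basic(1) that] by (simp add: meet_def same_code_def)
  then have "swept D' c' (r x) = swept D c x" for x
    unfolding swept_def by (rule code_sum)
  then show "cycle_parity D' c' v' = cycle_parity D c v"
    using b[OF s(1)] by (simp add: cycle_parity_def arc_SW_def v'_def code_SW_NE[OF v])
qed

end

lemma zero_less_mult_pos_iff: "0 < x \<Longrightarrow> 0 < x * y \<longleftrightarrow> 0 < y" for x y :: real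
  by (simp add: zero_less_mult_iff)

lemma orient_linear:
  assumes "linear L"
  shows "orient (L u) (L w) = orient (L 1) (L \<i>) * orient u w"
proof -
  have L: "L z = Re z *\<^sub>R L 1 + Im z *\<^sub>R L \<i>" for z
  proof -
    have "z = Re z *\<^sub>R 1 + Im z *\<^sub>R \<i>" by (simp add: complex_eq_iff)
    then have "L z = L (Re z *\<^sub>R 1 + Im z *\<^sub>R \<i>)" by simp
    also have "\<dots> = Re z *\<^sub>R L 1 + Im z *\<^sub>R L \<i>"
      by (simp only: linear_add[OF assms] linear_scale[OF assms])
    finally show ?thesis .
  qed
  show ?thesis unfolding L[of u] L[of w] by (simp add: orient_def) (simp add: algebra_simps)
qed

lemma velocity_works:
  assumes "long_diagram D"
  shows "(curve D has_vector_derivative velocity D t) (at t)"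
  using assms by (auto simp: long_diagram_def velocity_def C1_differentiable_on_eq vector_derivative_works)

lemma velocity_transform:
  assumes "long_diagram D" "long_diagram D'" "open U" "t \<in> U" "\<And>x. x \<in> U \<Longrightarrow> curve D' x = curve D x"
  shows "velocity D' t = velocity D t"
proof -
  have "(curve D' has_vector_derivative velocity D t) (at t)"
    by (rule has_vector_derivative_transform_within_open[OF velocity_works[OF assms(1)] assms(3,4)])
       (simp add: assms(5))
  then show ?thesis using velocity_works[OF assms(2)] vector_derivative_unique_at by blast
qed

text \<open>
  The Jacobian is positive at time \<open>0\<close>, where the map is the identity, and it depends continuously on
  the time without vanishing.
\<close>

lemma ambient_isotopy_orient:
  assumes "ambient_isotopy H"
  obtains L where "\<And>z. (H 1 has_derivative L z) (at z)" "\<And>z. orient (L z 1) (L z \<i>) > 0"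
proof -
  from assms obtain H' where H: "H 0 = id"
    and d: "\<And>s z. s \<in> {0..1} \<Longrightarrow> (H s has_derivative H' s z) (at z)"
    and nz: "\<And>s z. s \<in> {0..1} \<Longrightarrow> orient (H' s z 1) (H' s z \<i>) \<noteq> 0"
    and cont: "\<And>w. continuous_on ({0..1} \<times> UNIV) (\<lambda>(s, z). H' s z w)"
    unfolding ambient_isotopy_def by blast
  have "orient (H' 1 z 1) (H' 1 z \<i>) > 0" for z
  proof (rule ccontr)
    assume neg: "\<not> orient (H' 1 z 1) (H' 1 z \<i>) > 0"
    have "H' 0 z = id"
      using has_derivative_unique[OF d[of 0 z], of id] H by (simp add: id_def)
    then have p0: "orient (H' 0 z 1) (H' 0 z \<i>) > 0" by (simp add: orient_def)
    have c: "continuous_on {0..1} (\<lambda>s. H' s z w)" for w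
    proof -
      have "continuous_on {0..1} (\<lambda>s::real. (s, z))" by (intro continuous_intros)
      then show ?thesis using continuous_on_compose2[OF cont[of w], of "{0..1}" "\<lambda>s. (s, z)"] by auto
    qed
    have "continuous_on {0..1} (\<lambda>s. orient (H' s z 1) (H' s z \<i>))"
      unfolding orient_def by (intro continuous_intros c)
    then have "\<exists>s\<ge>0. s \<le> 1 \<and> orient (H' s z 1) (H' s z \<i>) = 0"
      using IVT2'[of "\<lambda>s. orient (H' s z 1) (H' s z \<i>)" 1 0 0] neg p0 by auto
    then show False using nz by auto
  qed
  then show ?thesis using that[of "H' 1"] d by auto
qed

text \<open>
  By the chain rule the velocities change by a linear map of positive determinant, up to positive
  factors.
\<close>

lemma isotopy_same_code:
  assumes "isotopy_move H r D D'"
  shows "same_code r D D'" "\<And>u. curve D' (r u) = H 1 (curve D u)"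
proof -
  from assms have D: "long_diagram D" and D': "long_diagram D'" and H: "ambient_isotopy H"
    and r: "bij r" "\<And>t. \<exists>d>0. (r has_real_derivative d) (at t)"
    and curve: "\<And>t. curve D' (r t) = H 1 (curve D t)" and over: "overpasses D' = r ` overpasses D"
    by (auto simp: isotopy_move_def)
  show "curve D' (r u) = H 1 (curve D u)" for u by (rule curve)
  have sm: "strict_mono r"
    unfolding strict_mono_def using DERIV_pos_imp_increasing[of _ _ r] r(2) by blast
  have injH: "inj (H 1)" using H by (auto simp: ambient_isotopy_def bij_def)
  have cr: "crossings D' = H 1 ` crossings D" by (simp add: crossings_def over image_image curve)
  have mem: "r u \<in> crossing_params D' \<longleftrightarrow> u \<in> crossing_params D" for u
    by (simp add: crossing_params_def curve cr inj_image_mem_iff[OF injH])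
  have T: "crossing_params D' = r ` crossing_params D"
    using strict_mono_surj_image_Collect[OF sm bij_is_surj[OF r(1)],
        of "\<lambda>w. w \<in> crossing_params D'" "\<lambda>z. z \<in> crossing_params D"] mem by simp
  have op: "other_param D' (r u) = r (other_param D u)" if u: "u \<in> crossing_params D" for u
    using other_param_neq[OF D u] curve_other_param[OF D u] r(1)
    by (intro other_param_unique[OF D']) (auto simp: curve bij_def inj_eq)
  obtain L where L: "\<And>z. (H 1 has_derivative L z) (at z)" "\<And>z. orient (L z 1) (L z \<i>) > 0"
    using ambient_isotopy_orient[OF H] by metis
  have vel: "\<exists>d>0. d *\<^sub>R velocity D' (r t) = L (curve D t) (velocity D t)" for t
  proof -
    obtain d where d: "d > 0" "(r has_real_derivative d) (at t)" using r(2) by blast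
    have "((curve D' \<circ> r) has_vector_derivative d *\<^sub>R velocity D' (r t)) (at t)"
      using d(2) velocity_works[OF D', of "r t"]
      by (intro vector_diff_chain_at) (simp_all add: has_real_derivative_iff_has_vector_derivative)
    moreover have "((H 1 \<circ> curve D) has_vector_derivative L (curve D t) (velocity D t)) (at t)"
    proof -
      have "((H 1 \<circ> curve D) has_derivative L (curve D t) \<circ> (\<lambda>x. x *\<^sub>R velocity D t)) (at t)"
        using velocity_works[OF D, of t] L(1)[of "curve D t"]
        by (intro diff_chain_at) (simp_all add: has_vector_derivative_def)
      moreover have "linear (L (curve D t))" using L(1) has_derivative_linear by blast
      ultimately show ?thesis by (simp add: has_vector_derivative_def o_def linear_scale)
    qed
    moreover have "curve D' \<circ> r = H 1 \<circ> curve D" by (auto simp: curve)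
    ultimately have "d *\<^sub>R velocity D' (r t) = L (curve D t) (velocity D t)"
      using vector_derivative_unique_at by metis
    with d show ?thesis by blast
  qed
  have asc: "ascends_right D' (r u) \<longleftrightarrow> ascends_right D u" if u: "u \<in> crossing_params D" for u
  proof -
    let ?w = "other_param D u" and ?L = "L (curve D u)"
    obtain d e where d: "d > 0" "d *\<^sub>R velocity D' (r u) = ?L (velocity D u)"
      and e: "e > 0" "e *\<^sub>R velocity D' (r ?w) = ?L (velocity D ?w)"
      using vel[of u] vel[of ?w] curve_other_param[OF D u] by auto
    have lin: "linear ?L" using L(1) has_derivative_linear by blast
    have "d * e * orient (velocity D' (r u)) (velocity D' (r ?w)) =
        orient (d *\<^sub>R velocity D' (r u)) (e *\<^sub>R velocity D' (r ?w))"
      by (simp add: orient_def algebra_simps)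
    also have "\<dots> = orient (?L 1) (?L \<i>) * orient (velocity D u) (velocity D ?w)"
      unfolding d(2) e(2) by (rule orient_linear[OF lin])
    finally have eq: "d * e * orient (velocity D' (r u)) (velocity D' (r ?w)) =
       orient (?L 1) (?L \<i>) * orient (velocity D u) (velocity D ?w)" .
    have "0 < d * e * orient (velocity D' (r u)) (velocity D' (r ?w)) \<longleftrightarrow>
        0 < orient (velocity D' (r u)) (velocity D' (r ?w))"
      by (rule zero_less_mult_pos_iff[OF mult_pos_pos[OF d(1) e(1)]])
    moreover have "0 < orient (?L 1) (?L \<i>) * orient (velocity D u) (velocity D ?w) \<longleftrightarrow>
        0 < orient (velocity D u) (velocity D ?w)"
      using L(2)[of "curve D u"] by (simp add: zero_less_mult_iff)
    ultimately show ?thesis using eq by (simp add: ascends_right_def op[OF u])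
  qed
  show "same_code r D D'" using D D' sm r(1) T op asc by (simp add: same_code_def bij_is_surj)
qed

lemma detour_same_code:
  assumes "detour_move D D'"
  shows "same_code id D D'" "\<And>u. u \<in> crossing_params D \<Longrightarrow> curve D' u = curve D u"
proof -
  from assms obtain a b where D: "long_diagram D" and D': "long_diagram D'"
    and over: "overpasses D' = overpasses D" and eq: "\<And>t. t \<notin> {a<..<b} \<Longrightarrow> curve D' t = curve D t"
    and no: "{a..b} \<inter> crossing_params D = {}" "{a..b} \<inter> crossing_params D' = {}"
    by (auto simp: detour_move_def)
  have out: "t \<notin> {a..b}" if "t \<in> crossing_params D \<or> t \<in> crossing_params D'" for t
    using that no by blast
  have eqo: "curve D' t = curve D t" if "t \<notin> {a..b}" for t using that by (intro eq) auto
  show "curve D' u = curve D u" if "u \<in> crossing_params D" for u using eqo out that by blast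
  have "curve D' t = curve D t" if "t \<in> overpasses D" for t
    using that out[of t] overpasses_subset[of D] eqo by blast
  then have cr: "crossings D' = crossings D" unfolding crossings_def over by (rule image_cong[OF refl])
  have T: "crossing_params D' = crossing_params D"
  proof -
    have "t \<in> crossing_params D' \<longleftrightarrow> t \<in> crossing_params D" if "t \<notin> {a..b}" for t
      using eqo[OF that] by (simp add: crossing_params_def cr)
    then show ?thesis using out by blast
  qed
  have op: "other_param D' u = other_param D u" if u: "u \<in> crossing_params D" for u
    using other_param_neq[OF D u] curve_other_param[OF D u] eqo out other_param_in[OF D u] u
    by (intro other_param_unique[OF D']) auto
  have vel: "velocity D' t = velocity D t" if "t \<notin> {a..b}" for t
    by (rule velocity_transform[OF D D', of "- {a..b}"]) (use that eqo in auto)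
  show "same_code id D D'"
    using D D' T op vel out other_param_in[OF D] by (auto simp: same_code_def strict_mono_def ascends_right_def)
qed

section \<open>Changes inside a disc\<close>

definition strands :: "nat \<Rightarrow> (nat \<Rightarrow> real) \<Rightarrow> (nat \<Rightarrow> real) \<Rightarrow> real set" where
  "strands n a b = (\<Union>k\<in>{1..n}. {a k..b k})"

definition open_strands :: "nat \<Rightarrow> (nat \<Rightarrow> real) \<Rightarrow> (nat \<Rightarrow> real) \<Rightarrow> real set" where
  "open_strands n a b = (\<Union>k\<in>{1..n}. {a k<..<b k})"

lemma open_strands_subset: "open_strands n a b \<subseteq> strands n a b"
  unfolding strands_def open_strands_def by fastforce

text \<open>
  The effect of a move in a disc that meets the diagram in the strands \<open>[a k, b k]\<close>: crossings that
  involve no strand stay the same, with their roles, and no crossing lies on the boundary of the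
  disc.
\<close>

definition agree_outside ::
    "nat \<Rightarrow> (nat \<Rightarrow> real) \<Rightarrow> (nat \<Rightarrow> real) \<Rightarrow> diagram \<Rightarrow> diagram \<Rightarrow> bool" where
  "agree_outside n a b D D' \<longleftrightarrow> long_diagram D \<and> long_diagram D' \<and>
     (\<forall>k\<in>{1..n}. a k < b k) \<and> disjoint_family_on (\<lambda>k. {a k..b k}) {1..n} \<and>
     (\<forall>k\<in>{1..n}. \<forall>E\<in>{D, D'}. a k \<notin> crossing_params E \<and> b k \<notin> crossing_params E) \<and>
     crossing_params D - strands n a b = crossing_params D' - strands n a b \<and>
     (\<forall>u\<in>crossing_params D - strands n a b. other_param D u \<notin> strands n a b \<and>
        other_param D' u = other_param D u \<and> (ascends_right D' u \<longleftrightarrow> ascends_right D u) \<and>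
        curve D' u = curve D u)"

lemma agree_outside_sym:
  assumes "agree_outside n a b D D'"
  shows "agree_outside n a b D' D"
proof -
  have eq: "crossing_params D - strands n a b = crossing_params D' - strands n a b"
    using assms unfolding agree_outside_def by blast
  show ?thesis
    using assms unfolding agree_outside_def insert_commute[of D' D] eq by simp
qed

text \<open>
  A point outside the open strands has each strand entirely before or entirely after it.
\<close>

lemma strand_prefix_sum:
  assumes E: "long_diagram E" and ab: "\<And>k. k \<in> {1..n} \<Longrightarrow> a k < b k"
    and disj: "disjoint_family_on (\<lambda>k. {a k..b k}) {1..n}"
    and ends: "\<And>k. k \<in> {1..n} \<Longrightarrow> a k \<notin> crossing_params E \<and> b k \<notin> crossing_params E"
    and x: "x \<notin> open_strands n a b"
  shows "crossing_sum E f {..<x} =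
    (\<Sum>u\<in>(crossing_params E - strands n a b) \<inter> {..<x}. f u) +
    (\<Sum>k\<in>{k \<in> {1..n}. b k \<le> x}. \<Sum>u\<in>crossing_params E \<inter> {a k..b k}. f u)"
proof -
  let ?T = "crossing_params E" and ?K = "{k \<in> {1..n}. b k \<le> x}"
  note fin = finite_crossing_params[OF E]
  have in_strand: "u < x \<longleftrightarrow> b k \<le> x" if "k \<in> {1..n}" "u \<in> ?T" "u \<in> {a k..b k}" for u k
  proof -
    have "u \<noteq> a k" "u \<noteq> b k" using that ends by auto
    moreover have "x \<notin> {a k<..<b k}" using x that(1) unfolding open_strands_def by blast
    ultimately show ?thesis using that(3) by auto
  qed
  have "?T \<inter> {..<x} = ((?T - strands n a b) \<inter> {..<x}) \<union> (\<Union>k\<in>?K. ?T \<inter> {a k..b k})"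
  proof (rule set_eqI)
    fix u show "u \<in> ?T \<inter> {..<x} \<longleftrightarrow> u \<in> ((?T - strands n a b) \<inter> {..<x}) \<union> (\<Union>k\<in>?K. ?T \<inter> {a k..b k})"
      using in_strand[of _ u] unfolding strands_def by blast
  qed
  also have "sum f \<dots> = (\<Sum>u\<in>(?T - strands n a b) \<inter> {..<x}. f u) + sum f (\<Union>k\<in>?K. ?T \<inter> {a k..b k})"
    by (rule sum.union_disjoint) (use fin in \<open>auto simp: strands_def\<close>)
  also have "sum f (\<Union>k\<in>?K. ?T \<inter> {a k..b k}) = (\<Sum>k\<in>?K. \<Sum>u\<in>?T \<inter> {a k..b k}. f u)"
  proof (rule sum.UNION_disjoint)
    show "\<forall>i\<in>?K. \<forall>j\<in>?K. i \<noteq> j \<longrightarrow> (?T \<inter> {a i..b i}) \<inter> (?T \<inter> {a j..b j}) = {}"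
      using disj unfolding disjoint_family_on_def by blast
  qed (use fin in auto)
  finally show ?thesis .
qed

context
  fixes n :: nat and a b :: "nat \<Rightarrow> real" and D D' :: diagram
  assumes agree: "agree_outside n a b D D'"
begin

lemma agree_basic:
  shows "long_diagram D" "long_diagram D'"
    "\<And>k. k \<in> {1..n} \<Longrightarrow> a k < b k" "disjoint_family_on (\<lambda>k. {a k..b k}) {1..n}"
    "\<And>k. k \<in> {1..n} \<Longrightarrow> a k \<notin> crossing_params D \<and> b k \<notin> crossing_params D"
    "\<And>k. k \<in> {1..n} \<Longrightarrow> a k \<notin> crossing_params D' \<and> b k \<notin> crossing_params D'"
    "crossing_params D - strands n a b = crossing_params D' - strands n a b"
  using agree unfolding agree_outside_def by blast+

lemma agree_outer:
  assumes "u \<in> crossing_params D" "u \<notin> strands n a b"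
  shows "other_param D u \<notin> strands n a b" "other_param D' u = other_param D u"
    "ascends_right D' u \<longleftrightarrow> ascends_right D u" "curve D' u = curve D u"
    "u \<in> crossing_params D'"
  using agree assms unfolding agree_outside_def by blast+

lemma agree_prefix_sum:
  assumes "\<And>u. u \<in> crossing_params D \<Longrightarrow> u \<notin> strands n a b \<Longrightarrow> f' u = f u"
    and "\<And>k. k \<in> {1..n} \<Longrightarrow>
      crossing_sum D' f' {a k..b k} = crossing_sum D f {a k..b k}"
    and x: "x \<notin> open_strands n a b"
  shows "crossing_sum D' f' {..<x} = crossing_sum D f {..<x}"
proof -
  have "(\<Sum>u\<in>(crossing_params D' - strands n a b) \<inter> {..<x}. f' u) =
      (\<Sum>u\<in>(crossing_params D - strands n a b) \<inter> {..<x}. f u)"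
    unfolding agree_basic(7)[symmetric] by (intro sum.cong) (auto simp: assms(1))
  moreover have "(\<Sum>k\<in>{k \<in> {1..n}. b k \<le> x}. \<Sum>u\<in>crossing_params D' \<inter> {a k..b k}. f' u) =
      (\<Sum>k\<in>{k \<in> {1..n}. b k \<le> x}. \<Sum>u\<in>crossing_params D \<inter> {a k..b k}. f u)"
    by (intro sum.cong refl assms(2)) auto
  moreover have "crossing_sum D f {..<x} =
      (\<Sum>u\<in>(crossing_params D - strands n a b) \<inter> {..<x}. f u) +
      (\<Sum>k\<in>{k \<in> {1..n}. b k \<le> x}. \<Sum>u\<in>crossing_params D \<inter> {a k..b k}. f u)"
    by (rule strand_prefix_sum[OF agree_basic(1) _ agree_basic(4) _ x]) (fact agree_basic(3,5))+
  moreover have "crossing_sum D' f' {..<x} =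
      (\<Sum>u\<in>(crossing_params D' - strands n a b) \<inter> {..<x}. f' u) +
      (\<Sum>k\<in>{k \<in> {1..n}. b k \<le> x}. \<Sum>u\<in>crossing_params D' \<inter> {a k..b k}. f' u)"
    by (rule strand_prefix_sum[OF agree_basic(2) _ agree_basic(4) _ x]) (fact agree_basic(3,6))+
  ultimately show ?thesis by (simp only:)
qed

lemma strand_ends_not_inside:
  assumes k: "k \<in> {1..n}"
  shows "a k \<notin> open_strands n a b" "b k \<notin> open_strands n a b"
proof -
  have "j = k" if "j \<in> {1..n}" "t \<in> {a k, b k}" "t \<in> {a j<..<b j}" for j t
  proof (rule ccontr)
    assume "j \<noteq> k"
    then have "{a j..b j} \<inter> {a k..b k} = {}"
      using agree_basic(4) k that(1) unfolding disjoint_family_on_def by blast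
    moreover have "t \<in> {a j..b j}" "t \<in> {a k..b k}" using that agree_basic(3)[OF k] by auto
    ultimately show False by blast
  qed
  then show "a k \<notin> open_strands n a b" "b k \<notin> open_strands n a b"
    unfolding open_strands_def by fastforce+
qed

lemma agree_cycle_of_index:
  assumes "\<And>u. u \<in> crossing_params D \<Longrightarrow> u \<notin> strands n a b \<Longrightarrow> \<pi> D' (curve D u) = \<pi> D (curve D u)"
    and "\<And>k. k \<in> {1..n} \<Longrightarrow> crossing_sum D' (weight D' (\<pi> D')) {a k..b k} =
       crossing_sum D (weight D (\<pi> D)) {a k..b k}"
    and x: "x \<notin> open_strands n a b" "x \<notin> crossing_params D" "x \<notin> crossing_params D'"
  shows "cycle_of_index \<pi> \<rho> D' (arc_at D' x) = cycle_of_index \<pi> \<rho> D (arc_at D x)"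
  unfolding cycle_of_index_arc_at[OF agree_basic(1) x(2)] cycle_of_index_arc_at[OF agree_basic(2) x(3)]
  by (subst agree_prefix_sum[OF _ assms(2) x(1)]) (use assms(1) in \<open>simp_all add: weight_def agree_outer\<close>)

context
  fixes c c' :: "real set \<Rightarrow> 'a::ab_group_add"
  assumes chains: "\<And>x. x \<notin> open_strands n a b \<Longrightarrow> x \<notin> crossing_params D \<Longrightarrow> x \<notin> crossing_params D' \<Longrightarrow>
    c' (arc_at D' x) = c (arc_at D x)"
begin

text \<open>
  An arc that starts or ends at a crossing outside the disc contains points outside the disc,
  even if it enters the disc later.
\<close>

lemma agree_outer_arcs:
  assumes u: "u \<in> crossing_params D" "u \<notin> strands n a b"
  shows "c' (arc_before D' u) = c (arc_before D u)" "c' (arc_after D' u) = c (arc_after D u)"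
proof -
  let ?T = "crossing_params D \<union> crossing_params D'"
  have fin: "finite ?T" using finite_crossing_params agree_basic by auto
  have op: "open (- strands n a b)" unfolding strands_def by (auto intro!: open_Compl closed_UN)
  note sub = open_strands_subset[of n a b]
  obtain x where x: "x < u" "{x..<u} \<inter> ?T = {}" "{x..u} \<subseteq> - strands n a b"
  proof (rule exists_just_before[OF fin _ op, of "u - 1" u])
    show "u - 1 < u" "u \<in> - strands n a b" using u by auto
  qed auto
  obtain y where y: "u < y" "{u<..y} \<inter> ?T = {}" "{u..y} \<subseteq> - strands n a b"
  proof (rule exists_just_after[OF fin _ op, of u "u + 1"])
    show "u < u + 1" "u \<in> - strands n a b" using u by auto
  qed auto
  have u': "u \<in> crossing_params D'" using agree_outer[OF u] by simp
  have "x \<in> {x..<u}" "x \<in> {x..u}" "y \<in> {u<..y}" "y \<in> {u..y}" using x y by auto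
  then have n: "x \<notin> ?T" "x \<notin> open_strands n a b" "y \<notin> ?T" "y \<notin> open_strands n a b"
    using x y sub by blast+
  have e: "{x..<u} \<inter> crossing_params D = {}" "{x..<u} \<inter> crossing_params D' = {}"
     "{u<..y} \<inter> crossing_params D = {}" "{u<..y} \<inter> crossing_params D' = {}"
    using x y by blast+
  show "c' (arc_before D' u) = c (arc_before D u)"
    unfolding arc_before_eq[OF x(1) e(1) u(1)] arc_before_eq[OF x(1) e(2) u'] using chains n by simp
  show "c' (arc_after D' u) = c (arc_after D u)"
    unfolding arc_after_eq[OF y(1) e(3) u(1)] arc_after_eq[OF y(1) e(4) u'] using chains n by simp
qed

lemma agree_ends:
  assumes k: "k \<in> {1..n}"
  shows "c' (arc_at D' (a k)) = c (arc_at D (a k))" "c' (arc_at D' (b k)) = c (arc_at D (b k))"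
  using chains strand_ends_not_inside[OF k] agree_basic(5,6)[OF k] by auto

lemma agree_outer_meet:
  assumes "u \<in> crossing_params D" "u \<notin> strands n a b"
  shows "meet D' c' u = meet D c u"
  using agree_outer[OF assms] agree_outer_arcs other_param_in[OF agree_basic(1) assms(1)]
  by (simp add: meet_def)

lemma agree_swept:
  assumes "\<And>k. k \<in> {1..n} \<Longrightarrow> crossing_sum D' (meet D' c') {a k..b k} =
        crossing_sum D (meet D c) {a k..b k}"
    and "x \<notin> open_strands n a b"
  shows "swept D' c' x = swept D c x"
  unfolding swept_def by (rule agree_prefix_sum[OF agree_outer_meet assms])

text \<open>
  Both sums are the difference of the values of the chains at the ends of the strand.
\<close>

lemma agree_strand_jumps:
  assumes k: "k \<in> {1..n}"
  shows "crossing_sum D' (jump D' c') {a k..b k} = crossing_sum D (jump D c) {a k..b k}"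
proof -
  have "crossing_sum E (jump E d) {a k..b k} = d (arc_at E (b k)) - d (arc_at E (a k))"
    if "long_diagram E" "a k \<notin> crossing_params E" "b k \<notin> crossing_params E" for E and d :: "real set \<Rightarrow> 'a"
  proof -
    have "{a k..b k} = insert (a k) (insert (b k) {a k<..<b k})" using agree_basic(3)[OF k] by auto
    then have "crossing_params E \<inter> {a k..b k} = crossing_params E \<inter> {a k<..<b k}"
      using that by auto
    then show ?thesis using chain_telescope[OF that(1) agree_basic(3)[OF k] that(2,3), of d] by simp
  qed
  then show ?thesis using agree_ends[OF k] agree_basic(1,2) agree_basic(5,6)[OF k] by simp
qed

lemma agree_outer_jump_and_parity:
  assumes v: "v \<in> crossings D" and out: "SW_NE D v \<notin> strands n a b"
  shows "jump_at_crossing D' c' v = jump_at_crossing D c v"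
    and "(\<And>k. k \<in> {1..n} \<Longrightarrow> crossing_sum D' (meet D' c') {a k..b k} =
        crossing_sum D (meet D c) {a k..b k}) \<Longrightarrow>
      cycle_parity D' c' v = cycle_parity D c v"
proof -
  note s = crossing_at_SW_NE[OF agree_basic(1) v]
  note o = agree_outer[OF s(1) out]
  have S: "SW_NE D' v = SW_NE D v" "SE_NW D' v = SE_NW D v"
    using s o SW_NE_eq[OF agree_basic(2) o(5)] SE_NW_eq[OF agree_basic(2) o(5)] by auto
  show "jump_at_crossing D' c' v = jump_at_crossing D c v"
    using agree_outer_arcs[OF s(1) out] by (simp add: arc_NE_def arc_SW_def S)
  assume sums: "\<And>k. k \<in> {1..n} \<Longrightarrow> crossing_sum D' (meet D' c') {a k..b k} =
        crossing_sum D (meet D c) {a k..b k}"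
  have "swept D' c' x = swept D c x" if "x \<notin> strands n a b" for x
    by (rule agree_swept[OF sums]) (use that open_strands_subset[of n a b] in auto)
  then show "cycle_parity D' c' v = cycle_parity D c v"
    using agree_outer_arcs[OF s(1) out] out o(1) s(4) by (simp add: cycle_parity_def arc_SW_def S)
qed

end

end

section \<open>First move\<close>

text \<open>
  The strands are numbered from \<open>1\<close>; the parameters \<open>p 1 2\<close> etc. are to keep this form.
\<close>

declare One_nat_def [simp del]

text \<open>
  The order of the two crossings on a straight strand of a second or third move depends on the
  direction of that strand; so \<open>p\<close> and \<open>q\<close> may come in either order.
\<close>

lemma strand_with_two_crossings:
  assumes E: "long_diagram E" and T: "crossing_params E \<inter> {a..b} = {p, q}"
    and pq: "p \<noteq> q" "a < p" "a < q" "p < b" "q < b"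
  shows "c (arc_before E p) = c (arc_at E a) + (if p < q then 0 else jump E c q)"
    and "c (arc_after E p) = c (arc_at E a) + (if p < q then 0 else jump E c q) + jump E c p"
    and "swept E c p = swept E c a + (if p < q then 0 else meet E c q)"
proof -
  let ?T = "crossing_params E"
  note fin = finite_crossing_params[OF E]
  have pT: "p \<in> ?T" "q \<in> ?T" using T by blast+
  have T': "u = p \<or> u = q" if "u \<in> ?T" "a \<le> u" "u \<le> b" for u
  proof -
    have "u \<in> ?T \<inter> {a..b}" using that by simp
    then show ?thesis unfolding T by simp
  qed
  have first: "c (arc_before E u) = c (arc_at E a) \<and> swept E c u = swept E c a"
    if "u \<in> ?T" "a < u" "\<And>t. t \<in> ?T \<Longrightarrow> a \<le> t \<Longrightarrow> t < u \<Longrightarrow> False" for u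
  proof -
    have "{a..<u} \<inter> ?T = {}" using that(3) by auto
    then have "arc_before E u = arc_at E a" using that by (intro arc_before_eq)
    moreover have "?T \<inter> {..<u} = ?T \<inter> {..<a}" using that(2,3) by fastforce
    ultimately show ?thesis by (simp add: swept_def)
  qed
  have "c (arc_before E p) = c (arc_at E a) + (if p < q then 0 else jump E c q) \<and>
    swept E c p = swept E c a + (if p < q then 0 else meet E c q)"
  proof (cases "p < q")
    case True
    have "c (arc_before E p) = c (arc_at E a) \<and> swept E c p = swept E c a"
    proof (rule first[OF pT(1) pq(2)])
      fix t assume "t \<in> ?T" "a \<le> t" "t < p"
      then show False using T'[of t] pq True by auto
    qed
    then show ?thesis using True by simp
  next
    case False
    then have qp: "q < p" using pq by simp
    have q: "c (arc_before E q) = c (arc_at E a) \<and> swept E c q = swept E c a"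
    proof (rule first[OF pT(2) pq(3)])
      fix t assume "t \<in> ?T" "a \<le> t" "t < q"
      then show False using T'[of t] pq qp by auto
    qed
    have no: "{q<..<p} \<inter> ?T = {}"
    proof (rule ccontr)
      assume "{q<..<p} \<inter> ?T \<noteq> {}"
      then obtain t where "t \<in> ?T" "q < t" "t < p" by auto
      then show False using T'[of t] pq by auto
    qed
    have "arc_after E q = arc_before E p" by (rule arc_after_eq_arc_before[OF qp no pT(2,1)])
    moreover have "swept E c p - swept E c q = meet E c q"
      using swept_diff[OF E qp pT(2), of c] no by (simp add: Int_commute)
    ultimately show ?thesis using q False by (simp add: jump_def algebra_simps)
  qed
  then show "c (arc_before E p) = c (arc_at E a) + (if p < q then 0 else jump E c q)"
    "swept E c p = swept E c a + (if p < q then 0 else meet E c q)"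
    "c (arc_after E p) = c (arc_at E a) + (if p < q then 0 else jump E c q) + jump E c p"
    by (auto simp: jump_def)
qed

definition kink :: "diagram \<Rightarrow> real \<Rightarrow> real \<Rightarrow> real \<Rightarrow> real \<Rightarrow> bool" where
  "kink D a b s t \<longleftrightarrow> a < s \<and> s < t \<and> t < b \<and> crossing_params D \<inter> {a..b} = {s, t} \<and> curve D s = curve D t"

lemma kink_other_param:
  assumes "long_diagram D" "kink D a b s t"
  shows "s \<in> crossing_params D" "t \<in> crossing_params D" "other_param D s = t" "other_param D t = s"
proof -
  show s: "s \<in> crossing_params D" and "t \<in> crossing_params D" using assms(2) by (auto simp: kink_def)
  show t: "other_param D s = t" using assms by (intro other_param_unique) (auto simp: kink_def)
  show "other_param D t = s" using other_param_involutive[OF assms(1) s] by (simp add: t)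
qed

lemma kink_weights:
  assumes D: "long_diagram D" and k: "kink D a b s t"
  shows "crossing_sum D (weight D \<pi>) {a..b} = 0"
  using k weight_other_param[OF D, of s \<pi>] by (simp add: kink_def kink_other_param[OF D k])

text \<open>
  If the strand SW-NE is passed first, both contributions are values on the two ends of
  the strand, which agree since the two jumps cancel; otherwise both are values on the loop.
\<close>

lemma kink_meets:
  assumes D: "long_diagram D" and k: "kink D a b s t" and cyc: "is_cycle D c"
  shows "crossing_sum D (meet D c) {a..b} = 0" "cycle_parity D c (curve D s) = 0"
proof -
  note o = kink_other_param[OF D k]
  have k': "a < s" "s < t" "t < b" "crossing_params D \<inter> {a..b} = {s, t}" using k by (auto simp: kink_def)
  have j: "jump D c t = - jump D c s" using cyc o by (metis is_cycle_iff_jump[OF D])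
  have asc: "ascends_right D t \<longleftrightarrow> \<not> ascends_right D s" using ascends_right_other[OF D o(1)] o by simp
  note S = strand_with_two_crossings[OF D k'(4), where c = c]
  have S': "crossing_params D \<inter> {a..b} = {t, s}" using k'(4) by auto
  note S2 = strand_with_two_crossings[OF D S', where c = c]
  have v: "c (arc_before D s) = c (arc_at D a)" "c (arc_after D t) = c (arc_at D a)"
      "c (arc_after D s) = c (arc_at D a) + jump D c s" "c (arc_before D t) = c (arc_at D a) + jump D c s"
      "swept D c s = swept D c a" "swept D c t = swept D c a + meet D c s"
    using S S2 k' j by auto
  show "crossing_sum D (meet D c) {a..b} = 0" using k' asc o v by (simp add: meet_def)
  have "SW_NE D (curve D s) = (if ascends_right D s then s else t)"
    "SE_NW D (curve D s) = (if ascends_right D s then t else s)"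
    using SW_NE_eq[OF D o(1)] SE_NW_eq[OF D o(1)] o by auto
  then show "cycle_parity D c (curve D s) = 0"
    using asc o v by (simp add: cycle_parity_def arc_SW_def meet_def)
qed

section \<open>Second move\<close>

text \<open>
  The strand of the parameters \<open>t\<^sub>1 < t\<^sub>2\<close> crosses the other one from opposite sides. The strand of \<open>s\<^sub>1\<close>
  and \<open>s\<^sub>2\<close> may run in either direction.
\<close>

definition bigon :: "diagram \<Rightarrow> (nat \<Rightarrow> real) \<Rightarrow> (nat \<Rightarrow> real) \<Rightarrow> real \<Rightarrow> real \<Rightarrow> real \<Rightarrow> real \<Rightarrow> bool" where
  "bigon D a b s\<^sub>1 s\<^sub>2 t\<^sub>1 t\<^sub>2 \<longleftrightarrow>
     s\<^sub>1 \<noteq> s\<^sub>2 \<and> a 1 < s\<^sub>1 \<and> a 1 < s\<^sub>2 \<and> s\<^sub>1 < b 1 \<and> s\<^sub>2 < b 1 \<and> a 2 < t\<^sub>1 \<and> t\<^sub>1 < t\<^sub>2 \<and> t\<^sub>2 < b 2 \<and>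
     crossing_params D \<inter> {a 1..b 1} = {s\<^sub>1, s\<^sub>2} \<and> crossing_params D \<inter> {a 2..b 2} = {t\<^sub>1, t\<^sub>2} \<and>
     other_param D s\<^sub>1 = t\<^sub>1 \<and> other_param D s\<^sub>2 = t\<^sub>2 \<and>
     (ascends_right D s\<^sub>2 \<longleftrightarrow> \<not> ascends_right D s\<^sub>1)"

context
  fixes D :: diagram and a b :: "nat \<Rightarrow> real" and s1 s2 t1 t2 :: real
  assumes D: "long_diagram D" and big: "bigon D a b s1 s2 t1 t2"
begin

lemma bigon_params:
  shows "s1 \<in> crossing_params D" "s2 \<in> crossing_params D" "t1 \<in> crossing_params D" "t2 \<in> crossing_params D"
    "other_param D s1 = t1" "other_param D s2 = t2" "ascends_right D s2 \<longleftrightarrow> \<not> ascends_right D s1"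
  using big by (auto simp: bigon_def)

lemma bigon_other_params:
  shows "other_param D t1 = s1" "other_param D t2 = s2" "curve D t1 = curve D s1" "curve D t2 = curve D s2"
    "ascends_right D t1 \<longleftrightarrow> \<not> ascends_right D s1" "ascends_right D t2 \<longleftrightarrow> ascends_right D s1"
  using bigon_params other_param_involutive[OF D] curve_other_param[OF D] ascends_right_other[OF D]
  by metis+

lemmas bigon_basic = bigon_params bigon_other_params

lemma bigon_sum:
  shows "crossing_sum D f {a 1..b 1} = f s1 + f s2"
    "crossing_sum D f {a 2..b 2} = f t1 + f t2"
  using big by (auto simp: bigon_def)

lemma bigon_weights:
  assumes "\<pi> (curve D s1) = \<pi> (curve D s2)"
  shows "crossing_sum D (weight D \<pi>) {a 1..b 1} = 0"
    "crossing_sum D (weight D \<pi>) {a 2..b 2} = 0"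
  unfolding bigon_sum using assms by (auto simp: weight_def bigon_basic)

lemma bigon_jump_at_crossing:
  assumes cyc: "is_cycle D c"
    and "crossing_sum D (jump D c) {a 1..b 1} = 0"
  shows "jump_at_crossing D c (curve D s1) = jump_at_crossing D c (curve D s2)"
proof -
  have "weight D (jump_at_crossing D c) s1 + weight D (jump_at_crossing D c) s2 = 0"
    using assms(2) unfolding bigon_sum by (simp add: cycle_jump_eq_weight[OF D cyc] bigon_basic)
  then show ?thesis
    by (cases "ascends_right D s1") (simp_all add: weight_def bigon_basic algebra_simps)
qed

text \<open>
  All intersections are with one of the two sides of the bigon or with the ends of the strands, and
  the hypothesis says that both ends of the strand of \<open>s\<^sub>1\<close> and \<open>s\<^sub>2\<close> have the same value; as the jumps
  at a crossing are opposite, this holds for the other strand, too.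
\<close>

lemma bigon_meets:
  assumes cyc: "is_cycle D c"
    and j0: "crossing_sum D (jump D c) {a 1..b 1} = 0"
  shows "crossing_sum D (meet D c) {a 1..b 1} = 0"
    "crossing_sum D (meet D c) {a 2..b 2} = 0"
    "cycle_parity D c (curve D s1) + cycle_parity D c (curve D s2) = 0"
proof -
  note o = bigon_basic
  have b: "s1 \<noteq> s2" "a 1 < s1" "a 1 < s2" "s1 < b 1" "s2 < b 1" "a 2 < t1" "t1 < t2" "t2 < b 2"
     "crossing_params D \<inter> {a 1..b 1} = {s1, s2}" "crossing_params D \<inter> {a 2..b 2} = {t1, t2}"
    using big unfolding bigon_def by blast+
  have b': "crossing_params D \<inter> {a 1..b 1} = {s2, s1}" "crossing_params D \<inter> {a 2..b 2} = {t2, t1}"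
    using b by auto
  have j: "jump D c s2 = - jump D c s1" using j0 unfolding bigon_sum by (simp add: eq_neg_iff_add_eq_0 add.commute)
  have jt: "jump D c t1 = - jump D c s1" "jump D c t2 = jump D c s1"
    using cyc o j by (metis is_cycle_iff_jump[OF D] minus_minus)+
  have c1: "s1 < s2 \<or> s2 < s1" using b by auto
  have v: "c (arc_before D s1) = c (arc_at D (a 1)) + (if s1 < s2 then 0 else - jump D c s1)"
    "c (arc_after D s1) = c (arc_at D (a 1)) + (if s1 < s2 then jump D c s1 else 0)"
    "c (arc_before D s2) = c (arc_at D (a 1)) + (if s1 < s2 then jump D c s1 else 0)"
    "c (arc_after D s2) = c (arc_at D (a 1)) + (if s1 < s2 then 0 else - jump D c s1)"
    "swept D c s1 = swept D c (a 1) + (if s1 < s2 then 0 else meet D c s2)"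
    "swept D c s2 = swept D c (a 1) + (if s1 < s2 then meet D c s1 else 0)"
    using strand_with_two_crossings[OF D b(9), where c = c] strand_with_two_crossings[OF D b'(1), where c = c]
      b j c1 by auto
  have w: "c (arc_before D t1) = c (arc_at D (a 2))"
    "c (arc_after D t1) = c (arc_at D (a 2)) - jump D c s1"
    "c (arc_before D t2) = c (arc_at D (a 2)) - jump D c s1"
    "c (arc_after D t2) = c (arc_at D (a 2))"
    "swept D c t1 = swept D c (a 2)"
    "swept D c t2 = swept D c (a 2) + meet D c t1"
    using strand_with_two_crossings[OF D b(10), where c = c] strand_with_two_crossings[OF D b'(2), where c = c]
      b jt by auto
  have m: "meet D c s1 = (if ascends_right D s1 then c (arc_after D t1) else - c (arc_before D t1))"
    "meet D c s2 = (if ascends_right D s1 then - c (arc_before D t2) else c (arc_after D t2))"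
    "meet D c t1 = (if ascends_right D s1 then - c (arc_before D s1) else c (arc_after D s1))"
    "meet D c t2 = (if ascends_right D s1 then c (arc_after D s2) else - c (arc_before D s2))"
    by (auto simp: meet_def o)
  show "crossing_sum D (meet D c) {a 1..b 1} = 0"
    "crossing_sum D (meet D c) {a 2..b 2} = 0"
    unfolding bigon_sum m v w by auto
  have S: "SW_NE D (curve D s1) = (if ascends_right D s1 then s1 else t1)"
    "SE_NW D (curve D s1) = (if ascends_right D s1 then t1 else s1)"
    "SW_NE D (curve D s2) = (if ascends_right D s1 then t2 else s2)"
    "SE_NW D (curve D s2) = (if ascends_right D s1 then s2 else t2)"
    by (auto simp: SW_NE_eq[OF D o(1)] SW_NE_eq[OF D o(2)] SE_NW_eq[OF D o(1)] SE_NW_eq[OF D o(2)] o)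
  show "cycle_parity D c (curve D s1) + cycle_parity D c (curve D s2) = 0"
    unfolding cycle_parity_def arc_SW_def S
    using c1 by (cases "ascends_right D s1"; cases "s1 < s2") (simp_all add: v w m algebra_simps)
qed

end

section \<open>Third move\<close>

text \<open>
  The picture of a third move in the chart, before or after the move. Strands \<open>1\<close> and \<open>2\<close> lie on the
  axes, and \<open>d\<^sub>1\<close> (\<open>d\<^sub>2\<close>) says that strand \<open>1\<close> (\<open>2\<close>) runs to the right (upwards). Strand \<open>3\<close> runs from
  the fourth to the second quadrant, and \<open>h\<close> says that it passes through the first one. The move
  negates \<open>h\<close>: it reverses the order of the two crossings on each strand, but keeps the roles
  of the strands at the crossings.
\<close>

definition triangle ::
    "diagram \<Rightarrow> (nat \<Rightarrow> real) \<Rightarrow> (nat \<Rightarrow> real) \<Rightarrow> (nat \<Rightarrow> nat \<Rightarrow> real) \<Rightarrow> bool \<Rightarrow> bool \<Rightarrow> bool \<Rightarrow> bool" where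
  "triangle D a b p d\<^sub>1 d\<^sub>2 h \<longleftrightarrow>
     (\<forall>i\<in>{1, 2, 3}. \<forall>j\<in>{1, 2, 3} - {i}. a i < p i j \<and> p i j < b i \<and> other_param D (p i j) = p j i) \<and>
     crossing_params D \<inter> {a 1..b 1} = {p 1 2, p 1 3} \<and>
     crossing_params D \<inter> {a 2..b 2} = {p 2 1, p 2 3} \<and>
     crossing_params D \<inter> {a 3..b 3} = {p 3 1, p 3 2} \<and>
     p 1 2 \<noteq> p 1 3 \<and> p 2 1 \<noteq> p 2 3 \<and> p 3 1 \<noteq> p 3 2 \<and>
     (p 1 2 < p 1 3 \<longleftrightarrow> d\<^sub>1 = h) \<and> (p 2 1 < p 2 3 \<longleftrightarrow> d\<^sub>2 = h) \<and> (p 3 1 < p 3 2 \<longleftrightarrow> h) \<and>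
     (ascends_right D (p 1 2) \<longleftrightarrow> d\<^sub>1 = d\<^sub>2) \<and> (ascends_right D (p 1 3) \<longleftrightarrow> d\<^sub>1) \<and>
     (ascends_right D (p 2 3) \<longleftrightarrow> d\<^sub>2)"

context
  fixes D :: diagram and a b p and d1 d2 h :: bool
  assumes D: "long_diagram D" and tri: "triangle D a b p d1 d2 h"
begin

lemma triangle_params:
  shows "p 1 2 \<in> crossing_params D" "p 1 3 \<in> crossing_params D" "p 2 1 \<in> crossing_params D"
    "p 2 3 \<in> crossing_params D" "p 3 1 \<in> crossing_params D" "p 3 2 \<in> crossing_params D"
  using tri unfolding triangle_def by blast+

lemma triangle_other_params:
  shows "other_param D (p 1 2) = p 2 1" "other_param D (p 1 3) = p 3 1" "other_param D (p 2 1) = p 1 2"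
    "other_param D (p 2 3) = p 3 2" "other_param D (p 3 1) = p 1 3" "other_param D (p 3 2) = p 2 3"
  using tri unfolding triangle_def by auto

lemma triangle_roles:
  shows "ascends_right D (p 1 2) \<longleftrightarrow> d1 = d2" "ascends_right D (p 1 3) \<longleftrightarrow> d1" "ascends_right D (p 2 3) \<longleftrightarrow> d2"
    "ascends_right D (p 2 1) \<longleftrightarrow> d1 \<noteq> d2" "ascends_right D (p 3 1) \<longleftrightarrow> \<not> d1" "ascends_right D (p 3 2) \<longleftrightarrow> \<not> d2"
  using tri ascends_right_other[OF D triangle_params(1)] ascends_right_other[OF D triangle_params(2)]
    ascends_right_other[OF D triangle_params(4)] unfolding triangle_other_params
  by (simp_all add: triangle_def)

lemma triangle_orders:
  shows "p 1 2 < p 1 3 \<longleftrightarrow> d1 = h" "p 2 1 < p 2 3 \<longleftrightarrow> d2 = h" "p 3 1 < p 3 2 \<longleftrightarrow> h"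
    "p 1 3 < p 1 2 \<longleftrightarrow> d1 \<noteq> h" "p 2 3 < p 2 1 \<longleftrightarrow> d2 \<noteq> h" "p 3 2 < p 3 1 \<longleftrightarrow> \<not> h"
  using tri unfolding triangle_def by (auto simp: not_less_iff_gr_or_eq)

lemmas triangle_basic = triangle_params triangle_other_params triangle_roles triangle_orders

lemma triangle_strands:
  shows "a 1 < p 1 2" "p 1 2 < b 1" "a 1 < p 1 3" "p 1 3 < b 1" "a 2 < p 2 1" "p 2 1 < b 2"
    "a 2 < p 2 3" "p 2 3 < b 2" "a 3 < p 3 1" "p 3 1 < b 3" "a 3 < p 3 2" "p 3 2 < b 3"
    "crossing_params D \<inter> {a 1..b 1} = {p 1 2, p 1 3}"
    "crossing_params D \<inter> {a 2..b 2} = {p 2 1, p 2 3}"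
    "crossing_params D \<inter> {a 3..b 3} = {p 3 1, p 3 2}"
    "crossing_params D \<inter> {a 1..b 1} = {p 1 3, p 1 2}"
    "crossing_params D \<inter> {a 2..b 2} = {p 2 3, p 2 1}"
    "crossing_params D \<inter> {a 3..b 3} = {p 3 2, p 3 1}"
    "p 1 2 \<noteq> p 1 3" "p 2 1 \<noteq> p 2 3" "p 3 1 \<noteq> p 3 2"
  using tri by (auto simp: triangle_def)

lemma triangle_strand_ends:
  assumes "k \<in> {1..3::nat}"
  shows "a k \<notin> crossing_params D" "b k \<notin> crossing_params D"
proof -
  note t = triangle_strands
  have ends: "a 1 \<in> {a 1..b 1}" "b 1 \<in> {a 1..b 1}" "a 2 \<in> {a 2..b 2}" "b 2 \<in> {a 2..b 2}"
    "a 3 \<in> {a 3..b 3}" "b 3 \<in> {a 3..b 3}" using t(1-12) by auto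
  have "a 1 \<notin> {p 1 2, p 1 3}" "b 1 \<notin> {p 1 2, p 1 3}" "a 2 \<notin> {p 2 1, p 2 3}" "b 2 \<notin> {p 2 1, p 2 3}"
    "a 3 \<notin> {p 3 1, p 3 2}" "b 3 \<notin> {p 3 1, p 3 2}" using t(1-12) by auto
  then have "a 1 \<notin> crossing_params D" "b 1 \<notin> crossing_params D" "a 2 \<notin> crossing_params D"
    "b 2 \<notin> crossing_params D" "a 3 \<notin> crossing_params D" "b 3 \<notin> crossing_params D"
    using t(13-15) ends by blast+
  moreover have "k = 1 \<or> k = 2 \<or> k = 3" using assms by auto
  ultimately show "a k \<notin> crossing_params D" "b k \<notin> crossing_params D" by blast+
qed

lemma triangle_sum:
  shows "crossing_sum D f {a 1..b 1} = f (p 1 2) + f (p 1 3)"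
    "crossing_sum D f {a 2..b 2} = f (p 2 1) + f (p 2 3)"
    "crossing_sum D f {a 3..b 3} = f (p 3 1) + f (p 3 2)"
  using tri by (auto simp: triangle_def)

lemma triangle_weights:
  shows "weight D \<pi> (p 1 2) = (if d1 = d2 then \<pi> (curve D (p 1 2)) else - \<pi> (curve D (p 1 2)))"
    "weight D \<pi> (p 1 3) = (if d1 then \<pi> (curve D (p 1 3)) else - \<pi> (curve D (p 1 3)))"
    "weight D \<pi> (p 2 3) = (if d2 then \<pi> (curve D (p 2 3)) else - \<pi> (curve D (p 2 3)))"
    "weight D \<pi> (p 2 1) = - weight D \<pi> (p 1 2)"
    "weight D \<pi> (p 3 1) = - weight D \<pi> (p 1 3)"
    "weight D \<pi> (p 3 2) = - weight D \<pi> (p 2 3)"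
  using weight_other_param[OF D triangle_basic(1), of \<pi>] weight_other_param[OF D triangle_basic(2), of \<pi>]
    weight_other_param[OF D triangle_basic(4), of \<pi>]
  by (simp_all add: weight_def[of D \<pi> "p 1 2"] weight_def[of D \<pi> "p 1 3"] weight_def[of D \<pi> "p 2 3"] triangle_basic)

text \<open>
  Reversing the order of the crossings on all three strands keeps the signs, so that they are the
  same before and after the move.
\<close>

lemma triangle_corner_sign:
  "corner_sign p 1 2 = (if d1 = d2 then -1 else 1)"
  "corner_sign p 1 3 = (if d1 then 1 else -1)"
  "corner_sign p 2 3 = (if d2 then -1 else 1)"
proof -
  have third: "6 - 1 - 2 = (3::nat)" "6 - 1 - 3 = (2::nat)" "6 - 2 - 3 = (1::nat)" by simp_all
  show "corner_sign p 1 2 = (if d1 = d2 then -1 else 1)"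
    "corner_sign p 1 3 = (if d1 then 1 else -1)"
    "corner_sign p 2 3 = (if d2 then -1 else 1)"
    unfolding corner_sign_def third triangle_basic by auto
qed

lemma triangle_SW_NE:
  shows "SW_NE D (curve D (p 1 2)) = (if d1 = d2 then p 1 2 else p 2 1)"
    "SE_NW D (curve D (p 1 2)) = (if d1 = d2 then p 2 1 else p 1 2)"
    "SW_NE D (curve D (p 1 3)) = (if d1 then p 1 3 else p 3 1)"
    "SE_NW D (curve D (p 1 3)) = (if d1 then p 3 1 else p 1 3)"
    "SW_NE D (curve D (p 2 3)) = (if d2 then p 2 3 else p 3 2)"
    "SE_NW D (curve D (p 2 3)) = (if d2 then p 3 2 else p 2 3)"
  by (simp_all add: SW_NE_eq[OF D] SE_NW_eq[OF D] triangle_basic)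

context
  fixes c :: "real set \<Rightarrow> 'a::ab_group_add"
  assumes cyc: "is_cycle D c"
begin

lemma triangle_jumps:
  "jump D c (p 2 1) = - jump D c (p 1 2)"
  "jump D c (p 3 1) = - jump D c (p 1 3)"
  "jump D c (p 3 2) = - jump D c (p 2 3)"
  using cyc triangle_basic by (metis is_cycle_iff_jump[OF D])+

lemma triangle_arcs_12:
  "c (arc_before D (p 1 2)) = c (arc_at D (a 1)) + (if d1 = h then 0 else jump D c (p 1 3))"
  "c (arc_after D (p 1 2)) = c (arc_at D (a 1)) + (if d1 = h then 0 else jump D c (p 1 3)) + jump D c (p 1 2)"
  "swept D c (p 1 2) = swept D c (a 1) + (if d1 = h then 0 else meet D c (p 1 3))"
  by (simp_all add: triangle_basic(19-24) triangle_jumps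
    strand_with_two_crossings[OF D triangle_strands(13) triangle_strands(19) triangle_strands(1,3,2,4)])

lemma triangle_arcs_13:
  "c (arc_before D (p 1 3)) = c (arc_at D (a 1)) + (if d1 = h then jump D c (p 1 2) else 0)"
  "c (arc_after D (p 1 3)) = c (arc_at D (a 1)) + (if d1 = h then jump D c (p 1 2) else 0) + jump D c (p 1 3)"
  "swept D c (p 1 3) = swept D c (a 1) + (if d1 = h then meet D c (p 1 2) else 0)"
  by (simp_all add: triangle_basic(19-24) triangle_jumps
    strand_with_two_crossings[OF D triangle_strands(16) triangle_strands(19)[symmetric] triangle_strands(3,1,4,2)])

lemma triangle_arcs_21:
  "c (arc_before D (p 2 1)) = c (arc_at D (a 2)) + (if d2 = h then 0 else jump D c (p 2 3))"
  "c (arc_after D (p 2 1)) = c (arc_at D (a 2)) + (if d2 = h then 0 else jump D c (p 2 3)) - jump D c (p 1 2)"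
  "swept D c (p 2 1) = swept D c (a 2) + (if d2 = h then 0 else meet D c (p 2 3))"
  by (simp_all add: triangle_basic(19-24) triangle_jumps
    strand_with_two_crossings[OF D triangle_strands(14) triangle_strands(20) triangle_strands(5,7,6,8)])

lemma triangle_arcs_23:
  "c (arc_before D (p 2 3)) = c (arc_at D (a 2)) + (if d2 = h then - jump D c (p 1 2) else 0)"
  "c (arc_after D (p 2 3)) = c (arc_at D (a 2)) + (if d2 = h then - jump D c (p 1 2) else 0) + jump D c (p 2 3)"
  "swept D c (p 2 3) = swept D c (a 2) + (if d2 = h then meet D c (p 2 1) else 0)"
  by (simp_all add: triangle_basic(19-24) triangle_jumps
    strand_with_two_crossings[OF D triangle_strands(17) triangle_strands(20)[symmetric] triangle_strands(7,5,8,6)])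

lemma triangle_arcs_31:
  "c (arc_before D (p 3 1)) = c (arc_at D (a 3)) + (if h then 0 else - jump D c (p 2 3))"
  "c (arc_after D (p 3 1)) = c (arc_at D (a 3)) + (if h then 0 else - jump D c (p 2 3)) - jump D c (p 1 3)"
  "swept D c (p 3 1) = swept D c (a 3) + (if h then 0 else meet D c (p 3 2))"
  by (simp_all add: triangle_basic(19-24) triangle_jumps
    strand_with_two_crossings[OF D triangle_strands(15) triangle_strands(21) triangle_strands(9,11,10,12)])

lemma triangle_arcs_32:
  "c (arc_before D (p 3 2)) = c (arc_at D (a 3)) + (if h then - jump D c (p 1 3) else 0)"
  "c (arc_after D (p 3 2)) = c (arc_at D (a 3)) + (if h then - jump D c (p 1 3) else 0) - jump D c (p 2 3)"
  "swept D c (p 3 2) = swept D c (a 3) + (if h then meet D c (p 3 1) else 0)"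
  by (simp_all add: triangle_basic(19-24) triangle_jumps
    strand_with_two_crossings[OF D triangle_strands(18) triangle_strands(21)[symmetric] triangle_strands(11,9,12,10)])

lemmas triangle_arcs = triangle_arcs_12 triangle_arcs_13 triangle_arcs_21 triangle_arcs_23 triangle_arcs_31 triangle_arcs_32

lemma triangle_meets:
  "meet D c (p 1 2) = (if d1 = d2 then c (arc_after D (p 2 1)) else - c (arc_before D (p 2 1)))"
  "meet D c (p 2 1) = (if d1 = d2 then - c (arc_before D (p 1 2)) else c (arc_after D (p 1 2)))"
  "meet D c (p 1 3) = (if d1 then c (arc_after D (p 3 1)) else - c (arc_before D (p 3 1)))"
  "meet D c (p 3 1) = (if d1 then - c (arc_before D (p 1 3)) else c (arc_after D (p 1 3)))"
  "meet D c (p 2 3) = (if d2 then c (arc_after D (p 3 2)) else - c (arc_before D (p 3 2)))"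
  "meet D c (p 3 2) = (if d2 then - c (arc_before D (p 2 3)) else c (arc_after D (p 2 3)))"
  by (simp_all add: meet_def triangle_basic)

text \<open>
  Each parity is expressed by the values on the incoming arcs of the strands, the values of \<open>swept\<close> there and
  the jumps; in each of the eight cases everything cancels.
\<close>

lemma triangle_parity_sum:
  "(\<Sum>(i, j)\<in>triangle_corners. int_scale (corner_sign p i j) (cycle_parity D c (curve D (p i j)))) = 0"
  unfolding triangle_corners_def
  by (cases d1; cases d2; cases h)
    (simp_all add: triangle_corner_sign cycle_parity_def arc_SW_def
      triangle_SW_NE triangle_arcs
      triangle_meets algebra_simps)

end

end

context
  fixes D D' :: diagram and a b p q and d1 d2 h :: bool
  assumes D: "long_diagram D" and tri: "triangle D a b p d1 d2 h"
    and D': "long_diagram D'" and tri': "triangle D' a b q d1 d2 (\<not> h)"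
begin

text \<open>
  Along each strand the changes by \<open>\<epsilon> l\<close> of the two weights are opposite.
\<close>

lemma triangle_pair_weights:
  fixes \<pi> \<pi>' :: "complex \<Rightarrow> 'a::ab_group_add"
  assumes "\<forall>(i, j)\<in>triangle_corners.
     \<pi>' (curve D' (q i j)) = \<pi> (curve D (p i j)) + int_scale (corner_sign p i j) l"
    and k: "k \<in> {1..3::nat}"
  shows "crossing_sum D' (weight D' \<pi>') {a k..b k} =
     crossing_sum D (weight D \<pi>) {a k..b k}"
proof -
  have "\<pi>' (curve D' (q 1 2)) = \<pi> (curve D (p 1 2)) + int_scale (corner_sign p 1 2) l"
    "\<pi>' (curve D' (q 1 3)) = \<pi> (curve D (p 1 3)) + int_scale (corner_sign p 1 3) l"
    "\<pi>' (curve D' (q 2 3)) = \<pi> (curve D (p 2 3)) + int_scale (corner_sign p 2 3) l"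
    using assms(1) by (auto simp: triangle_corners_def)
  note e = this[unfolded triangle_corner_sign[OF D tri]]
  have "k = 1 \<or> k = 2 \<or> k = 3" using k by auto
  then show ?thesis
    by (elim disjE; simp only: triangle_sum[OF D tri] triangle_sum[OF D' tri']
       triangle_weights[OF D tri] triangle_weights[OF D' tri'] e; cases d1; cases d2; simp)
qed

context
  fixes c c' :: "real set \<Rightarrow> 'a::ab_group_add"
  assumes cyc: "is_cycle D c" and cyc': "is_cycle D' c'"
    and total: "\<And>k. k \<in> {1..3::nat} \<Longrightarrow> crossing_sum D' (jump D' c') {a k..b k} =
     crossing_sum D (jump D c) {a k..b k}"
    and ends: "\<And>k. k \<in> {1..3::nat} \<Longrightarrow> c' (arc_at D' (a k)) = c (arc_at D (a k))"
begin

text \<open>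
  The sums of the jumps along strands \<open>1\<close> and \<open>2\<close> are preserved, so that the change of one jump
  determines the other two.
\<close>

lemma triangle_pair_jumps:
  "jump D' c' (q 1 3) = jump D c (p 1 3) - (jump D' c' (q 1 2) - jump D c (p 1 2))"
  "jump D' c' (q 2 3) = jump D c (p 2 3) + (jump D' c' (q 1 2) - jump D c (p 1 2))"
  using total[of 1] total[of 2]
  by (simp_all add: triangle_sum[OF D tri] triangle_sum[OF D' tri']
     triangle_jumps[OF D tri cyc] triangle_jumps[OF D' tri' cyc'] algebra_simps)

text \<open>
  The preserved sums force the changes of the jumps at the corners \<open>(1, 2)\<close>, \<open>(1, 3)\<close>, \<open>(2, 3)\<close> to be
  in the ratio \<open>1 : - 1 : 1\<close>, and the corner signs, with the signs of the crossings taken into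
  account, are in the ratio \<open>- 1 : 1 : - 1\<close>.
\<close>

lemma triangle_pair_jump_at_crossing:
  "\<exists>l. \<forall>(i, j)\<in>triangle_corners. jump_at_crossing D' c' (curve D' (q i j)) =
     jump_at_crossing D c (curve D (p i j)) + int_scale (corner_sign p i j) l"
proof -
  \<comment> \<open>The corner sign at (1, 2) is the negative of the sign of strand 1 there.\<close>
  let ?l = "jump D c (p 1 2) - jump D' c' (q 1 2)"
  have "jump_at_crossing D' c' (curve D' (q 1 2)) =
      jump_at_crossing D c (curve D (p 1 2)) + int_scale (corner_sign p 1 2) ?l"
    "jump_at_crossing D' c' (curve D' (q 1 3)) =
      jump_at_crossing D c (curve D (p 1 3)) + int_scale (corner_sign p 1 3) ?l"
    "jump_at_crossing D' c' (curve D' (q 2 3)) =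
      jump_at_crossing D c (curve D (p 2 3)) + int_scale (corner_sign p 2 3) ?l"
    unfolding jump_at_crossing_eq triangle_SW_NE[OF D tri] triangle_SW_NE[OF D' tri'] triangle_corner_sign[OF D tri]
    by (cases d1; cases d2;
       simp add: triangle_jumps[OF D tri cyc] triangle_jumps[OF D' tri' cyc']
         triangle_pair_jumps)+
  then show ?thesis unfolding triangle_corners_def by (intro exI[of _ ?l]) auto
qed

text \<open>
  The move exchanges the inner arc of a strand with one of its ends. So each of the two
  contributions along a strand changes by a jump, and the two jumps belong to
  the opposite corner of the triangle, hence are opposite.
\<close>

lemma triangle_pair_meets:
  assumes k: "k \<in> {1..3::nat}"
  shows "crossing_sum D' (meet D' c') {a k..b k} = crossing_sum D (meet D c) {a k..b k}"
proof -
  have "k = 1 \<or> k = 2 \<or> k = 3" using k by auto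
  then show ?thesis
    by (elim disjE; simp only: triangle_sum[OF D tri] triangle_sum[OF D' tri']
       triangle_meets[OF D tri cyc] triangle_meets[OF D' tri' cyc']
       triangle_arcs[OF D tri cyc] triangle_arcs[OF D' tri' cyc'] triangle_pair_jumps;
       cases d1; cases d2; cases h; simp add: ends algebra_simps)
qed

lemma triangle_pair_parity:
  assumes swept: "\<And>k. k \<in> {1..3::nat} \<Longrightarrow> swept D' c' (a k) = swept D c (a k)"
    and ij: "(i, j) \<in> triangle_corners"
  shows "cycle_parity D' c' (curve D' (q i j)) = cycle_parity D c (curve D (p i j))"
proof -
  have "i = 1 \<and> j = 2 \<or> i = 1 \<and> j = 3 \<or> i = 2 \<and> j = 3" using ij by (auto simp: triangle_corners_def)
  then show ?thesis
    by (elim disjE conjE; simp only: cycle_parity_def arc_SW_def triangle_SW_NE[OF D tri] triangle_SW_NE[OF D' tri'];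
       cases d1; cases d2; cases h; simp only: if_True if_False simp_thms
       triangle_meets[OF D tri cyc] triangle_meets[OF D' tri' cyc']
       triangle_arcs[OF D tri cyc] triangle_arcs[OF D' tri' cyc'] triangle_pair_jumps;
       simp add: ends swept algebra_simps)
qed

end

end

section \<open>The moves in the chart\<close>

lemma local_change_sym:
  assumes "local_change \<phi> n a b D D'"
  shows "local_change \<phi> n a b D' D"
proof -
  have reg: "{t. curve D t \<in> region \<phi>} = {t. curve D' t \<in> region \<phi>}"
    using assms unfolding local_change_def by simp
  then have r: "curve D t \<in> region \<phi> \<longleftrightarrow> curve D' t \<in> region \<phi>" for t by blast
  show ?thesis using assms unfolding local_change_def insert_commute[of D' D]
    by (simp add: r)
qed

lemma local_change_disc:
  assumes "local_change \<phi> n a b D D'"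
  shows "cmod (\<phi> (curve D t)) \<le> 1 \<longleftrightarrow> t \<in> strands n a b" "cmod (\<phi> (curve D' t)) \<le> 1 \<longleftrightarrow> t \<in> strands n a b"
    "curve D t \<in> region \<phi> \<longleftrightarrow> t \<in> open_strands n a b" "curve D' t \<in> region \<phi> \<longleftrightarrow> t \<in> open_strands n a b"
proof -
  have "{t. cmod (\<phi> (curve E t)) \<le> 1} = strands n a b \<and> {t. curve E t \<in> region \<phi>} = open_strands n a b"
    if "E \<in> {D, D'}" for E
    using assms that unfolding local_change_def strands_def open_strands_def by blast
  then show "cmod (\<phi> (curve D t)) \<le> 1 \<longleftrightarrow> t \<in> strands n a b" "cmod (\<phi> (curve D' t)) \<le> 1 \<longleftrightarrow> t \<in> strands n a b"
    "curve D t \<in> region \<phi> \<longleftrightarrow> t \<in> open_strands n a b" "curve D' t \<in> region \<phi> \<longleftrightarrow> t \<in> open_strands n a b"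
    by blast+
qed

lemma local_change_basic:
  assumes "local_change \<phi> n a b D D'"
  shows "long_diagram D" "long_diagram D'" "plane_chart \<phi>" "\<And>k. k \<in> {1..n} \<Longrightarrow> a k < b k"
    "disjoint_family_on (\<lambda>k. {a k..b k}) {1..n}"
    "\<And>t. t \<notin> open_strands n a b \<Longrightarrow> curve D' t = curve D t"
    "\<And>t. t \<notin> open_strands n a b \<Longrightarrow> t \<in> overpasses D' \<longleftrightarrow> t \<in> overpasses D"
  using assms local_change_disc(3)[OF assms] unfolding local_change_def by blast+

lemma local_change_crossing_params:
  assumes l: "local_change \<phi> n a b D D'" and t: "t \<notin> strands n a b" "t \<in> crossing_params D"
  shows "t \<in> crossing_params D'"
proof -
  note lc = local_change_basic[OF l] and ld = local_change_disc[OF l]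
  from t(2) obtain u where u: "u \<in> overpasses D" "curve D t = curve D u"
    by (auto simp: crossing_params_def crossings_def)
  have "u \<notin> strands n a b" using ld(1)[of u] ld(1)[of t] t u by simp
  then have "t \<notin> open_strands n a b" "u \<notin> open_strands n a b" using t open_strands_subset by blast+
  then have "u \<in> overpasses D'" "curve D' t = curve D' u" using u lc(6,7) by auto
  then show ?thesis by (auto simp: crossing_params_def crossings_def)
qed

text \<open>
  The complement of the strands is open, and the two curves agree on it; so they also
  have the same velocities there.
\<close>

lemma local_change_agree_outside:
  assumes l: "local_change \<phi> n a b D D'"
    and ends: "\<And>k E. k \<in> {1..n} \<Longrightarrow> E \<in> {D, D'} \<Longrightarrow> a k \<notin> crossing_params E \<and> b k \<notin> crossing_params E"
  shows "agree_outside n a b D D'"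
proof -
  let ?S = "strands n a b"
  note lc = local_change_basic[OF l] and ld = local_change_disc[OF l]
  note D = lc(1) and D' = lc(2)
  have eq: "curve D' t = curve D t" if "t \<notin> ?S" for t using that lc(6) open_strands_subset by blast
  have T: "crossing_params D - ?S = crossing_params D' - ?S"
    using local_change_crossing_params[OF l] local_change_crossing_params[OF local_change_sym[OF l]] by blast
  have op: "open (- ?S)" unfolding strands_def by (auto intro!: open_Compl closed_UN)
  have vel: "velocity D' t = velocity D t" if "t \<notin> ?S" for t
    by (rule velocity_transform[OF D D' op]) (use that eq in auto)
  have "other_param D u \<notin> ?S \<and> other_param D' u = other_param D u \<and>
     (ascends_right D' u \<longleftrightarrow> ascends_right D u) \<and> curve D' u = curve D u"
    if "u \<in> crossing_params D - ?S" for u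
  proof -
    have u: "u \<in> crossing_params D" "u \<notin> ?S" using that by auto
    let ?w = "other_param D u"
    have w: "?w \<notin> ?S" using ld(1)[of u] ld(1)[of ?w] u(2) curve_other_param[OF D u(1)] by simp
    have "other_param D' u = ?w"
      using other_param_neq[OF D u(1)] curve_other_param[OF D u(1)] eq[OF w] eq[OF u(2)]
      by (intro other_param_unique[OF D']) auto
    then show ?thesis using w eq[OF u(2)] vel[OF u(2)] vel[OF w] by (simp add: ascends_right_def)
  qed
  then show ?thesis using D D' lc(4,5) T ends unfolding agree_outside_def by blast
qed

lemma crossing_params_pair:
  assumes "r \<in> crossing_params E" "s \<in> crossing_params E" "r \<in> I" "s \<in> I"
    and "\<And>u. u \<in> crossing_params E \<Longrightarrow> u \<in> I \<Longrightarrow> u = r \<or> u = s"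
  shows "crossing_params E \<inter> I = {r, s}"
  using assms by auto

lemma other_param_on_other_strand:
  assumes E: "long_diagram E"
    and disc: "\<And>t. cmod (\<phi> (curve E t)) \<le> 1 \<longleftrightarrow> t \<in> strands n a b"
    and k: "k \<in> {1..n}" and inj: "inj_on (curve E) {a k..b k}"
    and u: "u \<in> crossing_params E" "u \<in> {a k..b k}"
  shows "other_param E u \<in> strands n a b - {a k..b k}"
proof -
  note w = other_param_neq[OF E u(1)] curve_other_param[OF E u(1)]
  have "u \<in> strands n a b" using u(2) k unfolding strands_def by blast
  then have "other_param E u \<in> strands n a b" using disc[of u] disc[of "other_param E u"] w(2) by simp
  moreover have "other_param E u \<notin> {a k..b k}" using inj_onD[OF inj w(2) _ u(2)] w(1) by blast
  ultimately show ?thesis by simp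
qed

text \<open>
  All crossings on the strand have both parameters on it.
\<close>

lemma R1_decreasing_kink:
  assumes "R1_decreasing \<phi> v D D'"
  obtains a b s t where "agree_outside 1 a b D D'"
    "\<And>x. curve D x \<in> region \<phi> \<longleftrightarrow> x \<in> open_strands 1 a b"
    "kink D (a 1) (b 1) s t" "curve D s = v" "crossing_params D' \<inter> {a 1..b 1} = {}"
proof -
  from assms obtain a b s t where l: "local_change \<phi> 1 a b D D'"
    and st: "a 1 < s" "s < t" "t < b 1" "curve D s = v" "curve D t = v" "v \<in> crossings D"
    and only: "\<And>x y. x \<in> {a 1..b 1} \<Longrightarrow> y \<in> {a 1..b 1} \<Longrightarrow> curve D x = curve D y \<Longrightarrow> x = y \<or> {x, y} = {s, t}"
    and inj: "inj_on (curve D') {a 1..b 1}"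
    unfolding R1_decreasing_def by blast
  note lc = local_change_basic[OF l] and ld = local_change_disc[OF l]
  have S: "strands 1 a b = {a 1..b 1}" by (simp add: strands_def)
  have T: "crossing_params D \<inter> {a 1..b 1} = {s, t}"
  proof
    show "{s, t} \<subseteq> crossing_params D \<inter> {a 1..b 1}" using st by (auto simp: crossing_params_def)
    show "crossing_params D \<inter> {a 1..b 1} \<subseteq> {s, t}"
    proof
      fix u assume "u \<in> crossing_params D \<inter> {a 1..b 1}"
      then have u: "u \<in> crossing_params D" "u \<in> {a 1..b 1}" by auto
      note w = other_param_neq[OF lc(1) u(1)] curve_other_param[OF lc(1) u(1)]
      have "other_param D u \<in> {a 1..b 1}"
        using ld(1)[of u] ld(1)[of "other_param D u"] u(2) w(2) by (simp only: S)
      then have "{other_param D u, u} = {s, t}" using only[OF _ u(2) w(2)] w(1) by blast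
      then show "u \<in> {s, t}" by blast
    qed
  qed
  have T': "crossing_params D' \<inter> {a 1..b 1} = {}"
  proof (rule ccontr)
    assume "crossing_params D' \<inter> {a 1..b 1} \<noteq> {}"
    then obtain u where u: "u \<in> crossing_params D'" "u \<in> {a 1..b 1}" by blast
    then show False using other_param_on_other_strand[OF lc(2) ld(2) _ inj u] S by simp
  qed
  have ab: "a 1 \<in> {a 1..b 1}" "b 1 \<in> {a 1..b 1}" using st by auto
  have "a 1 \<notin> {s, t}" "b 1 \<notin> {s, t}" using st by auto
  then have e: "a 1 \<notin> crossing_params D" "b 1 \<notin> crossing_params D"
    "a 1 \<notin> crossing_params D'" "b 1 \<notin> crossing_params D'"
    using T T' ab by blast+
  have "agree_outside 1 a b D D'"
    by (rule local_change_agree_outside[OF l]) (use e in auto)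
  then show ?thesis using that[of a b s t] ld(3) T T' st by (auto simp: kink_def)
qed

text \<open>
  The velocity in the chart may replace the velocity in all sign conditions, because the chart
  preserves the orientation.
\<close>

lemma plane_chart_velocity:
  assumes D: "long_diagram D" and \<phi>: "plane_chart \<phi>"
  obtains W where "\<And>t. ((\<lambda>t. Re (\<phi> (curve D t))) has_real_derivative Re (W t)) (at t)"
    "\<And>t. ((\<lambda>t. Im (\<phi> (curve D t))) has_real_derivative Im (W t)) (at t)"
    "\<And>t. W t \<noteq> 0"
    "\<And>s t. curve D s = curve D t \<Longrightarrow>
       orient (W s) (W t) > 0 \<longleftrightarrow> orient (velocity D s) (velocity D t) > 0"
    "\<And>s t. curve D s = curve D t \<Longrightarrow> s \<noteq> t \<Longrightarrow> orient (W s) (W t) \<noteq> 0"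
proof -
  from \<phi> obtain L where L: "\<And>z. (\<phi> has_derivative L z) (at z)" "\<And>z. orient (L z 1) (L z \<i>) > 0"
    unfolding plane_chart_def by blast
  define W where "W t = L (curve D t) (velocity D t)" for t
  have lin: "linear (L z)" for z using L(1) has_derivative_linear by blast
  have W: "((\<lambda>t. \<phi> (curve D t)) has_vector_derivative W t) (at t)" for t
  proof -
    have "((\<phi> \<circ> curve D) has_derivative L (curve D t) \<circ> (\<lambda>x. x *\<^sub>R velocity D t)) (at t)"
      using velocity_works[OF D, of t] L(1)[of "curve D t"]
      by (intro diff_chain_at) (simp_all add: has_vector_derivative_def)
    then show ?thesis by (simp add: has_vector_derivative_def o_def linear_scale[OF lin] W_def)
  qed
  have or: "orient (W s) (W t) = orient (L (curve D t) 1) (L (curve D t) \<i>) * orient (velocity D s) (velocity D t)"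
    if "curve D s = curve D t" for s t
    unfolding W_def that by (rule orient_linear[OF lin])
  show ?thesis
  proof
    show "((\<lambda>t. Re (\<phi> (curve D t))) has_real_derivative Re (W t)) (at t)" for t
      using bounded_linear.has_vector_derivative[OF bounded_linear_Re W] by (simp add: has_real_derivative_iff_has_vector_derivative)
    show "((\<lambda>t. Im (\<phi> (curve D t))) has_real_derivative Im (W t)) (at t)" for t
      using bounded_linear.has_vector_derivative[OF bounded_linear_Im W] by (simp add: has_real_derivative_iff_has_vector_derivative)
    show "orient (W s) (W t) > 0 \<longleftrightarrow> orient (velocity D s) (velocity D t) > 0"
      if "curve D s = curve D t" for s t
      unfolding or[OF that] by (rule zero_less_mult_pos_iff[OF L(2)])
    show "orient (W s) (W t) \<noteq> 0" if "curve D s = curve D t" "s \<noteq> t" for s t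
      unfolding or[OF that(1)] using long_diagram_transverse[OF D that(2,1)] L(2)[of "curve D t"] by simp
    show "W t \<noteq> 0" for t
    proof
      assume "W t = 0"
      then have "orient (L (curve D t) 1) (L (curve D t) \<i>) * orient (velocity D t) (\<i> * velocity D t) = 0"
        using orient_linear[OF lin, of "curve D t" "velocity D t" "\<i> * velocity D t"]
        by (simp add: W_def orient_def)
      then have "orient (velocity D t) (\<i> * velocity D t) = 0" using L(2)[of "curve D t"] by simp
      then have "velocity D t = 0"
        by (simp add: orient_def complex_eq_iff)
      then show False using D by (auto simp: long_diagram_def)
    qed
  qed
qed

lemma derivative_pos_of_right:
  fixes g :: "real \<Rightarrow> real"
  assumes "(g has_real_derivative y) (at x)" "y \<noteq> 0" "x < c" "\<And>t. x < t \<Longrightarrow> t < c \<Longrightarrow> g x < g t"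
  shows "y > 0"
proof (rule ccontr)
  assume "\<not> y > 0"
  then have "y < 0" using assms(2) by simp
  then obtain d where d: "d > 0" "\<And>h. h > 0 \<Longrightarrow> h < d \<Longrightarrow> g (x + h) < g x"
    using DERIV_neg_dec_right[OF assms(1)] by blast
  define h where "h = min d (c - x) / 2"
  have "h > 0" "h < d" "x < x + h" "x + h < c" using d(1) assms(3) by (auto simp: h_def min_def field_simps)
  then show False using d(2)[of h] assms(4)[of "x + h"] by simp
qed

lemma derivative_neg_of_right:
  fixes g :: "real \<Rightarrow> real"
  assumes "(g has_real_derivative y) (at x)" "y \<noteq> 0" "x < c" "\<And>t. x < t \<Longrightarrow> t < c \<Longrightarrow> g t < g x"
  shows "y < 0"
  using derivative_pos_of_right[OF DERIV_minus[OF assms(1)] _ assms(3)] assms(2,4) by simp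

text \<open>
  By Rolle's theorem the coordinate is injective on the strand, hence strictly monotone.
\<close>

lemma straight_strand:
  fixes g :: "real \<Rightarrow> real"
  assumes ab: "a < b" and g: "\<And>t. (g has_real_derivative g' t) (at t)"
    and nz: "\<And>t. a < t \<Longrightarrow> t < b \<Longrightarrow> g' t \<noteq> 0"
  shows "a < t \<Longrightarrow> t < b \<Longrightarrow> g' t > 0 \<longleftrightarrow> g a < g b"
    and "x \<in> {a..b} \<Longrightarrow> y \<in> {a..b} \<Longrightarrow> x \<noteq> y \<Longrightarrow> x < y \<longleftrightarrow> (g x < g y \<longleftrightarrow> g a < g b)"
    and "x \<in> {a..b} \<Longrightarrow> y \<in> {a..b} \<Longrightarrow> x \<noteq> y \<Longrightarrow> g x \<noteq> g y"
proof -
  have cont: "continuous_on X g" for X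
    using g DERIV_isCont continuous_at_imp_continuous_on by blast
  have inj': "g x \<noteq> g y" if xy: "a \<le> x" "x < y" "y \<le> b" for x y
  proof
    assume "g x = g y"
    then obtain z where z: "x < z" "z < y" "(g has_real_derivative 0) (at z)"
      using Rolle[OF xy(2) _ cont] g real_differentiable_def by metis
    then have "g' z = 0" using DERIV_unique[OF g[of z]] by blast
    then show False using nz z xy by auto
  qed
  then have inj: "inj_on g {a..b}" by (auto intro!: linorder_inj_onI)
  then consider "strict_mono_on {a..b} g" | "strict_antimono_on {a..b} g"
    using injective_eq_monotone_map[of "{a..b}" g] cont by (auto simp: is_interval_cc)
  then have "(\<forall>t. a < t \<longrightarrow> t < b \<longrightarrow> (g' t > 0 \<longleftrightarrow> g a < g b)) \<and>
    (\<forall>x\<in>{a..b}. \<forall>y\<in>{a..b}. x \<noteq> y \<longrightarrow> (x < y \<longleftrightarrow> (g x < g y \<longleftrightarrow> g a < g b)))"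
  proof cases
    case 1
    then have m: "g x < g y" if "a \<le> x" "x < y" "y \<le> b" for x y
      using that by (auto simp: monotone_on_def)
    have "g' t > 0" if "a < t" "t < b" for t
      using derivative_pos_of_right[OF g[of t] nz[OF that] that(2)] m that by simp
    moreover have "g x < g y \<longleftrightarrow> x < y" if "x \<in> {a..b}" "y \<in> {a..b}" "x \<noteq> y" for x y
      using m[of x y] m[of y x] that by fastforce
    ultimately show ?thesis using m[of a b] ab by auto
  next
    case 2
    then have m: "g y < g x" if "a \<le> x" "x < y" "y \<le> b" for x y
      using that by (auto simp: monotone_on_def)
    have "g' t < 0" if "a < t" "t < b" for t
      using derivative_neg_of_right[OF g[of t] nz[OF that] that(2)] m that by simp
    moreover have "g x < g y \<longleftrightarrow> \<not> x < y" if "x \<in> {a..b}" "y \<in> {a..b}" "x \<noteq> y" for x y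
      using m[of x y] m[of y x] that by fastforce
    ultimately show ?thesis using m[of a b] ab by fastforce
  qed
  then show "a < t \<Longrightarrow> t < b \<Longrightarrow> g' t > 0 \<longleftrightarrow> g a < g b"
    "x \<in> {a..b} \<Longrightarrow> y \<in> {a..b} \<Longrightarrow> x \<noteq> y \<Longrightarrow> x < y \<longleftrightarrow> (g x < g y \<longleftrightarrow> g a < g b)" by blast+
  show "x \<in> {a..b} \<Longrightarrow> y \<in> {a..b} \<Longrightarrow> x \<noteq> y \<Longrightarrow> g x \<noteq> g y" using inj by (auto dest: inj_onD)
qed

lemma derivative_zero_on_strand:
  fixes g :: "real \<Rightarrow> real"
  assumes "(g has_real_derivative y) (at t)" "a < t" "t < b" "\<And>x. x \<in> {a..b} \<Longrightarrow> g x = 0"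
  shows "y = 0"
proof -
  have "(g has_real_derivative 0) (at t)"
    by (rule has_field_derivative_transform_within_open[OF DERIV_const[of 0], of "{a<..<b}"])
       (use assms in auto)
  then show ?thesis using DERIV_unique[OF assms(1)] by blast
qed

text \<open>
  The second strand crosses the real axis downwards and then upwards, while the first one keeps its
  direction. The vertical velocities at the crossings cannot vanish by transversality.
\<close>

lemma R2_decreasing_bigon:
  assumes "R2_decreasing \<phi> v1 v2 D D'"
  obtains a b s1 s2 t1 t2 where "agree_outside 2 a b D D'"
    "\<And>x. curve D x \<in> region \<phi> \<longleftrightarrow> x \<in> open_strands 2 a b"
    "bigon D a b s1 s2 t1 t2" "curve D s1 = v1" "curve D s2 = v2"
    "\<And>k. k \<in> {1..2} \<Longrightarrow> crossing_params D' \<inter> {a k..b k} = {}"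
proof -
  from assms obtain a b s1 s2 t1 t2 where l: "local_change \<phi> 2 a b D D'"
    and inj0: "\<forall>k\<in>{1, 2}. inj_on (curve D) {a k..b k} \<and> inj_on (curve D') {a k..b k}"
    and flat0: "\<forall>t\<in>{a 1..b 1}. Im (\<phi> (curve D t)) = 0 \<and> curve D' t = curve D t"
    and t: "a 2 < t1" "t1 < t2" "t2 < b 2"
    and up: "\<forall>t\<in>{a 2..<t1} \<union> {t2<..b 2}. Im (\<phi> (curve D t)) > 0"
    and down: "\<forall>t\<in>{t1<..<t2}. Im (\<phi> (curve D t)) < 0"
    and up'0: "\<forall>t\<in>{a 2..b 2}. Im (\<phi> (curve D' t)) > 0"
    and s: "s1 \<in> {a 1<..<b 1}" "s2 \<in> {a 1<..<b 1}"
    and v: "curve D s1 = v1" "curve D t1 = v1" "curve D s2 = v2" "curve D t2 = v2"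
    and over: "{s1, s2} \<subseteq> overpasses D \<or> {t1, t2} \<subseteq> overpasses D"
    unfolding R2_decreasing_def by (elim exE conjE) (rule that, assumption+)
  have flat: "Im (\<phi> (curve D t)) = 0 \<and> curve D' t = curve D t" if "t \<in> {a 1..b 1}" for t
    using flat0 that by (rule bspec)
  have inj: "inj_on (curve D) {a k..b k} \<and> inj_on (curve D') {a k..b k}" if "k \<in> {1, 2}" for k
    using inj0 that by (rule bspec)
  have up': "Im (\<phi> (curve D' t)) > 0" if "t \<in> {a 2..b 2}" for t
    using up'0 that by (rule bspec)
  note lc = local_change_basic[OF l] and ld = local_change_disc[OF l]
  note D = lc(1) and D' = lc(2)
  have S: "strands 2 a b = {a 1..b 1} \<union> {a 2..b 2}"
  proof -
    have "{1..2} = {1, 2::nat}" by auto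
    then show ?thesis unfolding strands_def by simp
  qed
  have disj: "{a 1..b 1} \<inter> {a 2..b 2} = {}"
    using disjoint_family_onD[OF lc(5), of 1 2] by simp
  have partner: "other_param E u \<in> {a j..b j}"
    if E: "E \<in> {D, D'}" and u: "u \<in> crossing_params E" "u \<in> {a i..b i}" and ij: "(i, j) \<in> {(1, 2), (2, 1)}" for E u i j
    using other_param_on_other_strand[of E \<phi> 2 a b i u] E D D' inj[of i] ld(1,2) u ij S by auto
  have zero: "u \<in> {t1, t2}" if "u \<in> {a 2..b 2}" "Im (\<phi> (curve D u)) = 0" for u
  proof (rule ccontr)
    assume "u \<notin> {t1, t2}"
    then have "u \<in> {a 2..<t1} \<union> {t2<..b 2} \<or> u \<in> {t1<..<t2}" using that(1) by auto
    then show False using bspec[OF up, of u] bspec[OF down, of u] that(2) by (metis less_irrefl)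
  qed
  have sT: "s1 \<in> crossing_params D" "s2 \<in> crossing_params D" "t1 \<in> crossing_params D" "t2 \<in> crossing_params D"
  proof -
    have "v1 \<in> crossings D \<and> v2 \<in> crossings D"
      using over
    proof
      assume "{s1, s2} \<subseteq> overpasses D"
      then show ?thesis using imageI[of s1 "overpasses D" "curve D"] imageI[of s2 "overpasses D" "curve D"]
        unfolding v crossings_def by blast
    next
      assume "{t1, t2} \<subseteq> overpasses D"
      then show ?thesis using imageI[of t1 "overpasses D" "curve D"] imageI[of t2 "overpasses D" "curve D"]
        unfolding v crossings_def by blast
    qed
    then show "s1 \<in> crossing_params D" "s2 \<in> crossing_params D" "t1 \<in> crossing_params D" "t2 \<in> crossing_params D"
      unfolding crossing_params_def mem_Collect_eq v by blast+
  qed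
  have sI: "s1 \<in> {a 1..b 1}" "s2 \<in> {a 1..b 1}" "t1 \<in> {a 2..b 2}" "t2 \<in> {a 2..b 2}" using s t by auto
  have i1: "inj_on (curve D) {a 1..b 1}" and i2: "inj_on (curve D) {a 2..b 2}" using inj by auto
  have T1: "crossing_params D \<inter> {a 1..b 1} = {s1, s2}"
  proof (rule crossing_params_pair[OF sT(1,2) sI(1,2)])
    fix u assume u: "u \<in> crossing_params D" "u \<in> {a 1..b 1}"
    have w: "other_param D u \<in> {a 2..b 2}" using partner[of D u 1 2] u by simp
    have cw: "curve D (other_param D u) = curve D u" using curve_other_param[OF D u(1)] .
    then have "Im (\<phi> (curve D (other_param D u))) = 0" using flat[OF u(2)] by simp
    then have "other_param D u = t1 \<or> other_param D u = t2" using zero[OF w] by blast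
    then have "curve D u = curve D s1 \<or> curve D u = curve D s2" using cw v by auto
    then show "u = s1 \<or> u = s2" using inj_onD[OF i1 _ u(2)] sI by blast
  qed
  have T2: "crossing_params D \<inter> {a 2..b 2} = {t1, t2}"
  proof (rule crossing_params_pair[OF sT(3,4) sI(3,4)])
    fix u assume u: "u \<in> crossing_params D" "u \<in> {a 2..b 2}"
    have "other_param D u \<in> {a 1..b 1}" using partner[of D u 2 1] u by simp
    then have "Im (\<phi> (curve D u)) = 0" using flat[of "other_param D u"] curve_other_param[OF D u(1)] by simp
    then show "u = t1 \<or> u = t2" using zero[OF u(2)] by blast
  qed
  have none: "False" if "u \<in> crossing_params D'" "u \<in> {a 1..b 1}" for u
    using partner[of D' u 1 2] up'[of "other_param D' u"] flat[OF that(2)] curve_other_param[OF D' that(1)] that by simp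
  have T1': "crossing_params D' \<inter> {a 1..b 1} = {}" using none by blast
  have T2': "crossing_params D' \<inter> {a 2..b 2} = {}"
    using none partner[of D' _ 2 1] other_param_in[OF D'] by blast
  have ab: "a 1 \<in> {a 1..b 1}" "b 1 \<in> {a 1..b 1}" "a 2 \<in> {a 2..b 2}" "b 2 \<in> {a 2..b 2}" using s t by auto
  have "a 1 \<notin> {s1, s2}" "b 1 \<notin> {s1, s2}" "a 2 \<notin> {t1, t2}" "b 2 \<notin> {t1, t2}" using s t by auto
  then have e: "a 1 \<notin> crossing_params D" "b 1 \<notin> crossing_params D" "a 2 \<notin> crossing_params D" "b 2 \<notin> crossing_params D"
    "a 1 \<notin> crossing_params D'" "b 1 \<notin> crossing_params D'" "a 2 \<notin> crossing_params D'" "b 2 \<notin> crossing_params D'"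
    using T1 T2 T1' T2' ab by blast+
  have k12: "k = 1 \<or> k = 2" if "k \<in> {1..2::nat}" for k using that by auto
  have agree: "agree_outside 2 a b D D'"
    by (rule local_change_agree_outside[OF l]) (use e k12 in blast)
  have st: "s1 \<noteq> t1" "s2 \<noteq> t2" using disj sI by blast+
  have s12: "s1 \<noteq> s2" using inj_onD[OF i2 _ sI(3,4)] v t by auto
  have o: "other_param D s1 = t1" "other_param D s2 = t2"
    using st v by (auto intro!: other_param_unique[OF D])
  obtain W where W: "\<And>t. ((\<lambda>t. Re (\<phi> (curve D t))) has_real_derivative Re (W t)) (at t)"
    "\<And>t. ((\<lambda>t. Im (\<phi> (curve D t))) has_real_derivative Im (W t)) (at t)"
    "\<And>t. W t \<noteq> 0"
    "\<And>s t. curve D s = curve D t \<Longrightarrow>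
       orient (W s) (W t) > 0 \<longleftrightarrow> orient (velocity D s) (velocity D t) > 0"
    "\<And>s t. curve D s = curve D t \<Longrightarrow> s \<noteq> t \<Longrightarrow> orient (W s) (W t) \<noteq> 0"
    using plane_chart_velocity[OF D lc(3)] by metis
  have W1: "Im (W u) = 0" if "a 1 < u" "u < b 1" for u
    using derivative_zero_on_strand[OF W(2) that] flat by auto
  have ReW: "Re (W u) \<noteq> 0" if "a 1 < u" "u < b 1" for u using W1[OF that] W(3)[of u] by (simp add: complex_eq_iff)
  have ab1: "a 1 < b 1" using s by auto
  have dir: "Re (W u) > 0 \<longleftrightarrow> Re (\<phi> (curve D (a 1))) < Re (\<phi> (curve D (b 1)))" if "a 1 < u" "u < b 1" for u
    using straight_strand(1)[OF ab1 W(1) ReW that] by simp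
  have or: "orient (W s1) (W t1) = Re (W s1) * Im (W t1)" "orient (W s2) (W t2) = Re (W s2) * Im (W t2)"
    using W1 s by (auto simp: orient_def)
  have nz: "Im (W t1) \<noteq> 0" "Im (W t2) \<noteq> 0" using or W(5)[of s1 t1] W(5)[of s2 t2] v st by auto
  have z: "Im (\<phi> (curve D t1)) = 0" "Im (\<phi> (curve D t2)) = 0"
    using flat[OF sI(1)] flat[OF sI(2)] v by auto
  have "Im (W t1) < 0"
    by (rule derivative_neg_of_right[OF W(2) nz(1) t(2)]) (use down z in auto)
  moreover have "Im (W t2) > 0"
    by (rule derivative_pos_of_right[OF W(2) nz(2) t(3)]) (use up z in auto)
  moreover have "ascends_right D s1 \<longleftrightarrow> Re (W s1) * Im (W t1) > 0" "ascends_right D s2 \<longleftrightarrow> Re (W s2) * Im (W t2) > 0"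
    using W(4)[of s1 t1] W(4)[of s2 t2] v or by (auto simp: ascends_right_def o)
  ultimately have "ascends_right D s2 \<longleftrightarrow> \<not> ascends_right D s1"
    using dir[of s1] dir[of s2] ReW[of s1] ReW[of s2] s by (auto simp: zero_less_mult_iff)
  then have "bigon D a b s1 s2 t1 t2" using s t s12 T1 T2 o by (simp add: bigon_def)
  moreover have "crossing_params D' \<inter> {a k..b k} = {}" if "k \<in> {1..2}" for k
    using k12[OF that] T1' T2' by blast
  ultimately show ?thesis using that[of a b s1 s2 t1 t2] agree ld(3) v by blast
qed

lemma nonneg_of_left:
  fixes g :: "real \<Rightarrow> real"
  assumes "(g has_real_derivative y) (at x)" "c < x" "\<And>t. c < t \<Longrightarrow> t < x \<Longrightarrow> g t > 0"
  shows "g x \<ge> 0"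
proof (rule tendsto_lowerbound)
  have "isCont g x" using assms(1) by (rule DERIV_isCont)
  then show "(g \<longlongrightarrow> g x) (at_left x)"
    unfolding isCont_def by (rule filterlim_mono[OF _ order_refl at_le]) simp
  show "\<forall>\<^sub>F t in at_left x. 0 \<le> g t"
    unfolding eventually_at_left[OF assms(2)] using assms(2,3) by (intro exI[of _ c]) (auto intro: less_imp_le)
qed simp

lemma nonpos_of_left:
  fixes g :: "real \<Rightarrow> real"
  assumes "(g has_real_derivative y) (at x)" "c < x" "\<And>t. c < t \<Longrightarrow> t < x \<Longrightarrow> g t < 0"
  shows "g x \<le> 0"
  using nonneg_of_left[OF DERIV_minus[OF assms(1)] assms(2)] assms(3) by simp

text \<open>
  The hypotheses on strand \<open>3\<close> hold before and after the move: they say at which parameter it meets each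
  axis and leave open on which side of the origin it does so. This side is given by the order of the two
  parameters. Together with the directions of the straight strands it determines the order of the
  crossings on them.
\<close>

lemma triangle_in_chart:
  assumes E: "long_diagram E" and \<phi>: "plane_chart \<phi>"
    and disj: "disjoint_family_on (\<lambda>k. {a k..b k}) {1..3::nat}"
    and disc: "\<And>t. cmod (\<phi> (curve E t)) \<le> 1 \<longleftrightarrow> t \<in> strands 3 a b"
    and inj: "\<forall>k\<in>{1, 2, 3}. inj_on (curve E) {a k..b k}"
    and s1: "\<forall>t\<in>{a 1..b 1}. Im (\<phi> (curve E t)) = 0"
    and s2: "\<forall>t\<in>{a 2..b 2}. Re (\<phi> (curve E t)) = 0"
    and s3: "\<forall>t\<in>{a 3..<p 3 1} - {p 3 2}. Im (\<phi> (curve E t)) < 0"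
      "\<forall>t\<in>{p 3 1<..b 3} - {p 3 2}. Im (\<phi> (curve E t)) > 0"
      "\<forall>t\<in>{a 3..<p 3 2} - {p 3 1}. Re (\<phi> (curve E t)) > 0"
      "\<forall>t\<in>{p 3 2<..b 3} - {p 3 1}. Re (\<phi> (curve E t)) < 0"
    and p: "\<forall>i\<in>{1, 2, 3}. \<forall>j\<in>{1, 2, 3} - {i}. p i j \<in> {a i<..<b i} \<and>
        curve E (p i j) = curve E (p j i) \<and> (p i j \<in> overpasses E \<or> p j i \<in> overpasses E)"
  shows "triangle E a b p (Re (\<phi> (curve E (a 1))) < Re (\<phi> (curve E (b 1))))
     (Im (\<phi> (curve E (a 2))) < Im (\<phi> (curve E (b 2)))) (p 3 1 < p 3 2)"
proof -
  let ?X = "\<lambda>t. Re (\<phi> (curve E t))" and ?Y = "\<lambda>t. Im (\<phi> (curve E t))"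
  have injphi: "z = w" if "\<phi> z = \<phi> w" for z w
    using \<phi> that unfolding plane_chart_def by (metis bij_pointE)
  have S: "strands 3 a b = {a 1..b 1} \<union> {a 2..b 2} \<union> {a 3..b 3}"
  proof -
    have "{1..3} = {1, 2, 3::nat}" by auto
    then show ?thesis unfolding strands_def by auto
  qed
  have pp: "a i < p i j \<and> p i j < b i \<and> curve E (p i j) = curve E (p j i)"
    if "(i, j) \<in> {(1, 2), (1, 3), (2, 1), (2, 3), (3, 1), (3, 2)}" for i j
  proof -
    have i: "i \<in> {1, 2, 3}" and j: "j \<in> {1, 2, 3} - {i}" using that by auto
    show ?thesis using bspec[OF bspec[OF p i] j] by simp
  qed
  have pI: "p 1 2 \<in> {a 1..b 1}" "p 1 3 \<in> {a 1..b 1}" "p 2 1 \<in> {a 2..b 2}" "p 2 3 \<in> {a 2..b 2}"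
      "p 3 1 \<in> {a 3..b 3}" "p 3 2 \<in> {a 3..b 3}" and
    pO: "a 1 < p 1 2" "p 1 2 < b 1" "a 1 < p 1 3" "p 1 3 < b 1" "a 2 < p 2 1" "p 2 1 < b 2"
      "a 2 < p 2 3" "p 2 3 < b 2" "a 3 < p 3 1" "p 3 1 < b 3" "a 3 < p 3 2" "p 3 2 < b 3"
    using pp[of 1 2] pp[of 1 3] pp[of 2 1] pp[of 2 3] pp[of 3 1] pp[of 3 2] by simp_all
  have c12: "curve E (p 2 1) = curve E (p 1 2)" and c13: "curve E (p 3 1) = curve E (p 1 3)"
    and c23: "curve E (p 3 2) = curve E (p 2 3)" using pp[of 2 1] pp[of 3 1] pp[of 3 2] by simp_all
  have d12: "{a 1..b 1} \<inter> {a 2..b 2} = {}" and d13: "{a 1..b 1} \<inter> {a 3..b 3} = {}"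
    and d23: "{a 2..b 2} \<inter> {a 3..b 3} = {}"
    using disjoint_family_onD[OF disj, of 1 2]
      disjoint_family_onD[OF disj, of 1 3]
      disjoint_family_onD[OF disj, of 2 3] by simp_all
  have no_triple: False if "x \<in> {a 1..b 1}" "y \<in> {a 2..b 2}" "z \<in> {a 3..b 3}"
    "curve E x = curve E y" "curve E y = curve E z" for x y z
    using long_diagram_no_triple[OF E that(4,5)] that(1-3) d12 d13 d23 by blast
  have i1: "inj_on (curve E) {a 1..b 1}" and i2: "inj_on (curve E) {a 2..b 2}"
    using inj by auto
  have pin: "p i j \<in> crossing_params E" if "i \<in> {1, 2, 3}" "j \<in> {1, 2, 3} - {i}" for i j
  proof -
    have "curve E (p i j) = curve E (p j i)" "p i j \<in> overpasses E \<or> p j i \<in> overpasses E"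
      using p that by blast+
    then have "curve E (p i j) \<in> curve E ` overpasses E" by (metis imageI)
    then show ?thesis by (simp add: crossing_params_def crossings_def)
  qed
  have pT: "p 1 2 \<in> crossing_params E" "p 1 3 \<in> crossing_params E" "p 2 1 \<in> crossing_params E"
      "p 2 3 \<in> crossing_params E" "p 3 1 \<in> crossing_params E" "p 3 2 \<in> crossing_params E"
    by (rule pin; simp)+
  have ne: "p 2 1 \<noteq> p 1 2" "p 3 1 \<noteq> p 1 3" "p 3 2 \<noteq> p 2 3"
    using disjoint_iff[THEN iffD1, OF d12, rule_format, OF pI(1)] pI(3)
      disjoint_iff[THEN iffD1, OF d13, rule_format, OF pI(2)] pI(5)
      disjoint_iff[THEN iffD1, OF d23, rule_format, OF pI(4)] pI(6) by metis+
  note u = other_param_unique[OF E]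
  note o = u[OF ne(1) c12] u[OF ne(2) c13] u[OF not_sym[OF ne(1)] c12[symmetric]] u[OF ne(3) c23]
    u[OF not_sym[OF ne(2)] c13[symmetric]] u[OF not_sym[OF ne(3)] c23[symmetric]]
  have n: "p 1 2 \<noteq> p 1 3" "p 2 1 \<noteq> p 2 3" "p 3 1 \<noteq> p 3 2"
    using no_triple[OF pI(1,3,5)] no_triple[OF pI(1,3,6)] no_triple[OF pI(2,4,5)] c12 c13 c23 by metis+
  have Y3: "u = p 3 1 \<or> u = p 3 2" if "u \<in> {a 3..b 3}" "?Y u = 0" for u
  proof (rule ccontr)
    assume "\<not> ?thesis"
    then have "u \<in> {a 3..<p 3 1} - {p 3 2} \<or> u \<in> {p 3 1<..b 3} - {p 3 2}" using that(1) by auto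
    then show False using bspec[OF s3(1), of u] bspec[OF s3(2), of u] that(2) by (metis less_irrefl)
  qed
  have X3: "u = p 3 1 \<or> u = p 3 2" if "u \<in> {a 3..b 3}" "?X u = 0" for u
  proof (rule ccontr)
    assume "\<not> ?thesis"
    then have "u \<in> {a 3..<p 3 2} - {p 3 1} \<or> u \<in> {p 3 2<..b 3} - {p 3 1}" using that(1) by auto
    then show False using bspec[OF s3(3), of u] bspec[OF s3(4), of u] that(2) by (metis less_irrefl)
  qed
  \<comment> \<open>Strands 1 and 2 meet at the origin of the chart only.\<close>
  have centre: "curve E u = curve E (p 1 2)" if "?X u = 0" "?Y u = 0" for u
  proof -
    have "?Y (p 1 2) = 0" "?X (p 1 2) = 0" using bspec[OF s1 pI(1)] bspec[OF s2 pI(3)] c12 by auto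
    then have "\<phi> (curve E u) = \<phi> (curve E (p 1 2))" using that by (simp add: complex_eq_iff)
    then show ?thesis by (rule injphi)
  qed
  have partner: "other_param E u \<in> strands 3 a b - {a k..b k}"
    if "u \<in> crossing_params E" "u \<in> {a k..b k}" "k \<in> {1, 2, 3}" for u k
    using other_param_on_other_strand[OF E disc _ bspec[OF inj that(3)] that(1,2)] that(3) by auto
  have T1: "crossing_params E \<inter> {a 1..b 1} = {p 1 2, p 1 3}"
  proof (rule crossing_params_pair[OF pT(1,2) pI(1,2)])
    fix u assume u: "u \<in> crossing_params E" "u \<in> {a 1..b 1}"
    let ?w = "other_param E u"
    have cw: "curve E ?w = curve E u" by (rule curve_other_param[OF E u(1)])
    have Yu: "?Y u = 0" using bspec[OF s1 u(2)] .
    have "?w \<in> {a 2..b 2} \<or> ?w \<in> {a 3..b 3}" using partner[OF u] S by auto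
    then show "u = p 1 2 \<or> u = p 1 3"
    proof
      assume "?w \<in> {a 2..b 2}"
      then have "?X u = 0" using bspec[OF s2] cw by fastforce
      then show ?thesis using inj_onD[OF i1 centre u(2) pI(1)] Yu by blast
    next
      assume w: "?w \<in> {a 3..b 3}"
      have "?Y ?w = 0" using Yu cw by simp
      then consider "?w = p 3 1" | "?w = p 3 2" using Y3[OF w] by blast
      then show ?thesis
      proof cases
        case 1
        then have "curve E u = curve E (p 1 3)" using cw c13 by metis
        then show ?thesis using inj_onD[OF i1 _ u(2) pI(2)] by blast
      next
        case 2
        then show ?thesis using no_triple[OF u(2) pI(4,6)] cw c23 by metis
      qed
    qed
  qed
  have T2: "crossing_params E \<inter> {a 2..b 2} = {p 2 1, p 2 3}"
  proof (rule crossing_params_pair[OF pT(3,4) pI(3,4)])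
    fix u assume u: "u \<in> crossing_params E" "u \<in> {a 2..b 2}"
    let ?w = "other_param E u"
    have cw: "curve E ?w = curve E u" by (rule curve_other_param[OF E u(1)])
    have Xu: "?X u = 0" using bspec[OF s2 u(2)] .
    have "?w \<in> {a 1..b 1} \<or> ?w \<in> {a 3..b 3}" using partner[OF u] S by auto
    then show "u = p 2 1 \<or> u = p 2 3"
    proof
      assume "?w \<in> {a 1..b 1}"
      then have "?Y u = 0" using bspec[OF s1] cw by fastforce
      then have "curve E u = curve E (p 2 1)" using centre Xu c12 by metis
      then show ?thesis using inj_onD[OF i2 _ u(2) pI(3)] by blast
    next
      assume w: "?w \<in> {a 3..b 3}"
      have "?X ?w = 0" using Xu cw by simp
      then consider "?w = p 3 1" | "?w = p 3 2" using X3[OF w] by blast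
      then show ?thesis
      proof cases
        case 1
        then show ?thesis using no_triple[OF pI(2) u(2) pI(5)] cw c13 by metis
      next
        case 2
        then have "curve E u = curve E (p 2 3)" using cw c23 by metis
        then show ?thesis using inj_onD[OF i2 _ u(2) pI(4)] by blast
      qed
    qed
  qed
  have T3: "crossing_params E \<inter> {a 3..b 3} = {p 3 1, p 3 2}"
  proof (rule crossing_params_pair[OF pT(5,6) pI(5,6)])
    fix u assume u: "u \<in> crossing_params E" "u \<in> {a 3..b 3}"
    let ?w = "other_param E u"
    have cw: "curve E ?w = curve E u" by (rule curve_other_param[OF E u(1)])
    have "?w \<in> {a 1..b 1} \<or> ?w \<in> {a 2..b 2}" using partner[OF u] S by auto
    then have "?Y u = 0 \<or> ?X u = 0" using bspec[OF s1, of ?w] bspec[OF s2, of ?w] cw by auto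
    then show "u = p 3 1 \<or> u = p 3 2" using Y3[OF u(2)] X3[OF u(2)] by blast
  qed
  obtain W where W: "\<And>t. (?X has_real_derivative Re (W t)) (at t)"
    "\<And>t. (?Y has_real_derivative Im (W t)) (at t)"
    "\<And>t. W t \<noteq> 0"
    "\<And>s t. curve E s = curve E t \<Longrightarrow>
       orient (W s) (W t) > 0 \<longleftrightarrow> orient (velocity E s) (velocity E t) > 0"
    "\<And>s t. curve E s = curve E t \<Longrightarrow> s \<noteq> t \<Longrightarrow> orient (W s) (W t) \<noteq> 0"
    using plane_chart_velocity[OF E \<phi>] by metis
  have W1: "Im (W u) = 0" if "a 1 < u" "u < b 1" for u
    using derivative_zero_on_strand[OF W(2) that bspec[OF s1]] .
  have W2: "Re (W u) = 0" if "a 2 < u" "u < b 2" for u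
    using derivative_zero_on_strand[OF W(1) that bspec[OF s2]] .
  have W1n: "Re (W u) \<noteq> 0" if "a 1 < u" "u < b 1" for u using W1[OF that] W(3)[of u] by (simp add: complex_eq_iff)
  have W2n: "Im (W u) \<noteq> 0" if "a 2 < u" "u < b 2" for u using W2[OF that] W(3)[of u] by (simp add: complex_eq_iff)
  have ab: "a 1 < b 1" "a 2 < b 2" using pO by auto
  let ?d1 = "?X (a 1) < ?X (b 1)" and ?d2 = "?Y (a 2) < ?Y (b 2)" and ?h = "p 3 1 < p 3 2"
  have dir1: "Re (W u) > 0 \<longleftrightarrow> ?d1" if "a 1 < u" "u < b 1" for u
    using straight_strand(1)[OF ab(1) W(1) W1n that] by simp
  have dir2: "Im (W u) > 0 \<longleftrightarrow> ?d2" if "a 2 < u" "u < b 2" for u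
    using straight_strand(1)[OF ab(2) W(2) W2n that] by simp
  have ord1: "p 1 2 < p 1 3 \<longleftrightarrow> (?X (p 1 2) < ?X (p 1 3) \<longleftrightarrow> ?d1)"
    using straight_strand(2)[OF ab(1) W(1) W1n pI(1,2) n(1)] by blast
  have ord2: "p 2 1 < p 2 3 \<longleftrightarrow> (?Y (p 2 1) < ?Y (p 2 3) \<longleftrightarrow> ?d2)"
    using straight_strand(2)[OF ab(2) W(2) W2n pI(3,4) n(2)] by blast
  have ne: "?X (p 1 2) \<noteq> ?X (p 1 3)" "?Y (p 2 1) \<noteq> ?Y (p 2 3)"
    using straight_strand(3)[OF ab(1) W(1) W1n pI(1,2) n(1)] straight_strand(3)[OF ab(2) W(2) W2n pI(3,4) n(2)] by blast+
  have z: "?X (p 1 2) = 0" "?Y (p 2 1) = 0" "?Y (p 3 1) = 0" "?X (p 3 2) = 0"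
    using bspec[OF s2 pI(3)] bspec[OF s1 pI(1)] bspec[OF s1 pI(2)] bspec[OF s2 pI(4)] c12 c13 c23 by auto
  \<comment> \<open>Just before meeting the real axis, strand 3 is in the right half plane iff it has not yet met
    the imaginary axis. It does not meet the real axis at the origin.\<close>
  have pos1: "?X (p 1 3) > 0 \<longleftrightarrow> ?h"
  proof (cases ?h)
    case True
    have "?X (p 3 1) \<ge> 0"
      by (rule nonneg_of_left[OF W(1) pO(9)], rule bspec[OF s3(3)]) (use True in auto)
    then show ?thesis using ne(1) z(1) c13 True by simp
  next
    case False
    then have "p 3 2 < p 3 1" using n by auto
    then have "?X (p 3 1) \<le> 0"
      by (rule nonpos_of_left[OF W(1)]) (rule bspec[OF s3(4)], use pO in auto)
    then show ?thesis using c13 False by simp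
  qed
  have pos2: "?Y (p 2 3) > 0 \<longleftrightarrow> ?h"
  proof (cases ?h)
    case True
    then have "?Y (p 3 2) \<ge> 0"
      by (rule nonneg_of_left[OF W(2)]) (rule bspec[OF s3(2)], use pO in auto)
    then show ?thesis using ne(2) z(2) c23 True by simp
  next
    case False
    have "?Y (p 3 2) \<le> 0"
      by (rule nonpos_of_left[OF W(2) pO(11)], rule bspec[OF s3(1)]) (use False n in auto)
    then show ?thesis using c23 False by simp
  qed
  have or12: "orient (W (p 1 2)) (W (p 2 1)) = Re (W (p 1 2)) * Im (W (p 2 1))"
    and or13: "orient (W (p 1 3)) (W (p 3 1)) = Re (W (p 1 3)) * Im (W (p 3 1))"
    and or23: "orient (W (p 2 3)) (W (p 3 2)) = - (Im (W (p 2 3)) * Re (W (p 3 2)))"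
    using W1[OF pO(1,2)] W1[OF pO(3,4)] W2[OF pO(7,8)] by (auto simp: orient_def)
  have up: "Im (W (p 3 1)) > 0"
  proof (rule derivative_pos_of_right[OF W(2)])
    show "Im (W (p 3 1)) \<noteq> 0"
      using W(5)[of "p 1 3" "p 3 1"] or13 c13 pI d13 by auto
    show "p 3 1 < (if ?h then p 3 2 else b 3)" using pO by simp
    show "?Y (p 3 1) < ?Y t" if "p 3 1 < t" "t < (if ?h then p 3 2 else b 3)" for t
    proof -
      have "t \<in> {p 3 1<..b 3} - {p 3 2}" using that pO n by (auto split: if_splits)
      then show ?thesis using bspec[OF s3(2)] z(3) by simp
    qed
  qed
  have left: "Re (W (p 3 2)) < 0"
  proof (rule derivative_neg_of_right[OF W(1)])
    show "Re (W (p 3 2)) \<noteq> 0"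
      using W(5)[of "p 2 3" "p 3 2"] or23 c23 pI d23 by auto
    show "p 3 2 < (if ?h then b 3 else p 3 1)" using pO n by auto
    show "?X t < ?X (p 3 2)" if "p 3 2 < t" "t < (if ?h then b 3 else p 3 1)" for t
    proof -
      have "t \<in> {p 3 2<..b 3} - {p 3 1}" using that pO n by (auto split: if_splits)
      then show ?thesis using bspec[OF s3(4)] z(4) by simp
    qed
  qed
  have asc12: "ascends_right E (p 1 2) \<longleftrightarrow> ?d1 = ?d2"
    using W(4)[of "p 1 2" "p 2 1"] c12 or12 dir1[OF pO(1,2)] dir2[OF pO(5,6)] W1n[OF pO(1,2)] W2n[OF pO(5,6)]
    by (auto simp: ascends_right_def o zero_less_mult_iff)
  have asc13: "ascends_right E (p 1 3) \<longleftrightarrow> ?d1"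
    using W(4)[of "p 1 3" "p 3 1"] c13 or13 dir1[OF pO(3,4)] up
    by (auto simp: ascends_right_def o zero_less_mult_iff)
  have asc23: "ascends_right E (p 2 3) \<longleftrightarrow> ?d2"
    using W(4)[of "p 2 3" "p 3 2"] c23 or23 dir2[OF pO(7,8)] left
    by (auto simp: ascends_right_def o mult_less_0_iff)
  have "\<forall>i\<in>{1, 2, 3}. \<forall>j\<in>{1, 2, 3} - {i}. a i < p i j \<and> p i j < b i \<and> other_param E (p i j) = p j i"
    using pO o by auto
  moreover have "p 1 2 < p 1 3 \<longleftrightarrow> ?d1 = ?h" "p 2 1 < p 2 3 \<longleftrightarrow> ?d2 = ?h"
    using ord1 ord2 pos1 pos2 z by auto
  ultimately show ?thesis
    unfolding triangle_def using T1 T2 T3 n asc12 asc13 asc23 by blast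
qed

lemma R3_standard_triangles:
  assumes "R3_standard \<phi> p q D D'"
  obtains a b d1 d2 where "agree_outside 3 a b D D'"
    "\<And>x. curve D x \<in> region \<phi> \<longleftrightarrow> x \<in> open_strands 3 a b"
    "\<And>x. curve D' x \<in> region \<phi> \<longleftrightarrow> x \<in> open_strands 3 a b"
    "triangle D a b p d1 d2 True" "triangle D' a b q d1 d2 False"
proof -
  from assms obtain a b where l: "local_change \<phi> 3 a b D D'"
    and inj: "\<forall>k\<in>{1, 2, 3}. inj_on (curve D) {a k..b k} \<and> inj_on (curve D') {a k..b k}"
    and s1: "\<forall>t\<in>{a 1..b 1}. Im (\<phi> (curve D t)) = 0 \<and> curve D' t = curve D t"
    and s2: "\<forall>t\<in>{a 2..b 2}. Re (\<phi> (curve D t)) = 0 \<and> curve D' t = curve D t"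
    and p: "p 3 1 < p 3 2"
    and s3: "\<forall>t\<in>{a 3..<p 3 1}. Re (\<phi> (curve D t)) > 0 \<and> Im (\<phi> (curve D t)) < 0"
     "\<forall>t\<in>{p 3 1<..<p 3 2}. Re (\<phi> (curve D t)) > 0 \<and> Im (\<phi> (curve D t)) > 0"
     "\<forall>t\<in>{p 3 2<..b 3}. Re (\<phi> (curve D t)) < 0 \<and> Im (\<phi> (curve D t)) > 0"
    and q: "q 3 2 < q 3 1"
    and s3': "\<forall>t\<in>{a 3..<q 3 2}. Re (\<phi> (curve D' t)) > 0 \<and> Im (\<phi> (curve D' t)) < 0"
     "\<forall>t\<in>{q 3 2<..<q 3 1}. Re (\<phi> (curve D' t)) < 0 \<and> Im (\<phi> (curve D' t)) < 0"
     "\<forall>t\<in>{q 3 1<..b 3}. Re (\<phi> (curve D' t)) < 0 \<and> Im (\<phi> (curve D' t)) > 0"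
    and pq: "\<forall>i\<in>{1, 2, 3}. \<forall>j\<in>{1, 2, 3} - {i}.
        p i j \<in> {a i<..<b i} \<and> q i j \<in> {a i<..<b i} \<and>
        curve D (p i j) = curve D (p j i) \<and> curve D' (q i j) = curve D' (q j i) \<and>
        (p i j \<in> overpasses D \<or> p j i \<in> overpasses D) \<and>
        (q i j \<in> overpasses D' \<longleftrightarrow> p i j \<in> overpasses D)"
    unfolding R3_standard_def by (elim exE conjE) (rule that, assumption+)
  note lc = local_change_basic[OF l] and ld = local_change_disc[OF l]
  let ?d1 = "Re (\<phi> (curve D (a 1))) < Re (\<phi> (curve D (b 1)))"
  let ?d2 = "Im (\<phi> (curve D (a 2))) < Im (\<phi> (curve D (b 2)))"
  have pts: "p 3 1 \<in> {a 3<..<b 3}" "p 3 2 \<in> {a 3<..<b 3}" "q 3 1 \<in> {a 3<..<b 3}" "q 3 2 \<in> {a 3<..<b 3}"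
  proof -
    have "(3::nat) \<in> {1, 2, 3}" "1 \<in> {1, 2, 3} - {3::nat}" "2 \<in> {1, 2, 3} - {3::nat}" by auto
    then show "p 3 1 \<in> {a 3<..<b 3}" "p 3 2 \<in> {a 3<..<b 3}" "q 3 1 \<in> {a 3<..<b 3}" "q 3 2 \<in> {a 3<..<b 3}"
      using pq by blast+
  qed
  have t: "triangle D a b p ?d1 ?d2 (p 3 1 < p 3 2)"
  proof (rule triangle_in_chart[OF lc(1,3,5) ld(1)])
    show "\<forall>k\<in>{1, 2, 3}. inj_on (curve D) {a k..b k}" using inj by blast
    show "\<forall>t\<in>{a 1..b 1}. Im (\<phi> (curve D t)) = 0" "\<forall>t\<in>{a 2..b 2}. Re (\<phi> (curve D t)) = 0"
      using s1 s2 by blast+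
    show "\<forall>t\<in>{a 3..<p 3 1} - {p 3 2}. Im (\<phi> (curve D t)) < 0" using s3(1) by blast
    show "\<forall>t\<in>{p 3 2<..b 3} - {p 3 1}. Re (\<phi> (curve D t)) < 0" using s3(3) by blast
    have "{p 3 1<..b 3} - {p 3 2} \<subseteq> {p 3 1<..<p 3 2} \<union> {p 3 2<..b 3}"
      "{a 3..<p 3 2} - {p 3 1} \<subseteq> {a 3..<p 3 1} \<union> {p 3 1<..<p 3 2}" using p by auto
    then show "\<forall>t\<in>{p 3 1<..b 3} - {p 3 2}. Im (\<phi> (curve D t)) > 0"
      "\<forall>t\<in>{a 3..<p 3 2} - {p 3 1}. Re (\<phi> (curve D t)) > 0" using s3 by blast+
    show "\<forall>i\<in>{1, 2, 3}. \<forall>j\<in>{1, 2, 3} - {i}. p i j \<in> {a i<..<b i} \<and>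
        curve D (p i j) = curve D (p j i) \<and> (p i j \<in> overpasses D \<or> p j i \<in> overpasses D)" using pq by blast
  qed
  have t': "triangle D' a b q (Re (\<phi> (curve D' (a 1))) < Re (\<phi> (curve D' (b 1))))
     (Im (\<phi> (curve D' (a 2))) < Im (\<phi> (curve D' (b 2)))) (q 3 1 < q 3 2)"
  proof (rule triangle_in_chart[OF lc(2,3,5) ld(2)])
    show "\<forall>k\<in>{1, 2, 3}. inj_on (curve D') {a k..b k}" using inj by blast
    show "\<forall>t\<in>{a 1..b 1}. Im (\<phi> (curve D' t)) = 0" "\<forall>t\<in>{a 2..b 2}. Re (\<phi> (curve D' t)) = 0"
      using s1 s2 by simp_all
    show "\<forall>t\<in>{q 3 1<..b 3} - {q 3 2}. Im (\<phi> (curve D' t)) > 0" using s3'(3) by blast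
    show "\<forall>t\<in>{a 3..<q 3 2} - {q 3 1}. Re (\<phi> (curve D' t)) > 0" using s3'(1) by blast
    have "{a 3..<q 3 1} - {q 3 2} \<subseteq> {a 3..<q 3 2} \<union> {q 3 2<..<q 3 1}"
      "{q 3 2<..b 3} - {q 3 1} \<subseteq> {q 3 2<..<q 3 1} \<union> {q 3 1<..b 3}" using q by auto
    then show "\<forall>t\<in>{a 3..<q 3 1} - {q 3 2}. Im (\<phi> (curve D' t)) < 0"
      "\<forall>t\<in>{q 3 2<..b 3} - {q 3 1}. Re (\<phi> (curve D' t)) < 0" using s3' by blast+
    show "\<forall>i\<in>{1, 2, 3}. \<forall>j\<in>{1, 2, 3} - {i}. q i j \<in> {a i<..<b i} \<and>
        curve D' (q i j) = curve D' (q j i) \<and> (q i j \<in> overpasses D' \<or> q j i \<in> overpasses D')"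
    proof (intro ballI)
      fix i j :: nat assume ij: "i \<in> {1, 2, 3}" "j \<in> {1, 2, 3} - {i}"
      then have ji: "j \<in> {1, 2, 3}" "i \<in> {1, 2, 3} - {j}" by auto
      show "q i j \<in> {a i<..<b i} \<and> curve D' (q i j) = curve D' (q j i) \<and>
        (q i j \<in> overpasses D' \<or> q j i \<in> overpasses D')"
        using bspec[OF bspec[OF pq ij(1)] ij(2)] bspec[OF bspec[OF pq ji(1)] ji(2)] by blast
    qed
  qed
  have ends: "a 1 \<in> {a 1..b 1}" "b 1 \<in> {a 1..b 1}" "a 2 \<in> {a 2..b 2}" "b 2 \<in> {a 2..b 2}"
    using lc(4)[of 1] lc(4)[of 2] by auto
  have eq: "curve D' (a 1) = curve D (a 1)" "curve D' (b 1) = curve D (b 1)"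
    "curve D' (a 2) = curve D (a 2)" "curve D' (b 2) = curve D (b 2)"
    using bspec[OF s1 ends(1)] bspec[OF s1 ends(2)] bspec[OF s2 ends(3)] bspec[OF s2 ends(4)] by auto
  have T: "triangle D a b p ?d1 ?d2 True" using t p by simp
  have T': "triangle D' a b q ?d1 ?d2 False" using t' q by (simp add: eq)
  have "agree_outside 3 a b D D'"
    by (rule local_change_agree_outside[OF l])
       (use triangle_strand_ends[OF lc(1) T] triangle_strand_ends[OF lc(2) T'] in blast)
  then show ?thesis using that ld(3,4) T T' by blast
qed

text \<open>
  A move in the opposite direction exchanges the diagrams, and with them the two values of \<open>h\<close>.
\<close>

lemma R3_move_triangles:
  assumes "R3_move \<phi> p q D D'"
  obtains a b d1 d2 h where "agree_outside 3 a b D D'"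
    "\<And>x. curve D x \<in> region \<phi> \<longleftrightarrow> x \<in> open_strands 3 a b"
    "triangle D a b p d1 d2 h" "triangle D' a b q d1 d2 (\<not> h)"
proof (cases "R3_standard \<phi> p q D D'")
  case True
  then obtain a b d1 d2 where *: "agree_outside 3 a b D D'"
    "\<And>x. curve D x \<in> region \<phi> \<longleftrightarrow> x \<in> open_strands 3 a b"
    "\<And>x. curve D' x \<in> region \<phi> \<longleftrightarrow> x \<in> open_strands 3 a b"
    "triangle D a b p d1 d2 True" "triangle D' a b q d1 d2 False"
    by (rule R3_standard_triangles) blast
  show ?thesis by (rule that[OF *(1,2,4)]) (simp_all add: *(5))
next
  case False
  then have "R3_standard \<phi> q p D' D" using assms by (simp add: R3_move_def)
  then obtain a b d1 d2 where *: "agree_outside 3 a b D' D"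
    "\<And>x. curve D' x \<in> region \<phi> \<longleftrightarrow> x \<in> open_strands 3 a b"
    "\<And>x. curve D x \<in> region \<phi> \<longleftrightarrow> x \<in> open_strands 3 a b"
    "triangle D' a b q d1 d2 True" "triangle D a b p d1 d2 False"
    by (rule R3_standard_triangles) blast
  show ?thesis by (rule that[OF agree_outside_sym[OF *(1)] *(3,5)]) (simp_all add: *(4))
qed

section \<open>Invariance under Reidemeister moves\<close>

lemma reidemeister_local_change:
  assumes "reidemeister_move \<phi> D D'"
  obtains n a b where "local_change \<phi> n a b D D'"
proof -
  have 1: "\<exists>n a b. local_change \<phi> n a b E E'" if "R1_decreasing \<phi> v E E'" for v E E'
    using that unfolding R1_decreasing_def by (elim exE conjE) (intro exI)
  have 2: "\<exists>n a b. local_change \<phi> n a b E E'" if "R2_decreasing \<phi> v w E E'" for v w E E'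
    using that unfolding R2_decreasing_def by (elim exE conjE) (intro exI)
  have 3: "\<exists>n a b. local_change \<phi> n a b E E'" if "R3_standard \<phi> p q E E'" for p q E E'
    using that unfolding R3_standard_def by (elim exE conjE) (intro exI)
  have "(\<exists>n a b. local_change \<phi> n a b D D') \<or> (\<exists>n a b. local_change \<phi> n a b D' D)"
    using assms 1 2 3 unfolding reidemeister_move_def R3_move_def by metis
  then show ?thesis using that local_change_sym by blast
qed

lemma reidemeister_region:
  assumes "reidemeister_move \<phi> D D'"
  shows "curve D' x \<in> region \<phi> \<longleftrightarrow> curve D x \<in> region \<phi>"
proof -
  obtain n a b where "local_change \<phi> n a b D D'" using reidemeister_local_change[OF assms] .
  from local_change_disc(3,4)[OF this] show ?thesis by simp
qed

text \<open>
  Arcs with a common point outside the disc of a move correspond to each other; so the values of an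
  invariant cycle match in this sense.
\<close>

definition chains_match ::
    "(complex \<Rightarrow> complex) \<Rightarrow> diagram \<Rightarrow> diagram \<Rightarrow> (real set \<Rightarrow> 'a) \<Rightarrow> (real set \<Rightarrow> 'a) \<Rightarrow> bool" where
  "chains_match \<phi> D D' c c' \<longleftrightarrow> (\<forall>x. x \<notin> crossing_params D \<longrightarrow> x \<notin> crossing_params D' \<longrightarrow>
     curve D x \<notin> region \<phi> \<longrightarrow> c' (arc_at D' x) = c (arc_at D x))"

text \<open>
  The number and the ends of the strands are quantified, so that one statement covers the three moves.
\<close>

definition totals_match ::
    "(complex \<Rightarrow> complex) \<Rightarrow> diagram \<Rightarrow> diagram \<Rightarrow> (real \<Rightarrow> 'a::ab_group_add) \<Rightarrow> (real \<Rightarrow> 'a) \<Rightarrow> bool" where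
  "totals_match \<phi> D D' f f' \<longleftrightarrow> (\<exists>n a b. agree_outside n a b D D' \<and>
     (\<forall>x. curve D x \<in> region \<phi> \<longleftrightarrow> x \<in> open_strands n a b) \<and>
     (\<forall>k\<in>{1..n}. crossing_sum D' f' {a k..b k} = crossing_sum D f {a k..b k}))"

lemma chains_match_sym:
  assumes "reidemeister_move \<phi> D D'" "chains_match \<phi> D D' c c'"
  shows "chains_match \<phi> D' D c' c"
  using assms(2) by (simp add: chains_match_def reidemeister_region[OF assms(1)])

lemma totals_match_sym:
  assumes r: "reidemeister_move \<phi> D D'" and m: "totals_match \<phi> D D' f f'"
  shows "totals_match \<phi> D' D f' f"
proof -
  from m obtain n a b where *: "agree_outside n a b D D'"
    "\<And>x. curve D x \<in> region \<phi> \<longleftrightarrow> x \<in> open_strands n a b"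
    "\<And>k. k \<in> {1..n} \<Longrightarrow> crossing_sum D' f' {a k..b k} = crossing_sum D f {a k..b k}"
    unfolding totals_match_def by blast
  show ?thesis unfolding totals_match_def
    by (intro exI[of _ n] exI[of _ a] exI[of _ b])
       (use agree_outside_sym[OF *(1)] *(2,3) reidemeister_region[OF r] in auto)
qed

lemma reidemeister_move_sym: "reidemeister_move \<phi> D D' \<Longrightarrow> reidemeister_move \<phi> D' D"
  unfolding reidemeister_move_def R3_move_def by blast

lemma agree_outside_region:
  assumes a: "agree_outside n a b D D'" and r: "\<And>x. curve D x \<in> region \<phi> \<longleftrightarrow> x \<in> open_strands n a b"
    and x: "x \<in> crossing_params D" "curve D x \<notin> region \<phi>"
  shows "x \<notin> strands n a b"
proof
  assume "x \<in> strands n a b"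
  then obtain k where k: "k \<in> {1..n}" "x \<in> {a k..b k}" by (auto simp: strands_def)
  have "x \<notin> {a k<..<b k}" using r x(2) k(1) unfolding open_strands_def by blast
  then have "x = a k \<or> x = b k" using k(2) by auto
  then show False using agree_basic(5)[OF a k(1)] x(1) by blast
qed

lemma jumps_zero_if_no_crossings:
  fixes c c' :: "real set \<Rightarrow> 'a::ab_group_add"
  assumes a: "agree_outside n a b D D'" and r: "\<And>x. curve D x \<in> region \<phi> \<longleftrightarrow> x \<in> open_strands n a b"
    and c: "chains_match \<phi> D D' c c'"
    and k: "k \<in> {1..n}" "crossing_params D' \<inter> {a k..b k} = {}"
  shows "crossing_sum D (jump D c) {a k..b k} = 0"
proof -
  have "crossing_sum D' (jump D' c') {a k..b k} = crossing_sum D (jump D c) {a k..b k}"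
    by (rule agree_strand_jumps[OF a _ k(1)]) (use c r in \<open>auto simp: chains_match_def\<close>)
  then show ?thesis using k(2) by simp
qed

lemma R1_meets:
  assumes m: "R1_decreasing \<phi> v D D'" and cyc: "is_cycle D c"
  shows "totals_match \<phi> D D' (meet D c) (meet D' c')" "cycle_parity D c v = 0"
proof -
  obtain a b s t where *: "agree_outside 1 a b D D'"
    "\<And>x. curve D x \<in> region \<phi> \<longleftrightarrow> x \<in> open_strands 1 a b"
    "kink D (a 1) (b 1) s t" "curve D s = v" "crossing_params D' \<inter> {a 1..b 1} = {}"
    using R1_decreasing_kink[OF m] by blast
  note D = agree_basic(1)[OF *(1)]
  show "cycle_parity D c v = 0" using kink_meets(2)[OF D *(3) cyc(1)] *(4) by simp
  show "totals_match \<phi> D D' (meet D c) (meet D' c')"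
    unfolding totals_match_def
    by (intro exI[of _ 1] exI[of _ a] exI[of _ b]) (use * kink_meets(1)[OF D *(3) cyc(1)] in auto)
qed

lemma R2_meets:
  fixes c c' :: "real set \<Rightarrow> 'a::ab_group_add"
  assumes m: "R2_decreasing \<phi> v1 v2 D D'" and cyc: "is_cycle D c" and c: "chains_match \<phi> D D' c c'"
  shows "totals_match \<phi> D D' (meet D c) (meet D' c')" "cycle_parity D c v1 + cycle_parity D c v2 = 0"
    "jump_at_crossing D c v1 = jump_at_crossing D c v2"
proof -
  obtain a b s1 s2 t1 t2 where *: "agree_outside 2 a b D D'"
    "\<And>x. curve D x \<in> region \<phi> \<longleftrightarrow> x \<in> open_strands 2 a b"
    "bigon D a b s1 s2 t1 t2" "curve D s1 = v1" "curve D s2 = v2"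
    "\<And>k. k \<in> {1..2} \<Longrightarrow> crossing_params D' \<inter> {a k..b k} = {}"
    using R2_decreasing_bigon[OF m] by blast
  note D = agree_basic(1)[OF *(1)]
  have j0: "crossing_sum D (jump D c) {a 1..b 1} = 0"
    by (rule jumps_zero_if_no_crossings[OF *(1,2) c _ *(6)]) auto
  note bm = bigon_meets[OF D *(3) cyc(1) j0]
  show "cycle_parity D c v1 + cycle_parity D c v2 = 0" using bm(3) *(4,5) by simp
  show "jump_at_crossing D c v1 = jump_at_crossing D c v2"
    using bigon_jump_at_crossing[OF D *(3) cyc(1) j0] unfolding *(4,5) .
  have "crossing_sum D' (meet D' c') {a k..b k} = crossing_sum D (meet D c) {a k..b k}"
    if k: "k \<in> {1..2}" for k
  proof -
    have "k = 1 \<or> k = 2" using k by auto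
    then show ?thesis using bm(1,2) *(6)[OF k] by auto
  qed
  then show "totals_match \<phi> D D' (meet D c) (meet D' c')"
    unfolding totals_match_def
    by (intro exI[of _ 2] exI[of _ a] exI[of _ b]) (use *(1,2) in blast)
qed

lemma R3_meets:
  fixes c c' :: "real set \<Rightarrow> 'a::ab_group_add"
  assumes m: "R3_move \<phi> p q D D'" and cyc: "is_cycle D c" "is_cycle D' c'" and c: "chains_match \<phi> D D' c c'"
  shows "totals_match \<phi> D D' (meet D c) (meet D' c')"
    "(i, j) \<in> triangle_corners \<Longrightarrow> cycle_parity D' c' (curve D' (q i j)) = cycle_parity D c (curve D (p i j))"
    "(\<Sum>(i, j)\<in>triangle_corners. int_scale (corner_sign p i j) (cycle_parity D c (curve D (p i j)))) = 0"
    "\<exists>l. \<forall>(i, j)\<in>triangle_corners. jump_at_crossing D' c' (curve D' (q i j)) =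
       jump_at_crossing D c (curve D (p i j)) + int_scale (corner_sign p i j) l"
proof -
  obtain a b d1 d2 h where *: "agree_outside 3 a b D D'"
    "\<And>x. curve D x \<in> region \<phi> \<longleftrightarrow> x \<in> open_strands 3 a b"
    "triangle D a b p d1 d2 h" "triangle D' a b q d1 d2 (\<not> h)"
    using R3_move_triangles[OF m] by blast
  note D = agree_basic(1)[OF *(1)] and D' = agree_basic(2)[OF *(1)]
  have ch: "c' (arc_at D' x) = c (arc_at D x)"
    if "x \<notin> open_strands 3 a b" "x \<notin> crossing_params D" "x \<notin> crossing_params D'" for x
    using c *(2) that by (auto simp: chains_match_def)
  note ends = agree_ends(1)[where c = c and c' = c', OF *(1) ch]
  note tot = agree_strand_jumps[where c = c and c' = c', OF *(1) ch]
  note pair = D *(3) D' *(4) cyc tot ends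
  have meets: "crossing_sum D' (meet D' c') {a k..b k} = crossing_sum D (meet D c) {a k..b k}"
    if "k \<in> {1..3}" for k
    by (rule triangle_pair_meets[OF D *(3) D' *(4) cyc]) (use tot ends that in auto)
  then show "totals_match \<phi> D D' (meet D c) (meet D' c')"
    unfolding totals_match_def
    by (intro exI[of _ 3] exI[of _ a] exI[of _ b]) (use *(1,2) in blast)
  have sw: "swept D' c' (a k) = swept D c (a k)" if k: "k \<in> {1..3}" for k
    by (rule agree_swept[where c = c and c' = c', OF *(1) ch meets strand_ends_not_inside(1)[OF *(1) k]])
  show "(i, j) \<in> triangle_corners \<Longrightarrow> cycle_parity D' c' (curve D' (q i j)) = cycle_parity D c (curve D (p i j))"
    by (rule triangle_pair_parity[OF D *(3) D' *(4) cyc]) (use tot ends sw in auto)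
  show "(\<Sum>(i, j)\<in>triangle_corners. int_scale (corner_sign p i j) (cycle_parity D c (curve D (p i j)))) = 0"
    by (rule triangle_parity_sum[OF D *(3) cyc(1)])
  show "\<exists>l. \<forall>(i, j)\<in>triangle_corners. jump_at_crossing D' c' (curve D' (q i j)) =
       jump_at_crossing D c (curve D (p i j)) + int_scale (corner_sign p i j) l"
    by (rule triangle_pair_jump_at_crossing[OF D *(3) D' *(4) cyc]) (use tot ends in auto)
qed

lemma reidemeister_meets:
  fixes c c' :: "real set \<Rightarrow> 'a::ab_group_add"
  assumes m: "reidemeister_move \<phi> D D'" and cyc: "is_cycle D c" "is_cycle D' c'" and c: "chains_match \<phi> D D' c c'"
  shows "totals_match \<phi> D D' (meet D c) (meet D' c')"
proof -
  note c' = chains_match_sym[OF m c]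
  note sym = totals_match_sym[OF reidemeister_move_sym[OF m]]
  from m consider v where "R1_decreasing \<phi> v D D'" | v where "R1_decreasing \<phi> v D' D"
    | v w where "R2_decreasing \<phi> v w D D'" | v w where "R2_decreasing \<phi> v w D' D"
    | p q where "R3_move \<phi> p q D D'"
    unfolding reidemeister_move_def by blast
  then show ?thesis
  proof cases
    case 1
    then show ?thesis using R1_meets cyc by blast
  next
    case 2
    then show ?thesis using R1_meets cyc sym by blast
  next
    case 3
    then show ?thesis using R2_meets(1) cyc c by blast
  next
    case 4
    then show ?thesis using R2_meets(1) cyc c' sym by blast
  next
    case 5
    then show ?thesis using R3_meets(1) cyc c by blast
  qed
qed

lemma reidemeister_outer_crossing:
  fixes c c' :: "real set \<Rightarrow> 'a::ab_group_add"
  assumes m: "reidemeister_move \<phi> D D'" and cyc: "is_cycle D c" "is_cycle D' c'" and c: "chains_match \<phi> D D' c c'"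
    and v: "v \<in> crossings D" "v \<notin> region \<phi>"
  shows "v \<in> crossings D'" "jump_at_crossing D' c' v = jump_at_crossing D c v"
    "cycle_parity D' c' v = cycle_parity D c v"
proof -
  from reidemeister_meets[OF m cyc c] obtain n a b where *: "agree_outside n a b D D'"
    "\<And>x. curve D x \<in> region \<phi> \<longleftrightarrow> x \<in> open_strands n a b"
    "\<And>k. k \<in> {1..n} \<Longrightarrow> crossing_sum D' (meet D' c') {a k..b k} =
       crossing_sum D (meet D c) {a k..b k}"
    unfolding totals_match_def by blast
  note s = crossing_at_SW_NE[OF agree_basic(1)[OF *(1)] v(1)]
  have out: "SW_NE D v \<notin> strands n a b"
    by (rule agree_outside_region[OF *(1,2) s(1)]) (simp_all add: s v)
  have ch: "c' (arc_at D' x) = c (arc_at D x)"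
    if "x \<notin> open_strands n a b" "x \<notin> crossing_params D" "x \<notin> crossing_params D'" for x
    using c *(2) that by (auto simp: chains_match_def)
  show "jump_at_crossing D' c' v = jump_at_crossing D c v"
    by (rule agree_outer_jump_and_parity(1)[where c = c and c' = c', OF *(1) ch v(1) out])
  show "cycle_parity D' c' v = cycle_parity D c v"
    by (rule agree_outer_jump_and_parity(2)[where c = c and c' = c', OF *(1) ch v(1) out *(3)])
  show "v \<in> crossings D'" using agree_outer(4,5)[OF *(1) s(1) out] s(3)
    by (simp add: crossing_params_def)
qed

text \<open>
  The weights on a strand cancel in a first move, since they belong to one crossing, and in a second
  move, where \<open>\<pi>\<close> takes the same value at both crossings. In a third move the two changes on a strand
  cancel.
\<close>

lemma quasi_index_totals:
  fixes \<pi> :: "diagram \<Rightarrow> complex \<Rightarrow> 'a::ab_group_add"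
  assumes q: "quasi_index K \<pi>" and K: "D \<in> K" "D' \<in> K" and m: "reidemeister_move \<phi> D D'"
  shows "totals_match \<phi> D D' (weight D (\<pi> D)) (weight D' (\<pi> D'))"
proof -
  have r1: "totals_match \<phi> E E' (weight E (\<pi> E)) (weight E' (\<pi> E'))"
    if r: "R1_decreasing \<phi> v E E'" for v E E'
  proof -
    obtain a b s t where *: "agree_outside 1 a b E E'"
      "\<And>x. curve E x \<in> region \<phi> \<longleftrightarrow> x \<in> open_strands 1 a b"
      "kink E (a 1) (b 1) s t" "curve E s = v" "crossing_params E' \<inter> {a 1..b 1} = {}"
      using R1_decreasing_kink[OF r] by blast
    show ?thesis unfolding totals_match_def
      by (intro exI[of _ 1] exI[of _ a] exI[of _ b])
         (use * kink_weights[OF agree_basic(1)[OF *(1)] *(3)] in auto)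
  qed
  have r2: "totals_match \<phi> E E' (weight E (\<pi> E)) (weight E' (\<pi> E'))"
    if r: "R2_decreasing \<phi> v w E E'" and EK: "E \<in> K" "E' \<in> K" for v w E E'
  proof -
    obtain a b s1 s2 t1 t2 where *: "agree_outside 2 a b E E'"
      "\<And>x. curve E x \<in> region \<phi> \<longleftrightarrow> x \<in> open_strands 2 a b"
      "bigon E a b s1 s2 t1 t2" "curve E s1 = v" "curve E s2 = w"
      "\<And>k. k \<in> {1..2} \<Longrightarrow> crossing_params E' \<inter> {a k..b k} = {}"
      using R2_decreasing_bigon[OF r] by blast
    have "\<pi> E v = \<pi> E w" using q r EK unfolding quasi_index_def by blast
    then have "\<pi> E (curve E s1) = \<pi> E (curve E s2)" by (simp only: *(4,5))
    note bw = bigon_weights[OF agree_basic(1)[OF *(1)] *(3) this]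
    have "crossing_sum E' (weight E' (\<pi> E')) {a k..b k} =
        crossing_sum E (weight E (\<pi> E)) {a k..b k}" if k: "k \<in> {1..2}" for k
    proof -
      have "k = 1 \<or> k = 2" using k by auto
      then show ?thesis using bw *(6)[OF k] by auto
    qed
    then show ?thesis unfolding totals_match_def
      by (intro exI[of _ 2] exI[of _ a] exI[of _ b]) (use *(1,2) in blast)
  qed
  note sym = totals_match_sym[OF reidemeister_move_sym[OF m]]
  from m consider v where "R1_decreasing \<phi> v D D'" | v where "R1_decreasing \<phi> v D' D"
    | v w where "R2_decreasing \<phi> v w D D'" | v w where "R2_decreasing \<phi> v w D' D"
    | p q where "R3_move \<phi> p q D D'"
    unfolding reidemeister_move_def by blast
  then show ?thesis
  proof cases
    case 1
    then show ?thesis by (rule r1)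
  next
    case 2
    then show ?thesis by (rule sym[OF r1])
  next
    case 3
    then show ?thesis using r2 K by blast
  next
    case 4
    show ?thesis by (rule sym[OF r2[OF 4 K(2,1)]])
  next
    case r: (5 p q)
    obtain a b d1 d2 h where *: "agree_outside 3 a b D D'"
      "\<And>x. curve D x \<in> region \<phi> \<longleftrightarrow> x \<in> open_strands 3 a b"
      "triangle D a b p d1 d2 h" "triangle D' a b q d1 d2 (\<not> h)"
      using R3_move_triangles[OF r] by blast
    obtain l where l: "\<forall>(i, j)\<in>triangle_corners.
        \<pi> D' (curve D' (q i j)) = \<pi> D (curve D (p i j)) + int_scale (corner_sign p i j) l"
      using q K r unfolding quasi_index_def by blast
    have "crossing_sum D' (weight D' (\<pi> D')) {a k..b k} =
        crossing_sum D (weight D (\<pi> D)) {a k..b k}" if k: "k \<in> {1..3}" for k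
      by (rule triangle_pair_weights[OF agree_basic(1)[OF *(1)] *(3) agree_basic(2)[OF *(1)] *(4) l k])
    then show ?thesis unfolding totals_match_def
      by (intro exI[of _ 3] exI[of _ a] exI[of _ b]) (use *(1,2) in blast)
  qed
qed

lemma quasi_index_chains_match:
  fixes \<pi> :: "diagram \<Rightarrow> complex \<Rightarrow> 'a::ab_group_add"
  assumes q: "quasi_index K \<pi>" and K: "D \<in> K" "D' \<in> K" and m: "reidemeister_move \<phi> D D'"
  shows "chains_match \<phi> D D' (cycle_of_index \<pi> \<rho> D) (cycle_of_index \<pi> \<rho> D')"
proof -
  from quasi_index_totals[OF assms] obtain n a b where *: "agree_outside n a b D D'"
    "\<And>x. curve D x \<in> region \<phi> \<longleftrightarrow> x \<in> open_strands n a b"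
    "\<And>k. k \<in> {1..n} \<Longrightarrow> crossing_sum D' (weight D' (\<pi> D')) {a k..b k} =
       crossing_sum D (weight D (\<pi> D)) {a k..b k}"
    unfolding totals_match_def by blast
  have "\<pi> D' (curve D u) = \<pi> D (curve D u)" if u: "u \<in> crossing_params D" "u \<notin> strands n a b" for u
  proof -
    have "curve D u \<in> crossings D" using u(1) by (simp add: crossing_params_def)
    moreover have "curve D u \<notin> region \<phi>" using *(2) u(2) open_strands_subset by blast
    ultimately have "passive_pair D D' (curve D u) (curve D u)" using m unfolding passive_pair_def by blast
    then show ?thesis using q K unfolding quasi_index_def by metis
  qed
  then show ?thesis unfolding chains_match_def
    using agree_cycle_of_index[OF *(1) _ *(3)] *(2) by blast
qed

lemma invariant_cycle_chains_match:
  assumes inv: "invariant_cycle K \<delta>" and K: "D \<in> K" "D' \<in> K" and m: "reidemeister_move \<phi> D D'"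
  shows "chains_match \<phi> D D' (\<delta> D) (\<delta> D')"
  unfolding chains_match_def
proof (intro allI impI)
  fix x assume x: "x \<notin> crossing_params D" "x \<notin> crossing_params D'" "curve D x \<notin> region \<phi>"
  have "arc_at D x \<in> arcs D" "arc_at D' x \<in> arcs D'" "x \<in> arc_at D x \<inter> arc_at D' x"
    using x by (auto simp: arcs_eq arc_at_self)
  then have "arc_pair D D' (arc_at D x) (arc_at D' x)"
    unfolding arc_pair_def using m x(3) by blast
  then show "\<delta> D' (arc_at D' x) = \<delta> D (arc_at D x)" using inv K unfolding invariant_cycle_def by metis
qed

section \<open>The two constructions\<close>

lemma long_virtual_knot_long_diagram:
  assumes "long_virtual_knot K" "D \<in> K"
  shows "long_diagram D"
proof -
  from assms obtain D0 where D0: "long_diagram D0" "equivclp diagram_move D0 D"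
    by (auto simp: long_virtual_knot_def)
  have both: "long_diagram E \<and> long_diagram E'" if "diagram_move E E'" for E E'
  proof -
    from that consider H r where "isotopy_move H r E E'" | "detour_move E E'" | \<phi> where "reidemeister_move \<phi> E E'"
      unfolding diagram_move_def by blast
    then show ?thesis
    proof cases
      case 3
      obtain n a b where "local_change \<phi> n a b E E'" using reidemeister_local_change[OF 3] .
      then show ?thesis by (simp add: local_change_def)
    qed (auto simp: isotopy_move_def detour_move_def)
  qed
  from D0(2,1) show ?thesis by (induction rule: equivclp_induct) (use both in blast)+
qed

lemma isotopy_arc_pair:
  assumes "isotopy_move H r D D'" "a \<in> arcs D"
  shows "arc_pair D D' a (r ` a)"
proof -
  note code = isotopy_same_code(1)[OF assms(1)]
  from assms(2) obtain x where x: "x \<notin> crossing_params D" "a = arc_at D x" by (auto simp: arcs_eq)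
  then have "r ` a \<in> arcs D'" using code_arc_at[OF code x(1)] unfolding arcs_eq by force
  then show ?thesis using assms unfolding arc_pair_def by blast
qed

lemma detour_arc_pair:
  assumes "detour_move D D'" "a \<in> arcs D"
  shows "arc_pair D D' a (id ` a)"
proof -
  note code = detour_same_code(1)[OF assms(1)]
  from assms(2) obtain x where x: "x \<notin> crossing_params D" "a = arc_at D x" by (auto simp: arcs_eq)
  then have "a \<in> arcs D'" using code_arc_at[OF code x(1)] unfolding arcs_eq by force
  then show ?thesis using assms unfolding arc_pair_def by simp
qed

lemma passive_pair_invariant_cycle:
  fixes \<delta> :: "diagram \<Rightarrow> real set \<Rightarrow> 'a::ab_group_add"
  assumes K: "long_virtual_knot K" and inv: "invariant_cycle K \<delta>" and D: "D \<in> K" "D' \<in> K"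
    and pair: "passive_pair D D' v v'"
  shows "v \<in> crossings D" "v' \<in> crossings D'"
    "jump_at_crossing D' (\<delta> D') v' = jump_at_crossing D (\<delta> D) v"
    "cycle_parity D' (\<delta> D') v' = cycle_parity D (\<delta> D) v"
proof -
  show v: "v \<in> crossings D" using pair by (simp add: passive_pair_def)
  note s = crossing_at_SW_NE[OF long_virtual_knot_long_diagram[OF K D(1)] v]
  have eq: "\<delta> D a = \<delta> D' a'" if "arc_pair D D' a a'" for a a'
    using inv D that unfolding invariant_cycle_def by blast
  have cyc: "is_cycle D (\<delta> D)" "is_cycle D' (\<delta> D')" using inv D by (auto simp: invariant_cycle_def)
  have coded: "curve D' (r (SW_NE D v)) \<in> crossings D'" if "same_code r D D'" for r
    using code_basic(6)[OF that] s(1) by (auto simp: crossing_params_def)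
  from pair consider (iso) H r where "isotopy_move H r D D'" "v' = H 1 v"
    | (detour) "detour_move D D'" "v' = v"
    | (reid) \<phi> where "reidemeister_move \<phi> D D'" "v \<notin> region \<phi>" "v' = v"
    unfolding passive_pair_def by blast
  then have "v' \<in> crossings D' \<and> jump_at_crossing D' (\<delta> D') v' = jump_at_crossing D (\<delta> D) v \<and>
    cycle_parity D' (\<delta> D') v' = cycle_parity D (\<delta> D) v"
  proof cases
    case iso
    note code = isotopy_same_code(1)[OF iso(1)]
    have v': "v' = curve D' (r (SW_NE D v))" using iso(2) isotopy_same_code(2)[OF iso(1)] s(3) by simp
    show ?thesis unfolding v'
      using coded[OF code] code_jump_and_parity[where c = "\<delta> D" and c' = "\<delta> D'", OF code eq[OF isotopy_arc_pair[OF iso(1)]] v] by blast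
  next
    case detour
    note code = detour_same_code(1)[OF detour(1)]
    have v': "v' = curve D' (id (SW_NE D v))" using detour(2) detour_same_code(2)[OF detour(1) s(1)] s(3) by simp
    show ?thesis unfolding v'
      using coded[OF code] code_jump_and_parity[where c = "\<delta> D" and c' = "\<delta> D'", OF code eq[OF detour_arc_pair[OF detour(1)]] v] by blast
  next
    case reid
    show ?thesis unfolding reid(3)
      using reidemeister_outer_crossing[OF reid(1) cyc invariant_cycle_chains_match[OF inv D reid(1)] v reid(2)] by blast
  qed
  then show "v' \<in> crossings D'" "jump_at_crossing D' (\<delta> D') v' = jump_at_crossing D (\<delta> D) v"
    "cycle_parity D' (\<delta> D') v' = cycle_parity D (\<delta> D) v" by auto
qed

lemma R2_reidemeister: "R2_decreasing \<phi> v w D D' \<Longrightarrow> reidemeister_move \<phi> D D'"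
  and R3_reidemeister: "R3_move \<phi> p q D D' \<Longrightarrow> reidemeister_move \<phi> D D'"
  unfolding reidemeister_move_def by blast+

lemma quasi_index_of_cycle:
  fixes \<delta> :: "diagram \<Rightarrow> real set \<Rightarrow> 'a::ab_group_add"
  assumes K: "long_virtual_knot K" and inv: "invariant_cycle K \<delta>"
  shows "quasi_index K (\<lambda>D. jump_at_crossing D (\<delta> D))"
proof -
  have cyc: "is_cycle D (\<delta> D)" if "D \<in> K" for D using inv that by (simp add: invariant_cycle_def)
  show ?thesis
    unfolding quasi_index_def
  proof (intro conjI ballI allI impI)
    fix D D' v v' assume "D \<in> K" "D' \<in> K" "passive_pair D D' v v'"
    then show "jump_at_crossing D (\<delta> D) v = jump_at_crossing D' (\<delta> D') v'"
      using passive_pair_invariant_cycle(3)[OF K inv] by metis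
  next
    fix D D' \<phi> v w assume "D \<in> K" "D' \<in> K" "R2_decreasing \<phi> v w D D'"
    then show "jump_at_crossing D (\<delta> D) v = jump_at_crossing D (\<delta> D) w"
      using R2_meets(3) cyc invariant_cycle_chains_match[OF inv _ _ R2_reidemeister] by blast
  next
    fix D D' \<phi> p q assume "D \<in> K" "D' \<in> K" "R3_move \<phi> p q D D'"
    then show "\<exists>l. \<forall>(i, j)\<in>triangle_corners. jump_at_crossing D' (\<delta> D') (curve D' (q i j)) =
           jump_at_crossing D (\<delta> D) (curve D (p i j)) + int_scale (corner_sign p i j) l"
      using R3_meets(4) cyc invariant_cycle_chains_match[OF inv _ _ R3_reidemeister] by blast
  qed
qed

lemma R3_corner_crossings:
  assumes "R3_move \<phi> p q D D'" "(i, j) \<in> triangle_corners"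
  shows "curve D (p i j) \<in> crossings D" "curve D' (q i j) \<in> crossings D'"
proof -
  obtain a b d1 d2 h where *: "agree_outside 3 a b D D'"
    "triangle D a b p d1 d2 h" "triangle D' a b q d1 d2 (\<not> h)"
    using R3_move_triangles[OF assms(1)] by metis
  show "curve D (p i j) \<in> crossings D" "curve D' (q i j) \<in> crossings D'"
    using assms(2) triangle_basic(1,2,4)[OF agree_basic(1)[OF *(1)] *(2)]
      triangle_basic(1,2,4)[OF agree_basic(2)[OF *(1)] *(3)]
    by (auto simp: triangle_corners_def crossing_params_def)
qed

text \<open>
  The family \<open>P\<close> is prescribed at crossings only.
\<close>

lemma oriented_parity_of_cycle:
  fixes \<delta> :: "diagram \<Rightarrow> real set \<Rightarrow> 'a::ab_group_add"
  assumes K: "long_virtual_knot K" and inv: "invariant_cycle K \<delta>"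
    and P: "\<And>D v. D \<in> K \<Longrightarrow> v \<in> crossings D \<Longrightarrow> P D v = cycle_parity D (\<delta> D) v"
  shows "oriented_parity K P"
proof -
  have cyc: "is_cycle D (\<delta> D)" if "D \<in> K" for D using inv that by (simp add: invariant_cycle_def)
  show ?thesis
    unfolding oriented_parity_def
  proof (intro conjI ballI allI impI)
    fix D D' v v' assume D: "D \<in> K" "D' \<in> K" and "passive_pair D D' v v' \<or> active_pair D D' v v'"
    then show "P D v = P D' v'"
    proof (elim disjE)
      assume "passive_pair D D' v v'"
      then show ?thesis using passive_pair_invariant_cycle[OF K inv D] P D by metis
    next
      assume "active_pair D D' v v'"
      then obtain \<phi> p q i j where r: "R3_move \<phi> p q D D'" and ij: "(i, j) \<in> triangle_corners"
        and v: "v = curve D (p i j)" "v' = curve D' (q i j)"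
        unfolding active_pair_def by blast
      show ?thesis
        unfolding v P[OF D(1) R3_corner_crossings(1)[OF r ij]] P[OF D(2) R3_corner_crossings(2)[OF r ij]]
        using R3_meets(2)[OF r cyc[OF D(1)] cyc[OF D(2)] invariant_cycle_chains_match[OF inv D R3_reidemeister[OF r]] ij]
        by simp
    qed
  next
    fix D D' \<phi> v assume D: "D \<in> K" "D' \<in> K" and r: "R1_decreasing \<phi> v D D'"
    have "v \<in> crossings D" using r unfolding R1_decreasing_def by blast
    then show "P D v = 0" using R1_meets(2)[OF r cyc[OF D(1)]] P D by simp
  next
    fix D D' \<phi> v w assume D: "D \<in> K" "D' \<in> K" and r: "R2_decreasing \<phi> v w D D'"
    obtain a b s1 s2 t1 t2 where *: "agree_outside 2 a b D D'"
      "bigon D a b s1 s2 t1 t2" "curve D s1 = v" "curve D s2 = w"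
      using R2_decreasing_bigon[OF r] by metis
    have "v \<in> crossings D" "w \<in> crossings D"
      using bigon_basic(1,2)[OF agree_basic(1)[OF *(1)] *(2)] *(3,4) by (auto simp: crossing_params_def)
    then show "P D v + P D w = 0"
      using R2_meets(2)[OF r cyc[OF D(1)] invariant_cycle_chains_match[OF inv D R2_reidemeister[OF r]]] P D by simp
  next
    fix D D' \<phi> p q assume D: "D \<in> K" "D' \<in> K" and r: "R3_move \<phi> p q D D'"
    have "(\<Sum>(i, j)\<in>triangle_corners. int_scale (corner_sign p i j) (P D (curve D (p i j)))) =
      (\<Sum>(i, j)\<in>triangle_corners. int_scale (corner_sign p i j) (cycle_parity D (\<delta> D) (curve D (p i j))))"
      using P[OF D(1) R3_corner_crossings(1)[OF r]] by (intro sum.cong) auto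
    then show "(\<Sum>(i, j)\<in>triangle_corners. int_scale (corner_sign p i j) (P D (curve D (p i j)))) = 0"
      using R3_meets(3)[OF r cyc[OF D(1)] cyc[OF D(2)] invariant_cycle_chains_match[OF inv D R3_reidemeister[OF r]]]
      by simp
  qed
qed

lemma invariant_cycle_of_index:
  fixes \<pi> :: "diagram \<Rightarrow> complex \<Rightarrow> 'a::ab_group_add"
  assumes K: "long_virtual_knot K" and q: "quasi_index K \<pi>"
  shows "invariant_cycle K (cycle_of_index \<pi> \<rho>)"
  unfolding invariant_cycle_def
proof (intro conjI ballI allI impI)
  fix D assume "D \<in> K"
  then show "is_cycle D (cycle_of_index \<pi> \<rho> D)"
    by (rule is_cycle_cycle_of_index[OF long_virtual_knot_long_diagram[OF K]])
next
  fix D D' a a' assume D: "D \<in> K" "D' \<in> K" and pair: "arc_pair D D' a a'"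
  have a: "a \<in> arcs D" "a' \<in> arcs D'" using pair by (auto simp: arc_pair_def)
  have p: "\<pi> D v = \<pi> D' v'" if "passive_pair D D' v v'" for v v'
    using q D that unfolding quasi_index_def by blast
  from pair consider (iso) H r where "isotopy_move H r D D'" "a' = r ` a"
    | (detour) "detour_move D D'" "a' = a"
    | (reid) \<phi> t where "reidemeister_move \<phi> D D'" "t \<in> a" "t \<in> a'" "curve D t \<notin> region \<phi>"
    unfolding arc_pair_def by blast
  then show "cycle_of_index \<pi> \<rho> D a = cycle_of_index \<pi> \<rho> D' a'"
  proof cases
    case iso
    have "\<pi> D' (curve D' (r u)) = \<pi> D (curve D u)" if "u \<in> crossing_params D" for u
    proof -
      have "passive_pair D D' (curve D u) (H 1 (curve D u))"
        using iso(1) that unfolding passive_pair_def crossing_params_def by blast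
      then show ?thesis using p isotopy_same_code(2)[OF iso(1)] by metis
    qed
    then show ?thesis unfolding iso(2)
      using code_cycle_of_index[OF isotopy_same_code(1)[OF iso(1)] _ a(1), of \<pi> \<rho>] by metis
  next
    case detour
    have "\<pi> D' (curve D' (id u)) = \<pi> D (curve D u)" if "u \<in> crossing_params D" for u
    proof -
      have "passive_pair D D' (curve D u) (curve D u)"
        using detour(1) that unfolding passive_pair_def crossing_params_def by blast
      then show ?thesis using p detour_same_code(2)[OF detour(1) that] by simp
    qed
    then have "cycle_of_index \<pi> \<rho> D' (id ` a) = cycle_of_index \<pi> \<rho> D a"
      by (rule code_cycle_of_index[OF detour_same_code(1)[OF detour(1)] _ a(1)])
    then show ?thesis unfolding detour(2) by simp
  next
    case reid
    show ?thesis
      using quasi_index_chains_match[OF q D reid(1), of \<rho>] reid(4) arc_eq_arc_at[OF a(1) reid(2)]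
        arc_eq_arc_at[OF a(2) reid(3)] unfolding chains_match_def by metis
  qed
qed

text \<open>
  The value on the first arc. The choice of the point does not matter, and a point exists
  because the diagram has finitely many crossings.
\<close>

definition initial_value :: "(diagram \<Rightarrow> real set \<Rightarrow> 'a) \<Rightarrow> diagram \<Rightarrow> 'a" where
  "initial_value \<delta> D = \<delta> D (arc_at D (SOME x. \<forall>u\<in>crossing_params D. x < u))"

lemma initial_value_eq:
  assumes D: "long_diagram D" and x: "\<And>u. u \<in> crossing_params D \<Longrightarrow> x < u"
  shows "initial_value \<delta> D = \<delta> D (arc_at D x)"
proof -
  define y where "y = (SOME x. \<forall>u\<in>crossing_params D. x < u)"
  have y: "\<forall>u\<in>crossing_params D. y < u"
    unfolding y_def by (rule someI[of _ x]) (use x in blast)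
  have "arc_at D (min x y) = arc_at D (max x y)"
    by (rule arc_at_cong) (use x y in \<open>fastforce+\<close>)
  then have "arc_at D x = arc_at D y" by (auto simp: min_def max_def split: if_splits)
  then show ?thesis by (simp add: initial_value_def y_def)
qed

lemma far_left:
  assumes "finite (T :: real set)"
  obtains x where "\<And>u. u \<in> T \<Longrightarrow> x < u" "x < m"
proof -
  have fin: "finite (insert m T)" using assms by simp
  have "Min (insert m T) - 1 < u" if "u \<in> insert m T" for u
    using Min_le[OF fin that] by simp
  then show ?thesis using that[of "Min (insert m T) - 1"] by blast
qed

text \<open>
  The first arcs of the two diagrams contain a common point far to the left, which is outside the
  region of the move.
\<close>

lemma initial_value_invariant:
  assumes K: "long_virtual_knot K" and inv: "invariant_cycle K \<delta>" and D: "D \<in> K" "D' \<in> K"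
    and m: "diagram_move D D'"
  shows "initial_value \<delta> D = initial_value \<delta> D'"
proof -
  have lD: "long_diagram D" "long_diagram D'" using long_virtual_knot_long_diagram[OF K] D by auto
  note fin = finite_crossing_params[OF lD(1)] finite_crossing_params[OF lD(2)]
  have eq: "\<delta> D a = \<delta> D' a'" if "arc_pair D D' a a'" for a a'
    using inv D that unfolding invariant_cycle_def by blast
  have coded: "initial_value \<delta> D = initial_value \<delta> D'"
    if code: "same_code r D D'" and pair: "\<And>a. a \<in> arcs D \<Longrightarrow> arc_pair D D' a (r ` a)" for r
  proof -
    obtain x where x: "\<And>u. u \<in> crossing_params D \<Longrightarrow> x < u" using far_left[OF fin(1)] by metis
    then have xn: "x \<notin> crossing_params D" by blast
    have "r x < u" if "u \<in> crossing_params D'" for u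
      using that x code_basic(3,6)[OF code] by (auto simp: strict_mono_less)
    moreover have "\<delta> D (arc_at D x) = \<delta> D' (arc_at D' (r x))"
      unfolding code_arc_at(2)[OF code xn] using xn by (intro eq pair) (simp add: arcs_eq)
    ultimately show ?thesis using initial_value_eq[OF lD(1) x, of \<delta>] initial_value_eq[OF lD(2), of "r x" \<delta>] by simp
  qed
  from m consider (iso) H r where "isotopy_move H r D D'" | (detour) "detour_move D D'"
    | (reid) \<phi> where "reidemeister_move \<phi> D D'"
    unfolding diagram_move_def by blast
  then show ?thesis
  proof cases
    case iso
    then show ?thesis using coded isotopy_same_code(1) isotopy_arc_pair by blast
  next
    case detour
    then show ?thesis using coded detour_same_code(1) detour_arc_pair by blast
  next
    case reid
    obtain n a b where l: "local_change \<phi> n a b D D'" using reidemeister_local_change[OF reid] .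
    have "finite (crossing_params D \<union> crossing_params D' \<union> a ` {1..n})" using fin by simp
    then obtain x where x: "\<And>u. u \<in> crossing_params D \<union> crossing_params D' \<union> a ` {1..n} \<Longrightarrow> x < u"
      by (rule far_left) blast
    have "x \<notin> open_strands n a b"
    proof
      assume "x \<in> open_strands n a b"
      then obtain k where "k \<in> {1..n}" "a k < x" by (auto simp: open_strands_def)
      then show False using x[of "a k"] by auto
    qed
    then have "curve D x \<notin> region \<phi>" using local_change_disc(3)[OF l] by blast
    moreover have "x \<notin> crossing_params D" "x \<notin> crossing_params D'" using x by blast+
    ultimately have "\<delta> D' (arc_at D' x) = \<delta> D (arc_at D x)"
      using invariant_cycle_chains_match[OF inv D reid] unfolding chains_match_def by blast
    then show ?thesis using initial_value_eq[OF lD(1), of x \<delta>] initial_value_eq[OF lD(2), of x \<delta>] x by simp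
  qed
qed

lemma initial_value_constant:
  assumes K: "long_virtual_knot K" and inv: "invariant_cycle K \<delta>"
  obtains \<rho> where "\<And>D. D \<in> K \<Longrightarrow> initial_value \<delta> D = \<rho>"
proof -
  from K obtain D0 where K0: "K = {D'. equivclp diagram_move D0 D'}" by (auto simp: long_virtual_knot_def)
  have "initial_value \<delta> D = initial_value \<delta> D0" if "D \<in> K" for D
  proof -
    have "equivclp diagram_move D0 D" using that K0 by simp
    then show ?thesis
    proof (induction rule: equivclp_induct)
      case base
      show ?case ..
    next
      case (step E E')
      have E: "E \<in> K" "E' \<in> K" using step(1,2) K0 by (auto intro: equivclp_into_equivclp)
      from step(2) show ?case
        using initial_value_invariant[OF K inv E] initial_value_invariant[OF K inv E(2,1)] step(3) by metis
    qed
  qed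
  then show ?thesis by (rule that)
qed

theorem theorem10:
  fixes K :: "diagram set"
  assumes "long_virtual_knot K"
  shows
    "(\<forall>\<delta> :: diagram \<Rightarrow> real set \<Rightarrow> 'a::ab_group_add. invariant_cycle K \<delta> \<longrightarrow>
        (\<forall>D\<in>K. \<forall>v\<in>crossings D.
           \<delta> D (arc_NE D v) - \<delta> D (arc_SW D v) = \<delta> D (arc_SE D v) - \<delta> D (arc_NW D v)) \<and>
        quasi_index K (\<lambda>D v. \<delta> D (arc_NE D v) - \<delta> D (arc_SW D v)) \<and>
        (\<exists>\<rho>. \<forall>D\<in>K. \<forall>a\<in>arcs D.
           \<delta> D a = cycle_of_index (\<lambda>D v. \<delta> D (arc_NE D v) - \<delta> D (arc_SW D v)) \<rho> D a)) \<and>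
     (\<forall>(\<pi> :: diagram \<Rightarrow> complex \<Rightarrow> 'a) \<rho>. quasi_index K \<pi> \<longrightarrow>
        invariant_cycle K (cycle_of_index \<pi> \<rho>) \<and>
        oriented_parity K (parity_of_index \<pi> \<rho>))"
proof (intro conjI allI impI)
  fix \<delta> :: "diagram \<Rightarrow> real set \<Rightarrow> 'a" assume inv: "invariant_cycle K \<delta>"
  have long: "long_diagram D" if "D \<in> K" for D using long_virtual_knot_long_diagram[OF assms that] .
  show "\<forall>D\<in>K. \<forall>v\<in>crossings D.
     \<delta> D (arc_NE D v) - \<delta> D (arc_SW D v) = \<delta> D (arc_SE D v) - \<delta> D (arc_NW D v)"
  proof (intro ballI)
    fix D v assume "D \<in> K" "v \<in> crossings D"
    then have "\<delta> D (arc_SW D v) + \<delta> D (arc_SE D v) = \<delta> D (arc_NW D v) + \<delta> D (arc_NE D v)"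
      using inv by (simp add: invariant_cycle_def is_cycle_def)
    then show "\<delta> D (arc_NE D v) - \<delta> D (arc_SW D v) = \<delta> D (arc_SE D v) - \<delta> D (arc_NW D v)"
      by (simp add: algebra_simps)
  qed
  show "quasi_index K (\<lambda>D v. \<delta> D (arc_NE D v) - \<delta> D (arc_SW D v))"
    by (rule quasi_index_of_cycle[OF assms inv])
  obtain \<rho> where \<rho>: "\<And>D. D \<in> K \<Longrightarrow> initial_value \<delta> D = \<rho>"
    using initial_value_constant[OF assms inv] by blast
  have "\<delta> D a = cycle_of_index (\<lambda>D v. \<delta> D (arc_NE D v) - \<delta> D (arc_SW D v)) \<rho> D a"
    if D: "D \<in> K" and a: "a \<in> arcs D" for D a
  proof -
    obtain x where x: "\<And>u. u \<in> crossing_params D \<Longrightarrow> x < u"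
      using far_left[OF finite_crossing_params[OF long[OF D]]] by metis
    have "is_cycle D (\<delta> D)" using inv D by (simp add: invariant_cycle_def)
    from cycle_eq_cycle_of_index[of D \<delta>, OF long[OF D] this x a]
    show ?thesis using initial_value_eq[OF long[OF D] x, of \<delta>] \<rho>[OF D] by simp
  qed
  then show "\<exists>\<rho>. \<forall>D\<in>K. \<forall>a\<in>arcs D.
     \<delta> D a = cycle_of_index (\<lambda>D v. \<delta> D (arc_NE D v) - \<delta> D (arc_SW D v)) \<rho> D a" by blast
next
  fix \<pi> :: "diagram \<Rightarrow> complex \<Rightarrow> 'a" and \<rho> assume q: "quasi_index K \<pi>"
  show inv: "invariant_cycle K (cycle_of_index \<pi> \<rho>)" by (rule invariant_cycle_of_index[OF assms q])
  show "oriented_parity K (parity_of_index \<pi> \<rho>)"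
    by (rule oriented_parity_of_cycle[OF assms inv])
       (rule parity_of_index_eq_cycle_parity[OF long_virtual_knot_long_diagram[OF assms]])
qed

end
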